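(* Let $V:\mathbb{Z}\to\mathbb{R}$ be bounded, let $H$ be the operator on $\ell^2(\mathbb{Z})$ given by $[H\psi](n)=\psi(n+1)+\psi(n-1)+V(n)\psi(n)$, and let $K\ge 4$ be such that $\sigma(H)\subseteq[-K+1,K-1]$. Suppose that, for some $C\in(0,\infty)$ and $\alpha\in(0,1)$, we have, as $T\to\infty$, $$\int_{-K}^K\Big(\max_{1\le n\le CT^\alpha}\big\|\Phi\big(n,E+\tfrac{i}{T}\big)\big\|^2\Big)^{-1}dE=O(T^{-m})$$ and $$\int_{-K}^K\Big(\max_{1\le -n\le CT^\alpha}\big\|\Phi\big(n,E+\tfrac{i}{T}\big)\big\|^2\Big)^{-1}dE=O(T^{-m})$$ for every $m\ge 1$ (the maxima being over integers $n$). Then $\alpha_u^+\le\alpha$. In particular, $\beta^+_{\delta_1}(p)\le\alpha$ for every $p>0$.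
   Context: Transfer matrices: for $z\in\mathbb{C}$, $m\in\mathbb{Z}$ put $T(m,z)=\begin{pmatrix} z-V(m)&-1\\1&0\end{pmatrix}$, and $\Phi(n,z)=T(n,z)\cdots T(1,z)$ for $n\ge1$, $\Phi(0,z)=\mathrm{Id}$, $\Phi(n,z)=[T(n+1,z)]^{-1}\cdots[T(0,z)]^{-1}$ for $n\le-1$. Thus $(u(n+1),u(n))^{\top}=\Phi(n,z)(u(1),u(0))^{\top}$ for every solution $u$ of $u(n+1)+u(n-1)+V(n)u(n)=zu(n)$. $\|\cdot\|$ is the operator norm. Dynamical quantities: let $(\delta_n)$ be the canonical basis of $\ell^2(\mathbb{Z})$. For $T>0$ let $a(n,T)=\frac{2}{T}\int_0^\infty e^{-2t/T}|\langle e^{-itH}\delta_1,\delta_n\rangle|^2\,dt$. For $p>0$ let $\langle|X|^p_{\delta_1}\rangle(T)=\sum_n|n|^pa(n,T)$ and $\beta^+_{\delta_1}(p)=\limsup_{T\to\infty}\frac{\log\langle|X|^p_{\delta_1}\rangle(T)}{p\log T}$. For real $N$ let $P(N,T)=\sum_{|n|>N}a(n,T)$. For $\alpha\in[0,+\infty]$ let $S^+(\alpha)=-\limsup_{T\to\infty}\frac{\log P(T^\alpha-2,T)}{\log T}\in[0,\infty]$, and $\alpha_u^+=\sup\{\alpha\ge0: S^+(\alpha)<\infty\}$. *)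

theory Defs
  imports "HOL-Analysis.Analysis"
begin

typedef ell2 = "{f :: int \<Rightarrow> complex. (\<lambda>n. (cmod (f n))\<^sup>2) summable_on UNIV}"
  morphisms coord Abs_ell2
  by (rule exI[of _ "\<lambda>_. 0"]) simp

setup_lifting type_definition_ell2

lemma ell2_add_closed:
  fixes f g :: "int \<Rightarrow> complex"
  assumes "(\<lambda>n. (cmod (f n))\<^sup>2) summable_on UNIV" "(\<lambda>n. (cmod (g n))\<^sup>2) summable_on UNIV"
  shows "(\<lambda>n. (cmod (f n + g n))\<^sup>2) summable_on UNIV"
proof (rule summable_on_comparison_test)
  show "(\<lambda>n. 2 * (cmod (f n))\<^sup>2 + 2 * (cmod (g n))\<^sup>2) summable_on UNIV"
    by (intro summable_on_add summable_on_cmult_right assms)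
  fix n
  have "(cmod (f n + g n))\<^sup>2 \<le> (cmod (f n) + cmod (g n))\<^sup>2"
    by (intro power_mono norm_triangle_ineq norm_ge_zero)
  also have "\<dots> \<le> 2 * (cmod (f n))\<^sup>2 + 2 * (cmod (g n))\<^sup>2"
    using sum_squares_bound[of "cmod (f n)" "cmod (g n)"] by (simp add: power2_sum)
  finally show "(cmod (f n + g n))\<^sup>2 \<le> 2 * (cmod (f n))\<^sup>2 + 2 * (cmod (g n))\<^sup>2" .
qed simp

lemma ell2_mult_closed:
  fixes f :: "int \<Rightarrow> complex" and w :: "int \<Rightarrow> complex"
  assumes "(\<lambda>n. (cmod (f n))\<^sup>2) summable_on UNIV" "\<And>n. cmod (w n) \<le> B"
  shows "(\<lambda>n. (cmod (w n * f n))\<^sup>2) summable_on UNIV"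
proof (rule summable_on_comparison_test)
  show "(\<lambda>n. B\<^sup>2 * (cmod (f n))\<^sup>2) summable_on UNIV"
    by (intro summable_on_cmult_right assms)
  show "(cmod (w n * f n))\<^sup>2 \<le> B\<^sup>2 * (cmod (f n))\<^sup>2" for n
    unfolding norm_mult power_mult_distrib
    by (intro mult_right_mono power_mono assms) auto
qed simp

lemma ell2_shift_closed:
  fixes f :: "int \<Rightarrow> complex" and k :: int
  assumes "(\<lambda>n. (cmod (f n))\<^sup>2) summable_on UNIV"
  shows "(\<lambda>n. (cmod (f (n + k)))\<^sup>2) summable_on UNIV"
proof -
  have "bij (\<lambda>n. n + k)"
    by (rule bij_betw_byWitness[where f' = "\<lambda>n. n - k"]) auto
  from summable_on_reindex_bij_betw[OF this, of "\<lambda>n. (cmod (f n))\<^sup>2"] assms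
  show ?thesis by simp
qed

lemma ell2_prod_summable:
  fixes f g :: "int \<Rightarrow> complex"
  assumes "(\<lambda>n. (cmod (f n))\<^sup>2) summable_on UNIV" "(\<lambda>n. (cmod (g n))\<^sup>2) summable_on UNIV"
  shows "(\<lambda>n. f n * cnj (g n)) summable_on UNIV"
proof (rule abs_summable_summable, rule summable_on_comparison_test)
  show "(\<lambda>n. (cmod (f n))\<^sup>2 + (cmod (g n))\<^sup>2) summable_on UNIV"
    by (intro summable_on_add assms)
  fix n
  show "norm (f n * cnj (g n)) \<le> (cmod (f n))\<^sup>2 + (cmod (g n))\<^sup>2"
    using sum_squares_bound[of "cmod (f n)" "cmod (g n)"]
      mult_nonneg_nonneg[OF norm_ge_zero[of "f n"] norm_ge_zero[of "g n"]]
    unfolding norm_mult complex_mod_cnj by linarith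
qed simp

instantiation ell2 :: real_vector
begin

lift_definition zero_ell2 :: ell2 is "\<lambda>_. 0" by simp
lift_definition plus_ell2 :: "ell2 \<Rightarrow> ell2 \<Rightarrow> ell2" is "\<lambda>f g n. f n + g n"
  by (rule ell2_add_closed)
lift_definition uminus_ell2 :: "ell2 \<Rightarrow> ell2" is "\<lambda>f n. - f n" by simp
lift_definition minus_ell2 :: "ell2 \<Rightarrow> ell2 \<Rightarrow> ell2" is "\<lambda>f g n. f n - g n"
  subgoal for f g using ell2_add_closed[of f "\<lambda>n. - g n"] by simp
  done
lift_definition scaleR_ell2 :: "real \<Rightarrow> ell2 \<Rightarrow> ell2" is "\<lambda>r f n. complex_of_real r * f n"
  subgoal for r f by (rule ell2_mult_closed[where B = "\<bar>r\<bar>"]) simp_all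
  done

instance
  by standard (transfer, simp add: algebra_simps)+

end

lift_definition cscale :: "complex \<Rightarrow> ell2 \<Rightarrow> ell2"  (infixr "*\<^sub>C" 75) is "\<lambda>c f n. c * f n"
  by (erule ell2_mult_closed) (rule order_refl)

lemma coord_simps [simp]:
  "coord 0 n = 0"
  "coord (x + y) n = coord x n + coord y n"
  "coord (- x) n = - coord x n"
  "coord (x - y) n = coord x n - coord y n"
  "coord (r *\<^sub>R x) n = complex_of_real r * coord x n"
  "coord (c *\<^sub>C x) n = c * coord x n"
  by (simp_all add: minus_ell2.rep_eq zero_ell2.rep_eq plus_ell2.rep_eq uminus_ell2.rep_eq
      scaleR_ell2.rep_eq cscale.rep_eq)

lemma ell2_eqI: "(\<And>n. coord x n = coord y n) \<Longrightarrow> x = y"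
  by (simp add: fun_eq_iff flip: coord_inject)

lemma coord_summable: "(\<lambda>n. (cmod (coord x n))\<^sup>2) summable_on UNIV"
  using coord[of x] by simp

definition cinner :: "ell2 \<Rightarrow> ell2 \<Rightarrow> complex" where
  "cinner x y = (\<Sum>\<^sub>\<infinity>n. coord x n * cnj (coord y n))"

lemma cinner_self: "cinner x x = complex_of_real (\<Sum>\<^sub>\<infinity>n. (cmod (coord x n))\<^sup>2)"
  unfolding cinner_def complex_norm_square[symmetric] 
  by (rule infsumI, rule has_sum_of_real, rule has_sum_infsum, rule coord_summable)

instantiation ell2 :: real_inner
begin

definition inner_ell2 :: "ell2 \<Rightarrow> ell2 \<Rightarrow> real" where
  "inner_ell2 x y = Re (cinner x y)"
definition norm_ell2 :: "ell2 \<Rightarrow> real" where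
  "norm_ell2 x = sqrt (x \<bullet> x)"
definition sgn_ell2 :: "ell2 \<Rightarrow> ell2" where
  "sgn_ell2 x = x /\<^sub>R norm x"
definition dist_ell2 :: "ell2 \<Rightarrow> ell2 \<Rightarrow> real" where
  "dist_ell2 x y = norm (x - y)"
definition uniformity_ell2 :: "(ell2 \<times> ell2) filter" where
  "uniformity_ell2 = (INF e\<in>{0 <..}. principal {(x, y). dist x y < e})"
definition open_ell2 :: "ell2 set \<Rightarrow> bool" where
  "open_ell2 U \<longleftrightarrow> (\<forall>x\<in>U. eventually (\<lambda>(x', y). x' = x \<longrightarrow> y \<in> U) uniformity)"

instance
proof
  fix x y z :: ell2 and r :: real
  have "cinner y x = cnj (cinner x y)"
    unfolding cinner_def by (simp flip: infsum_cnj add: mult.commute)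
  then show "x \<bullet> y = y \<bullet> x"
    by (simp add: inner_ell2_def)
  have "cinner (x + y) z = cinner x z + cinner y z"
    unfolding cinner_def
    by (simp add: distrib_right infsum_add ell2_prod_summable coord_summable)
  then show "(x + y) \<bullet> z = x \<bullet> z + y \<bullet> z"
    by (simp add: inner_ell2_def)
  have "cinner (r *\<^sub>R x) y = complex_of_real r * cinner x y"
    unfolding cinner_def by (simp add: mult.assoc infsum_cmult_right')
  then show "(r *\<^sub>R x) \<bullet> y = r * (x \<bullet> y)"
    by (simp add: inner_ell2_def)
  show "0 \<le> x \<bullet> x"
    by (simp add: inner_ell2_def cinner_self infsum_nonneg)
  show "(x \<bullet> x = 0) = (x = 0)"
  proof
    assume "x \<bullet> x = 0"
    then have "(\<Sum>\<^sub>\<infinity>n. (cmod (coord x n))\<^sup>2) = 0"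
      by (simp add: inner_ell2_def cinner_self)
    then have "(cmod (coord x n))\<^sup>2 = 0" for n
      by (intro nonneg_infsum_le_0D[OF _ coord_summable]) simp_all
    then show "x = 0"
      by (intro ell2_eqI) simp
  qed (simp add: inner_ell2_def cinner_def)
qed (fact norm_ell2_def sgn_ell2_def dist_ell2_def uniformity_ell2_def open_ell2_def)+

end

lemma norm_ell2_eq: "(norm (x :: ell2))\<^sup>2 = (\<Sum>\<^sub>\<infinity>n. (cmod (coord x n))\<^sup>2)"
  by (simp add: norm_ell2_def inner_ell2_def cinner_self infsum_nonneg)

lemma sum_coord_le_norm: "finite F \<Longrightarrow> (\<Sum>n\<in>F. (cmod (coord x n))\<^sup>2) \<le> (norm x)\<^sup>2"
  unfolding norm_ell2_eq by (rule finite_sum_le_infsum[OF coord_summable]) auto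

lemma coord_le_norm: "cmod (coord x n) \<le> norm x"
  by (rule power2_le_imp_le) (use sum_coord_le_norm[of "{n}" x] in simp_all)

instance ell2 :: banach
proof
  fix X :: "nat \<Rightarrow> ell2"
  assume X: "Cauchy X"
  have "Cauchy (\<lambda>i. coord (X i) n)" for n
  proof (rule CauchyI)
    fix e :: real assume "0 < e"
    then obtain M where "\<forall>i\<ge>M. \<forall>j\<ge>M. norm (X i - X j) < e"
      using CauchyD[OF X] by blast
    then show "\<exists>M. \<forall>i\<ge>M. \<forall>j\<ge>M. cmod (coord (X i) n - coord (X j) n) < e"
      by (metis coord_le_norm coord_simps(4) le_less_trans)
  qed
  then have "\<forall>n. \<exists>l. (\<lambda>i. coord (X i) n) \<longlonglongrightarrow> l"
    by (simp add: Cauchy_convergent_iff convergent_def)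
  from choice[OF this] obtain f where f: "\<And>n. (\<lambda>i. coord (X i) n) \<longlonglongrightarrow> f n"
    by auto
  have bd: "(\<Sum>n\<in>F. (cmod (coord (X i) n - f n))\<^sup>2) \<le> e\<^sup>2"
    if M: "\<forall>i\<ge>M. \<forall>j\<ge>M. norm (X i - X j) < e" and "i \<ge> M" "finite F" for M e i F
  proof (rule tendsto_upperbound)
    show "(\<lambda>j. \<Sum>n\<in>F. (cmod (coord (X i) n - coord (X j) n))\<^sup>2)
        \<longlonglongrightarrow> (\<Sum>n\<in>F. (cmod (coord (X i) n - f n))\<^sup>2)"
      by (intro tendsto_intros f)
    show "\<forall>\<^sub>F j in sequentially. (\<Sum>n\<in>F. (cmod (coord (X i) n - coord (X j) n))\<^sup>2) \<le> e\<^sup>2"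
    proof (rule eventually_sequentiallyI)
      fix j assume "M \<le> j"
      then have "(norm (X i - X j))\<^sup>2 \<le> e\<^sup>2"
        using M \<open>i \<ge> M\<close> by (intro power_mono) (auto simp: less_imp_le)
      then show "(\<Sum>n\<in>F. (cmod (coord (X i) n - coord (X j) n))\<^sup>2) \<le> e\<^sup>2"
        using sum_coord_le_norm[OF \<open>finite F\<close>, of "X i - X j"] by simp
    qed
  qed simp
  have sm: "(\<lambda>n. (cmod (coord (X i) n - f n))\<^sup>2) summable_on UNIV"
    if "\<forall>i\<ge>M. \<forall>j\<ge>M. norm (X i - X j) < e" "i \<ge> M" for M e i
    by (rule nonneg_bounded_partial_sums_imp_summable_on[where C = "e\<^sup>2"])
      (use bd[OF that] in \<open>auto simp: eventually_finite_subsets_at_top\<close>)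
  obtain M1 where M1: "\<forall>i\<ge>M1. \<forall>j\<ge>M1. norm (X i - X j) < 1"
    using CauchyD[OF X, of 1] by auto
  have "(\<lambda>n. (cmod (f n))\<^sup>2) summable_on UNIV"
    using ell2_add_closed[OF coord_summable[of "- X M1"], of "\<lambda>n. coord (X M1) n - f n"]
      sm[OF M1 order_refl] by simp
  then have cl: "coord (Abs_ell2 f) = f"
    by (intro Abs_ell2_inverse) simp
  have "X \<longlonglongrightarrow> Abs_ell2 f"
  proof (rule LIMSEQ_I)
    fix r :: real assume "0 < r"
    then obtain M where M: "\<forall>i\<ge>M. \<forall>j\<ge>M. norm (X i - X j) < r / 2"
      using CauchyD[OF X, of "r / 2"] by auto
    show "\<exists>M. \<forall>i\<ge>M. norm (X i - Abs_ell2 f) < r"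
    proof (intro exI allI impI)
      fix i assume i: "M \<le> i"
      have "(norm (X i - Abs_ell2 f))\<^sup>2 \<le> (r / 2)\<^sup>2"
        unfolding norm_ell2_eq
        by (rule infsum_le_finite_sums[OF coord_summable]) (use bd[OF M i] in \<open>simp add: cl\<close>)
      from power2_le_imp_le[OF this] have "norm (X i - Abs_ell2 f) \<le> r / 2"
        using \<open>0 < r\<close> by simp
      then show "norm (X i - Abs_ell2 f) < r"
        using \<open>0 < r\<close> by simp
    qed
  qed
  then show "convergent X"
    by (auto simp: convergent_def)
qed

lift_definition delta :: "int \<Rightarrow> ell2" is "\<lambda>m n. if n = m then 1 else 0"
  subgoal for m
    by (rule finite_nonzero_values_imp_summable_on, rule finite_subset[of _ "{m}"]) auto
  done

text \<open>For unbounded \<open>V\<close> the right-hand side may be a junk value of \<open>Abs_ell2\<close>; for bounded \<open>V\<close>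
  see \<open>coord_schroedinger\<close>.\<close>

definition schroedinger :: "(int \<Rightarrow> real) \<Rightarrow> ell2 \<Rightarrow> ell2" where
  "schroedinger V \<psi> =
     Abs_ell2 (\<lambda>n. coord \<psi> (n + 1) + coord \<psi> (n - 1) + complex_of_real (V n) * coord \<psi> n)"

lemma coord_schroedinger:
  assumes "bounded (range V)"
  shows "coord (schroedinger V \<psi>) n =
    coord \<psi> (n + 1) + coord \<psi> (n - 1) + complex_of_real (V n) * coord \<psi> n"
proof -
  obtain B where B: "\<And>n. \<bar>V n\<bar> \<le> B"
    using assms by (auto simp: bounded_iff)
  have "(\<lambda>n. (cmod (coord \<psi> (n + 1) + coord \<psi> (n - 1) + complex_of_real (V n) * coord \<psi> n))\<^sup>2)
      summable_on UNIV"
    using ell2_shift_closed[OF coord_summable, of \<psi> 1] ell2_shift_closed[OF coord_summable, of \<psi> "-1"]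
    by (intro ell2_add_closed ell2_mult_closed[where B = B] coord_summable) (auto simp: B)
  then show ?thesis
    by (simp add: schroedinger_def Abs_ell2_inverse)
qed

text \<open>For a complex-linear operator \<open>A\<close> the two-sided inverse \<open>R\<close> is automatically complex-linear,
  so it suffices to require that it is real-linear and bounded.\<close>

definition spectrum :: "(ell2 \<Rightarrow> ell2) \<Rightarrow> complex set" where
  "spectrum A = {z. \<not> (\<exists>R. bounded_linear R \<and>
     (\<forall>\<psi>. R (A \<psi> - z *\<^sub>C \<psi>) = \<psi>) \<and> (\<forall>\<psi>. A (R \<psi>) - z *\<^sub>C R \<psi> = \<psi>))}"

text \<open>The group \<open>exp (- i t A)\<close> of a bounded operator, given by the norm-convergent
  exponential series.\<close>

definition evolution :: "(ell2 \<Rightarrow> ell2) \<Rightarrow> real \<Rightarrow> ell2 \<Rightarrow> ell2" where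
  "evolution A t \<psi> = (\<Sum>k. ((- \<i> * complex_of_real t) ^ k / fact k) *\<^sub>C (A ^^ k) \<psi>)"

definition transfer_step :: "(int \<Rightarrow> real) \<Rightarrow> int \<Rightarrow> complex \<Rightarrow> complex^2^2" where
  "transfer_step V m z =
     vector [vector [z - complex_of_real (V m), -1],
             vector [1,                          0]]"

primrec transfer_pos :: "(int \<Rightarrow> real) \<Rightarrow> complex \<Rightarrow> nat \<Rightarrow> complex^2^2" where
  "transfer_pos V z 0 = mat 1"
| "transfer_pos V z (Suc k) = transfer_step V (int (Suc k)) z ** transfer_pos V z k"

primrec transfer_neg :: "(int \<Rightarrow> real) \<Rightarrow> complex \<Rightarrow> nat \<Rightarrow> complex^2^2" where
  "transfer_neg V z 0 = mat 1"
| "transfer_neg V z (Suc k) = matrix_inv (transfer_step V (- int k) z) ** transfer_neg V z k"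

definition transfer_matrix :: "(int \<Rightarrow> real) \<Rightarrow> int \<Rightarrow> complex \<Rightarrow> complex^2^2" where
  "transfer_matrix V n z =
     (if n \<ge> 0 then transfer_pos V z (nat n) else transfer_neg V z (nat (- n)))"

text \<open>The library norm on the matrix type is the Frobenius norm, hence \<open>onorm\<close>.\<close>

definition matrix_opnorm :: "complex^2^2 \<Rightarrow> real" where
  "matrix_opnorm A = onorm (\<lambda>v. A *v v)"

text \<open>For bounded \<open>V\<close> and \<open>T > 0\<close> every \<open>avg_prob V n T\<close> is strictly positive (the leading
  term of the matrix element at \<open>t = 0\<close> is a nonzero multiple of \<open>t ^ \<bar>n - 1\<bar>\<close>) and decays
  exponentially in \<open>n\<close>, so the sums below converge and, apart from the empty sum arising for
  \<open>\<alpha> = \<infinity>\<close>, the arguments of the logarithms are positive.\<close>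

definition avg_prob :: "(int \<Rightarrow> real) \<Rightarrow> int \<Rightarrow> real \<Rightarrow> real" where
  "avg_prob V n T = 2 / T * (LINT t:{0..}|lborel.
     exp (- 2 * t / T) * (cmod (cinner (evolution (schroedinger V) t (delta 1)) (delta n)))\<^sup>2)"

definition moment :: "(int \<Rightarrow> real) \<Rightarrow> real \<Rightarrow> real \<Rightarrow> real" where
  "moment V p T = (\<Sum>\<^sub>\<infinity>n. \<bar>real_of_int n\<bar> powr p * avg_prob V n T)"

definition beta_plus :: "(int \<Rightarrow> real) \<Rightarrow> real \<Rightarrow> ereal" where
  "beta_plus V p = Limsup at_top (\<lambda>T. ereal (ln (moment V p T) / (p * ln T)))"

definition outside_prob :: "(int \<Rightarrow> real) \<Rightarrow> ereal \<Rightarrow> real \<Rightarrow> real" where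
  "outside_prob V N T = (\<Sum>\<^sub>\<infinity>n\<in>{n. N < ereal \<bar>real_of_int n\<bar>}. avg_prob V n T)"

text \<open>Logarithm and power with the conventions \<open>log 0 = -\<infinity>\<close> and \<open>T\<^sup>\<infinity> = \<infinity>\<close> for \<open>T > 1\<close>;
  these are only needed at the endpoint \<open>\<alpha> = \<infinity>\<close> of \<open>S_plus\<close>.\<close>

definition ext_ln :: "real \<Rightarrow> ereal" where
  "ext_ln x = (if x = 0 then - \<infinity> else ereal (ln x))"

definition ext_powr :: "real \<Rightarrow> ereal \<Rightarrow> ereal" where
  "ext_powr T \<alpha> = (if \<alpha> = \<infinity> then \<infinity> else ereal (T powr real_of_ereal \<alpha>))"

definition S_plus :: "(int \<Rightarrow> real) \<Rightarrow> ereal \<Rightarrow> ereal" where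
  "S_plus V \<alpha> =
     - Limsup at_top (\<lambda>T. ext_ln (outside_prob V (ext_powr T \<alpha> - 2) T) / ereal (ln T))"

definition alpha_u_plus :: "(int \<Rightarrow> real) \<Rightarrow> ereal" where
  "alpha_u_plus V = Sup {\<alpha>. 0 \<le> \<alpha> \<and> S_plus V \<alpha> < \<infinity>}"

end

theory Submission
  imports Defs "HOL-Complex_Analysis.Complex_Analysis"
begin

text \<open>Write \<open>G(z)\<close> for the matrix of the resolvent of \<open>H\<close>, which is symmetric because \<open>H\<close> is real.
  Cauchy's formula on the rectangle with vertices \<open>\<plusminus>K \<plusminus> i\<epsilon>\<close>, \<open>\<epsilon> = 1 / (2T)\<close>, expresses the evolution
  by \<open>G\<close>; on the vertical sides \<open>G(n, 1)\<close> decays in \<open>n\<close> faster than any power, so the average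
  probabilities are controlled by the integral of \<open>|G(n, 1; E + i\<epsilon>)|\<^sup>2\<close> over \<open>-K \<le> E \<le> K\<close>.

  For \<open>n > k > 0\<close> the sequence \<open>v = G(\<cdot>, n)\<close> solves the difference equation up to the site \<open>k\<close>.
  If \<open>v\<close> is cut off to the right of a site \<open>j < n\<close>, then \<open>(H - z) v\<close> only sees \<open>v(j)\<close> and \<open>v(j + 1)\<close>;
  since \<open>|(H - z) x| \<ge> \<epsilon> |x|\<close>, the solution \<open>v\<close> cannot have shrunk by more than a factor \<open>\<epsilon>\<close> between the
  origin and \<open>j\<close>. Reduction of order then shows that \<open>v\<close> grows like \<open>\<parallel>\<Phi>(k, z)\<parallel>\<close> up to powers of \<open>k / \<epsilon>\<close>,
  that is, \<open>\<parallel>\<Phi>(k, z)\<parallel> |G(1, n)|\<close> is bounded by a power of \<open>T\<close> times \<open>|G(k, n)| + |G(k + 1, n)|\<close>,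
  which is square summable in \<open>n\<close>. Maximising over \<open>k\<close> and integrating over \<open>E\<close> brings in
  the hypotheses, taken at \<open>2T\<close> in place of \<open>T\<close>.\<close>

section \<open>Square-summable sequences and the Schroedinger operator\<close>

text \<open>The hypotheses give \<open>O(T powr (- real m))\<close> for every \<open>m\<close>, so
  losing a fixed power of \<open>T\<close> costs nothing; this permits the crude constants
  everywhere, with \<open>T\<close> itself as the bound for the resolvent at height
  \<open>1 / T\<close>. The obstacle is that infinitely many sites \<open>n\<close> must be summed
  while the maximising \<open>k\<close> depends on the energy. Hence the source is placed at
  \<open>n\<close> and the solution is read off at 0, 1, \<open>k\<close> and \<open>k + 1\<close>:
  by symmetry the values at \<open>k\<close> and \<open>k + 1\<close>, as functions of
  \<open>n\<close>, are columns of the Green function, with norm at most \<open>T\<close> whatever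
  \<open>k\<close> is. The source must lie beyond \<open>k\<close>, so that the piece kept by the
  cut contains 0 and 1 but not the source. On the vertical sides there is no gain in
  \<open>T\<close>, only decay in \<open>n\<close>; since |n| exceeds a multiple of
  \<open>T powr \<alpha>\<close> with \<alpha> > 0, this is again decay in \<open>T\<close>. For the
  moments, a small outside probability does not control the weight |n|^p at remote sites, whence a
  separate a priori estimate there.\<close>

lemma norm_cscale: "norm (c *\<^sub>C x) = cmod c * norm x"
proof -
  have "(norm (c *\<^sub>C x))\<^sup>2 = (cmod c * norm x)\<^sup>2"
    unfolding norm_ell2_eq power_mult_distrib
    by (simp add: norm_mult power_mult_distrib infsum_cmult_right' flip: norm_ell2_eq)
  then show ?thesis by (simp add: power2_eq_iff_nonneg)
qed

lemma ell2_norm_le: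
  assumes "\<And>F. finite F \<Longrightarrow> (\<Sum>n\<in>F. (cmod (coord x n))\<^sup>2) \<le> c\<^sup>2" "0 \<le> c"
  shows "norm x \<le> c"
proof (rule power2_le_imp_le)
  show "(norm x)\<^sup>2 \<le> c\<^sup>2"
    unfolding norm_ell2_eq by (rule infsum_le_finite_sums[OF coord_summable]) (use assms in auto)
qed fact

lemma coord_delta [simp]: "coord (delta m) n = (if n = m then 1 else 0)"
  by (simp add: delta.rep_eq)

lemma bounded_linear_coord: "bounded_linear (\<lambda>x. coord x n)"
  by (rule bounded_linear_intro[where K = 1]) (simp_all add: coord_le_norm scaleR_conv_of_real)

lemma cscale_simps:
  "c *\<^sub>C (x + y) = c *\<^sub>C x + c *\<^sub>C y" "c *\<^sub>C (x - y) = c *\<^sub>C x - c *\<^sub>C y"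
  "(a + b) *\<^sub>C x = a *\<^sub>C x + b *\<^sub>C x" "(a - b) *\<^sub>C x = a *\<^sub>C x - b *\<^sub>C x"
  "a *\<^sub>C b *\<^sub>C x = (a * b) *\<^sub>C x" "1 *\<^sub>C x = x" "0 *\<^sub>C x = 0" "c *\<^sub>C 0 = 0" "(- c) *\<^sub>C x = - (c *\<^sub>C x)"
  "r *\<^sub>R x = complex_of_real r *\<^sub>C x"
  by (rule ell2_eqI; simp add: algebra_simps)+

lemma cscale_sum: "c *\<^sub>C (\<Sum>i\<in>I. f i) = (\<Sum>i\<in>I. c *\<^sub>C f i)"
  by (induction I rule: infinite_finite_induct) (simp_all add: cscale_simps)

text \<open>The bilinear form, without conjugation: the real operator \<open>H\<close> is symmetric for it, which makes
  the Green function symmetric rather than merely Hermitian.\<close>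

definition bil :: "ell2 \<Rightarrow> ell2 \<Rightarrow> complex" where
  "bil x y = (\<Sum>\<^sub>\<infinity>n. coord x n * coord y n)"

lift_definition econj :: "ell2 \<Rightarrow> ell2" is "\<lambda>f n. cnj (f n)" by simp

lemma coord_econj [simp]: "coord (econj x) n = cnj (coord x n)"
  by (simp add: econj.rep_eq)

lemma norm_econj [simp]: "norm (econj x) = norm x"
proof -
  have "(norm (econj x))\<^sup>2 = (norm x)\<^sup>2"
    unfolding norm_ell2_eq by simp
  then show ?thesis by (simp add: power2_eq_iff_nonneg)
qed

lemma cinner_eq_bil: "cinner x y = bil x (econj y)"
  by (simp add: cinner_def bil_def)

lemma bil_summable: "(\<lambda>n. coord x n * coord y n) summable_on UNIV"
  using ell2_prod_summable[OF coord_summable[of x] coord_summable[of "econj y"]] by simp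

lemma bil_commute: "bil x y = bil y x"
  by (simp add: bil_def mult.commute)

lemma bil_linear:
  "bil (x + y) w = bil x w + bil y w" "bil (x - y) w = bil x w - bil y w" "bil (c *\<^sub>C x) w = c * bil x w"
proof -
  show *: "bil (x + y) w = bil x w + bil y w" for x y
    unfolding bil_def by (simp add: distrib_right infsum_add bil_summable)
  show **: "bil (c *\<^sub>C x) w = c * bil x w" for c x
    unfolding bil_def by (simp add: mult.assoc infsum_cmult_right')
  show "bil (x - y) w = bil x w - bil y w"
    using *[of x "- 1 *\<^sub>C y"] **[of "-1" y] by (simp add: cscale_simps)
qed

lemma bil_delta: "bil (delta n) x = coord x n"
proof -
  have "bil (delta n) x = (\<Sum>\<^sub>\<infinity>m\<in>{n}. coord (delta n) m * coord x m)"
    unfolding bil_def by (rule infsum_cong_neutral) auto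
  then show ?thesis by simp
qed

lemma cinner_delta: "cinner x (delta n) = coord x n"
proof -
  have "econj (delta n) = delta n"
    by (rule ell2_eqI) simp
  then show ?thesis
    by (simp add: cinner_eq_bil bil_delta bil_commute[of x])
qed

text \<open>The class \<open>real_inner\<close> provides Cauchy-Schwarz only for the real part of
  \<open>cinner\<close>; multiplying \<open>y\<close> by \<open>\<i>\<close> moves the imaginary
  part there.\<close>

lemma Im_cinner_bound: "\<bar>Im (cinner x y)\<bar> \<le> norm x * norm y"
proof -
  have "cinner x (\<i> *\<^sub>C y) = - \<i> * cinner x y"
    unfolding cinner_def by (simp flip: infsum_cmult_right' add: mult_ac infsum_uminus)
  then have "x \<bullet> (\<i> *\<^sub>C y) = Im (cinner x y)"
    by (simp add: inner_ell2_def)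
  then show ?thesis
    using Cauchy_Schwarz_ineq2[of x "\<i> *\<^sub>C y"] by (simp add: norm_cscale)
qed

lemma cinner_linear:
  "cinner (x - y) w = cinner x w - cinner y w" "cinner (c *\<^sub>C x) w = c * cinner x w"
  by (simp_all add: cinner_eq_bil bil_linear)

lemma cinner_commute: "cinner y x = cnj (cinner x y)"
  unfolding cinner_def by (simp flip: infsum_cnj add: mult.commute)

lemma cinner_self_norm: "cinner x x = complex_of_real ((norm x)\<^sup>2)"
  by (simp add: cinner_self norm_ell2_eq)

section \<open>The operator for a bounded potential: boundedness, symmetry, lower bound\<close>

locale bounded_potential =
  fixes V :: "int \<Rightarrow> real"
  assumes bounded_V: "bounded (range V)"
begin

abbreviation H :: "ell2 \<Rightarrow> ell2" where "H \<equiv> schroedinger V"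

lemmas coord_H [simp] = coord_schroedinger[OF bounded_V]

lemma H_linear: "H (x + y) = H x + H y" "H (x - y) = H x - H y" "H (c *\<^sub>C x) = c *\<^sub>C H x"
  "H (r *\<^sub>R x) = r *\<^sub>R H x" "H 0 = 0" "H (econj x) = econj (H x)"
  by (rule ell2_eqI; simp add: algebra_simps)+

lemma H_sum: "H (\<Sum>i\<in>I. f i) = (\<Sum>i\<in>I. H (f i))"
  by (induction I rule: infinite_finite_induct) (simp_all add: H_linear)

lemma H_bounded: "\<exists>M\<ge>1. \<forall>x. norm (H x) \<le> M * norm x"
proof -
  obtain B where B: "\<And>n. \<bar>V n\<bar> \<le> B"
    using bounded_V by (auto simp: bounded_iff)
  then have "0 \<le> B" by (meson abs_ge_zero order_trans)
  show ?thesis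
  proof (intro exI conjI allI)
    fix x :: ell2
    let ?sq = "\<lambda>n. (cmod (coord x n))\<^sup>2"
    show "norm (H x) \<le> (3 * (2 + B)) * norm x"
    proof (rule ell2_norm_le)
      fix F :: "int set" assume F: "finite F"
      have sh: "(\<Sum>n\<in>F. ?sq (n + k)) \<le> (norm x)\<^sup>2" for k
      proof -
        have "(\<Sum>n\<in>F. ?sq (n + k)) = (\<Sum>n\<in>(\<lambda>n. n + k) ` F. ?sq n)"
          by (subst sum.reindex) (auto simp: inj_on_def)
        also have "\<dots> \<le> (norm x)\<^sup>2"
          using F by (intro sum_coord_le_norm) auto
        finally show ?thesis .
      qed
      \<comment> \<open>The 3 comes from (a + b + c)^2 <= 3 (a^2 + b^2 + c^2). The final constant
        \<open>3 * (2 + B)\<close> is generous so that no square root is needed.\<close>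
      have "(cmod (coord (H x) n))\<^sup>2 \<le> 3 * (?sq (n + 1) + ?sq (n + -1) + B\<^sup>2 * ?sq n)" for n
      proof -
        have "cmod (coord (H x) n) \<le> cmod (coord x (n + 1)) + cmod (coord x (n - 1)) + B * cmod (coord x n)"
          using B[of n]
          by (auto intro!: order_trans[OF norm_triangle_ineq] add_mono mult_right_mono simp: norm_mult)
        then have "(cmod (coord (H x) n))\<^sup>2 \<le>
            (cmod (coord x (n + 1)) + cmod (coord x (n - 1)) + B * cmod (coord x n))\<^sup>2"
          by (rule power_mono) simp
        also have "\<dots> \<le> 3 * (?sq (n + 1) + ?sq (n - 1) + (B * cmod (coord x n))\<^sup>2)"
          using sum_squares_bound[of "cmod (coord x (n + 1))" "cmod (coord x (n - 1))"]
            sum_squares_bound[of "cmod (coord x (n + 1))" "B * cmod (coord x n)"]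
            sum_squares_bound[of "cmod (coord x (n - 1))" "B * cmod (coord x n)"]
          by (simp add: power2_eq_square algebra_simps)
        finally show ?thesis by (simp add: power_mult_distrib)
      qed
      then have "(\<Sum>n\<in>F. (cmod (coord (H x) n))\<^sup>2) \<le>
          (\<Sum>n\<in>F. 3 * (?sq (n + 1) + ?sq (n + -1) + B\<^sup>2 * ?sq n))"
        by (rule sum_mono)
      also have "\<dots> = 3 * ((\<Sum>n\<in>F. ?sq (n + 1)) + (\<Sum>n\<in>F. ?sq (n + -1)) + B\<^sup>2 * (\<Sum>n\<in>F. ?sq n))"
        by (simp add: sum_distrib_left sum.distrib algebra_simps)
      also have "\<dots> \<le> 3 * ((norm x)\<^sup>2 + (norm x)\<^sup>2 + B\<^sup>2 * (norm x)\<^sup>2)"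
        using sh[of 1] sh[of "-1"] sh[of 0] by (intro mult_left_mono add_mono) auto
      also have "\<dots> = 3 * (2 + B\<^sup>2) * (norm x)\<^sup>2"
        by (simp add: algebra_simps)
      also have "\<dots> \<le> (3 * (2 + B))\<^sup>2 * (norm x)\<^sup>2"
      proof (rule mult_right_mono)
        have "3 * (2 + B\<^sup>2) \<le> 9 * (4 + 4 * B + B\<^sup>2)"
          using \<open>0 \<le> B\<close> by simp
        then show "3 * (2 + B\<^sup>2) \<le> (3 * (2 + B))\<^sup>2"
          by (simp add: power2_eq_square algebra_simps)
      qed simp
      finally show "(\<Sum>n\<in>F. (cmod (coord (H x) n))\<^sup>2) \<le> (3 * (2 + B) * norm x)\<^sup>2"
        by (simp add: power_mult_distrib)
    qed (use \<open>0 \<le> B\<close> in simp)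
  qed (use \<open>0 \<le> B\<close> in simp)
qed

text \<open>The two shifts are transposes of each other and the potential acts diagonally.\<close>

lemma bil_H: "bil (H x) y = bil x (H y)"
proof -
  have bij: "bij (\<lambda>n::int. n + k)" for k
    by (rule bij_betw_byWitness[where f' = "\<lambda>n. n - k"]) auto
  have sm: "(\<lambda>n. coord x (n + k) * coord y n) summable_on UNIV" for x y and k :: int
    using ell2_prod_summable[OF ell2_shift_closed[OF coord_summable[of x]] coord_summable[of "econj y"]]
    by simp
  have sh: "(\<Sum>\<^sub>\<infinity>n. coord x (n + k) * coord y n) = (\<Sum>\<^sub>\<infinity>n. coord x n * coord y (n + - k))" for k
    using infsum_reindex_bij_betw[OF bij[of "-k"], of "\<lambda>n. coord x (n + k) * coord y n"] by simp
  have smV: "(\<lambda>n. complex_of_real (V n) * coord x n * coord y n) summable_on UNIV"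
  proof -
    obtain B where B: "\<And>n. \<bar>V n\<bar> \<le> B"
      using bounded_V by (auto simp: bounded_iff)
    show ?thesis
      using ell2_prod_summable[OF ell2_mult_closed[OF coord_summable[of x], of V B] coord_summable[of "econj y"]] B
      by simp
  qed
  have "bil (H x) y = (\<Sum>\<^sub>\<infinity>n. coord x (n + 1) * coord y n + coord x (n + -1) * coord y n
      + complex_of_real (V n) * coord x n * coord y n)"
    unfolding bil_def by (simp add: algebra_simps)
  also have "\<dots> = (\<Sum>\<^sub>\<infinity>n. coord x (n + 1) * coord y n) + (\<Sum>\<^sub>\<infinity>n. coord x (n + -1) * coord y n)
      + (\<Sum>\<^sub>\<infinity>n. complex_of_real (V n) * coord x n * coord y n)"
    by (intro trans[OF infsum_add] arg_cong2[of _ _ _ _ "(+)"] infsum_add summable_on_add sm smV refl)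
  also have "\<dots> = (\<Sum>\<^sub>\<infinity>n. coord y (n + 1) * coord x n) + (\<Sum>\<^sub>\<infinity>n. coord y (n + -1) * coord x n)
      + (\<Sum>\<^sub>\<infinity>n. complex_of_real (V n) * coord x n * coord y n)"
    by (subst sh, subst sh) (simp add: mult.commute)
  also have "\<dots> = (\<Sum>\<^sub>\<infinity>n. coord y (n + 1) * coord x n + coord y (n + -1) * coord x n
      + complex_of_real (V n) * coord x n * coord y n)"
    by (intro sym[OF trans[OF infsum_add]] arg_cong2[of _ _ _ _ "(+)"] infsum_add summable_on_add sm smV refl)
  also have "\<dots> = bil x (H y)"
    unfolding bil_def by (simp add: algebra_simps)
  finally show ?thesis .
qed

text \<open>\<open>H\<close> commutes with \<open>econj\<close> because \<open>V\<close> is real,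
  which turns the symmetry for \<open>bil\<close> into self-adjointness.\<close>

lemma Im_cinner_H: "Im (cinner (H x) x) = 0"
proof -
  have "cinner (H x) x = cnj (cinner (H x) x)"
    by (metis bil_H H_linear(6) cinner_commute cinner_eq_bil)
  then show ?thesis by (simp add: complex_eq_iff)
qed

text \<open>The quadratic form of \<open>H\<close> is real, so only Im z survives in the imaginary
  part of the form of \<open>H - z\<close>. Stated without an inverse, the bound applies directly to
  truncated solutions.\<close>

lemma H_lower_bound: "\<bar>Im z\<bar> * norm x \<le> norm (H x - z *\<^sub>C x)"
proof (cases "x = 0")
  case False
  have "Im (cinner (H x - z *\<^sub>C x) x) = - Im z * (norm x)\<^sup>2"
    by (simp add: cinner_linear Im_cinner_H cinner_self_norm)
  then have "\<bar>Im z\<bar> * (norm x)\<^sup>2 \<le> norm (H x - z *\<^sub>C x) * norm x"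
    using Im_cinner_bound[of "H x - z *\<^sub>C x" x] by (simp add: abs_mult)
  then have "(\<bar>Im z\<bar> * norm x) * norm x \<le> norm (H x - z *\<^sub>C x) * norm x"
    by (simp add: power2_eq_square mult.assoc)
  then show ?thesis using False by simp
qed simp

end

section \<open>Cutting off solutions\<close>

lift_definition restrict_ell2 :: "int set \<Rightarrow> ell2 \<Rightarrow> ell2" is "\<lambda>A f n. if n \<in> A then f n else 0"
  subgoal for A f
    using ell2_mult_closed[of f "\<lambda>n. if n \<in> A then 1 else 0" 1]
    by (simp add: if_distrib[where f = "\<lambda>x. x * _"] cong: if_cong)
  done

lemma coord_restrict_ell2 [simp]: "coord (restrict_ell2 A x) n = (if n \<in> A then coord x n else 0)"
  by (simp add: restrict_ell2.rep_eq)

lemma norm_restrict_ell2: "(norm (restrict_ell2 A x))\<^sup>2 = (\<Sum>\<^sub>\<infinity>n\<in>A. (cmod (coord x n))\<^sup>2)"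
  unfolding norm_ell2_eq by (rule infsum_cong_neutral) auto

lemma norm_restrict_ell2_insert:
  assumes "k \<notin> A"
  shows "(norm (restrict_ell2 (insert k A) x))\<^sup>2 = (cmod (coord x k))\<^sup>2 + (norm (restrict_ell2 A x))\<^sup>2"
proof -
  have "(\<Sum>\<^sub>\<infinity>n\<in>{k} \<union> A. (cmod (coord x n))\<^sup>2) =
      (\<Sum>\<^sub>\<infinity>n\<in>{k}. (cmod (coord x n))\<^sup>2) + (\<Sum>\<^sub>\<infinity>n\<in>A. (cmod (coord x n))\<^sup>2)"
    by (rule infsum_Un_disjoint) (use assms summable_on_subset_banach[OF coord_summable] in auto)
  then show ?thesis by (simp add: norm_restrict_ell2)
qed

lemma norm_restrict_ell2_empty: "norm (restrict_ell2 {} x) = 0"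
  using norm_restrict_ell2[of "{}" x] by simp

lemma norm_restrict_ell2_le: "norm (restrict_ell2 A x) \<le> norm x"
proof (rule ell2_norm_le)
  fix F :: "int set" assume F: "finite F"
  have "(\<Sum>n\<in>F. (cmod (coord (restrict_ell2 A x) n))\<^sup>2) \<le> (\<Sum>n\<in>F. (cmod (coord x n))\<^sup>2)"
    by (rule sum_mono) simp
  then show "(\<Sum>n\<in>F. (cmod (coord (restrict_ell2 A x) n))\<^sup>2) \<le> (norm x)\<^sup>2"
    using sum_coord_le_norm[OF F, of x] by simp
qed simp

lemma norm_two_deltas:
  assumes "p \<noteq> q"
  shows "(norm (a *\<^sub>C delta p + b *\<^sub>C delta q))\<^sup>2 = (cmod a)\<^sup>2 + (cmod b)\<^sup>2"
proof -
  let ?x = "a *\<^sub>C delta p + b *\<^sub>C delta q"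
  have "?x = restrict_ell2 (insert p (insert q {})) ?x"
    by (rule ell2_eqI) auto
  then have "(norm ?x)\<^sup>2 = (norm (restrict_ell2 (insert p (insert q {})) ?x))\<^sup>2"
    by simp
  also have "\<dots> = (cmod a)\<^sup>2 + (cmod b)\<^sup>2"
    using assms by (subst norm_restrict_ell2_insert, simp, subst norm_restrict_ell2_insert, simp)
      (simp add: norm_restrict_ell2_empty)
  finally show ?thesis .
qed

lemma norm_delta [simp]: "norm (delta n) = 1"
proof -
  have "(norm (delta n))\<^sup>2 = 1"
    using norm_two_deltas[of n "n + 1" 1 0] by (simp add: cscale_simps)
  then show ?thesis by (simp add: power2_eq_1_iff) (metis norm_ge_zero not_one_le_zero one_neq_neg_one le_minus_one_simps(3))
qed

context bounded_potential
begin

text \<open>\<open>B\<close> stays abstract because it has two sources: the inverse height of a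
  horizontal line, and a compactness bound on the vertical sides, where z may be real.\<close>

lemma cut_off_right:
  assumes u: "H u - z *\<^sub>C u = delta j" and "j < N" and B: "\<And>x. norm x \<le> B * norm (H x - z *\<^sub>C x)"
  shows "(norm (restrict_ell2 {N..} u))\<^sup>2 \<le> B\<^sup>2 * ((cmod (coord u N))\<^sup>2 + (cmod (coord u (N - 1)))\<^sup>2)"
proof -
  let ?w = "restrict_ell2 {N..} u"
  have "coord (H u - z *\<^sub>C u) n = 0" if "n \<ge> N" for n
    using u that \<open>j < N\<close> by simp
  then have eq: "coord u (n + 1) + coord u (n - 1) + complex_of_real (V n) * coord u n = z * coord u n"
    if "n \<ge> N" for n
    using that by simp
  \<comment> \<open>Site \<open>N - 1\<close> still feels its surviving neighbour \<open>N\<close>,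
    while site \<open>N\<close> misses the removed value at \<open>N - 1\<close>; everywhere else
    the equation is intact or trivial.\<close>
  have "H ?w - z *\<^sub>C ?w = coord u N *\<^sub>C delta (N - 1) + (- coord u (N - 1)) *\<^sub>C delta N" (is "?l = ?r")
  proof (rule ell2_eqI)
    fix n
    consider "n < N - 1" | "n = N - 1" | "n = N" | "n > N" by linarith
    then show "coord ?l n = coord ?r n"
      by cases (use eq[of n] in \<open>auto simp: algebra_simps\<close>)
  qed
  then have "norm ?w \<le> B * norm (coord u N *\<^sub>C delta (N - 1) + (- coord u (N - 1)) *\<^sub>C delta N)"
    using B[of ?w] by simp
  then have "(norm ?w)\<^sup>2 \<le> (B * norm (coord u N *\<^sub>C delta (N - 1) + (- coord u (N - 1)) *\<^sub>C delta N))\<^sup>2"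
    by (rule power_mono) simp
  also have "\<dots> = B\<^sup>2 * ((cmod (coord u N))\<^sup>2 + (cmod (coord u (N - 1)))\<^sup>2)"
    unfolding power_mult_distrib by (subst norm_two_deltas) auto
  finally show ?thesis .
qed

lemma cut_off_left:
  assumes u: "H u - z *\<^sub>C u = delta j" and "N < j" and B: "\<And>x. norm x \<le> B * norm (H x - z *\<^sub>C x)"
  shows "(norm (restrict_ell2 {..N} u))\<^sup>2 \<le> B\<^sup>2 * ((cmod (coord u N))\<^sup>2 + (cmod (coord u (N + 1)))\<^sup>2)"
proof -
  let ?w = "restrict_ell2 {..N} u"
  have "coord (H u - z *\<^sub>C u) n = 0" if "n \<le> N" for n
    using u that \<open>N < j\<close> by simp
  then have eq: "coord u (n + 1) + coord u (n - 1) + complex_of_real (V n) * coord u n = z * coord u n"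
    if "n \<le> N" for n
    using that by simp
  have "H ?w - z *\<^sub>C ?w = coord u N *\<^sub>C delta (N + 1) + (- coord u (N + 1)) *\<^sub>C delta N" (is "?l = ?r")
  proof (rule ell2_eqI)
    fix n
    consider "n > N + 1" | "n = N + 1" | "n = N" | "n < N" by linarith
    then show "coord ?l n = coord ?r n"
      by cases (use eq[of n] in \<open>auto simp: algebra_simps\<close>)
  qed
  then have "norm ?w \<le> B * norm (coord u N *\<^sub>C delta (N + 1) + (- coord u (N + 1)) *\<^sub>C delta N)"
    using B[of ?w] by simp
  then have "(norm ?w)\<^sup>2 \<le> (B * norm (coord u N *\<^sub>C delta (N + 1) + (- coord u (N + 1)) *\<^sub>C delta N))\<^sup>2"
    by (rule power_mono) simp
  also have "\<dots> = B\<^sup>2 * ((cmod (coord u N))\<^sup>2 + (cmod (coord u (N + 1)))\<^sup>2)"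
    unfolding power_mult_distrib by (subst norm_two_deltas) auto
  finally show ?thesis .
qed

end

section \<open>Decay of the Green function away from its source\<close>

lemma exp_minus_le_inverse_power:
  fixes x :: real assumes "0 < x"
  shows "exp (- x) \<le> fact s / x ^ s"
proof -
  have "x ^ s / fact s \<le> (\<Sum>k. x ^ k / fact k)"
    using sum_le_suminf[of "\<lambda>k. x ^ k / fact k" "{s}"] summable_exp_generic[of x] assms
    by (simp add: scaleR_conv_of_real field_simps)
  also have "\<dots> = exp x"
    by (simp add: exp_def scaleR_conv_of_real field_simps)
  finally show ?thesis
    using assms by (simp add: exp_minus field_simps)
qed

text \<open>Monotonicity and \<open>rec\<close> give S(n + 2) <= B^2 (S(n) - S(n + 2)), so two steps
  shrink \<open>S\<close> by \<open>q = B\<^sup>2 / (1 + B\<^sup>2)\<close>. The geometric decay is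
  weakened to a power because \<open>B\<close> will be of order \<open>T\<close>, and then the
  dependence on \<open>T\<close> has to be explicit. The 8 is 2 * 4, from 1 + B^2 <= 2 B^2 and n <=
  4 j.\<close>

lemma tail_decay:
  fixes S :: "nat \<Rightarrow> real"
  assumes dec: "\<And>n. S (Suc n) \<le> S n" and nn: "\<And>n. 0 \<le> S n" and bd: "\<And>n. S n \<le> B\<^sup>2"
    and B: "1 \<le> B" and rec: "\<And>n. 1 \<le> n \<Longrightarrow> S (Suc n) \<le> B\<^sup>2 * (S n - S (Suc (Suc n)))"
    and n: "1 \<le> n"
  shows "S n \<le> B\<^sup>2 * (fact s * (8 * B\<^sup>2 / real n) ^ s)"
proof -
  define q where "q = 1 - 1 / (1 + B\<^sup>2)"
  have B2: "B\<^sup>2 \<ge> 1" using B by simp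
  then have q: "0 \<le> q" "q * (1 + B\<^sup>2) = B\<^sup>2"
    by (auto simp: q_def field_simps)
  have step: "S (Suc (Suc n)) \<le> q * S n" if "1 \<le> n" for n
  proof -
    have "(1 + B\<^sup>2) * S (Suc (Suc n)) \<le> B\<^sup>2 * S n"
      using rec[OF that] dec[of "Suc n"] by (simp add: algebra_simps)
    also have "\<dots> = (1 + B\<^sup>2) * (q * S n)" using q by (simp add: mult_ac)
    finally show ?thesis using B2 by (simp add: mult_le_cancel_left)
  qed
  have geo: "S (1 + 2 * j) \<le> q ^ j * B\<^sup>2" for j
  proof (induction j)
    case (Suc j)
    have "S (1 + 2 * Suc j) \<le> q * S (1 + 2 * j)"
      using step[of "1 + 2 * j"] by simp
    also have "\<dots> \<le> q * (q ^ j * B\<^sup>2)"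
      using Suc q by (intro mult_left_mono) auto
    finally show ?case by simp
  qed (use bd in simp)
  show ?thesis
  proof (cases "n \<ge> 4")
    case False
    \<comment> \<open>For \<open>n < 4\<close> the claimed bound is no better than the trivial bound
      by B^2.\<close>
    have "1 \<le> 8 * B\<^sup>2 / real n"
      using False n B2 by (simp add: field_simps)
    then have "1 \<le> (8 * B\<^sup>2 / real n) ^ s" by simp
    moreover have "(1::real) \<le> fact s" by simp
    ultimately have "1 * 1 \<le> (fact s :: real) * (8 * B\<^sup>2 / real n) ^ s"
      by (intro mult_mono) auto
    then have "B\<^sup>2 * 1 \<le> B\<^sup>2 * (fact s * (8 * B\<^sup>2 / real n) ^ s)"
      by (intro mult_left_mono) auto
    then show ?thesis using bd[of n] by simp
  next
    case True
    \<comment> \<open>The number of double steps that fit between index 1, where \<open>rec\<close>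
      starts to hold, and \<open>n\<close>.\<close>
    define j where "j = (n - 1) div 2"
    have j: "1 + 2 * j \<le> n" "n \<le> 4 * j" "j \<ge> 1" using True by (auto simp: j_def)
    have "S n \<le> S (1 + 2 * j)"
      using dec j(1) by (rule lift_Suc_antimono_le)
    also have "\<dots> \<le> q ^ j * B\<^sup>2" by (rule geo)
    also have "\<dots> \<le> (exp (- 1 / (1 + B\<^sup>2))) ^ j * B\<^sup>2"
      using exp_ge_add_one_self[of "- 1 / (1 + B\<^sup>2)"] q(1)
      by (intro mult_right_mono power_mono) (auto simp: q_def)
    also have "\<dots> = B\<^sup>2 * exp (- (real j / (1 + B\<^sup>2)))"
      by (simp flip: exp_of_nat_mult)
    also have "\<dots> \<le> B\<^sup>2 * (fact s / (real j / (1 + B\<^sup>2)) ^ s)"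
      using j B2 by (intro mult_left_mono exp_minus_le_inverse_power) (auto simp: add_pos_nonneg)
    also have "\<dots> = B\<^sup>2 * (fact s * ((1 + B\<^sup>2) / real j) ^ s)"
      by (simp add: power_divide)
    also have "\<dots> \<le> B\<^sup>2 * (fact s * (8 * B\<^sup>2 / real n) ^ s)"
    proof (intro mult_left_mono power_mono)
      have "(1 + B\<^sup>2) * real n \<le> (2 * B\<^sup>2) * (4 * real j)"
        using j B2 by (intro mult_mono) auto
      then show "(1 + B\<^sup>2) / real j \<le> 8 * B\<^sup>2 / real n"
        using j n by (simp add: field_simps)
    qed auto
    finally show ?thesis .
  qed
qed

context bounded_potential
begin

text \<open>A substitute for the Combes-Thomas estimate: by the cut-off, the tail sums \<open>S\<close> of \<open>|u|\<^sup>2\<close> satisfy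
  \<open>S(k) \<le> B\<^sup>2 (|u(k)|\<^sup>2 + |u(k - 1)|\<^sup>2) = B\<^sup>2 (S(k - 1) - S(k + 1))\<close>.\<close>

lemma green_decay:
  assumes u: "H u - z *\<^sub>C u = delta 1" and B: "\<And>x. norm x \<le> B * norm (H x - z *\<^sub>C x)"
    and B1: "1 \<le> B" and n: "n \<noteq> 0"
  shows "(cmod (coord u n))\<^sup>2 \<le> B\<^sup>2 * (fact s * (8 * B\<^sup>2 / \<bar>real_of_int n\<bar>) ^ s)"
proof -
  have u_le: "norm u \<le> B" using B[of u] u by simp
  have bd: "(norm (restrict_ell2 A u))\<^sup>2 \<le> B\<^sup>2" for A
    using u_le norm_restrict_ell2_le[of A u] by (intro power_mono) auto
  show ?thesis
  proof (cases "n > 0")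
    case True
    define S where "S k = (norm (restrict_ell2 {int k..} u))\<^sup>2" for k
    have S_Suc: "S k = (cmod (coord u (int k)))\<^sup>2 + S (Suc k)" for k
    proof -
      have "{int k..} = insert (int k) {int (Suc k)..}" by auto
      then show ?thesis unfolding S_def by (simp only:) (rule norm_restrict_ell2_insert, simp)
    qed
    have "S (nat n) \<le> B\<^sup>2 * (fact s * (8 * B\<^sup>2 / real (nat n)) ^ s)"
    proof (rule tail_decay)
      fix k :: nat assume "1 \<le> k"
      show "S (Suc k) \<le> B\<^sup>2 * (S k - S (Suc (Suc k)))"
        using cut_off_right[OF u _ B, of "int (Suc k)"] \<open>1 \<le> k\<close> S_Suc[of k] S_Suc[of "Suc k"]
        by (simp add: S_def add.commute)
    next
      show "S (Suc k) \<le> S k" for k using S_Suc[of k] by simp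
    qed (use bd B1 True in \<open>auto simp: S_def\<close>)
    moreover have "(cmod (coord u n))\<^sup>2 \<le> S (nat n)"
      using S_Suc[of "nat n"] True by (simp add: S_def)
    ultimately show ?thesis using True by simp
  next
    case False
    define S where "S k = (norm (restrict_ell2 {..- int k} u))\<^sup>2" for k
    have S_Suc: "S k = (cmod (coord u (- int k)))\<^sup>2 + S (Suc k)" for k
    proof -
      have "{..- int k} = insert (- int k) {..- int (Suc k)}" by auto
      then show ?thesis unfolding S_def by (simp only:) (rule norm_restrict_ell2_insert, simp)
    qed
    have "S (nat (- n)) \<le> B\<^sup>2 * (fact s * (8 * B\<^sup>2 / real (nat (- n))) ^ s)"
    proof (rule tail_decay)
      fix k :: nat assume "1 \<le> k"
      show "S (Suc k) \<le> B\<^sup>2 * (S k - S (Suc (Suc k)))"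
        using cut_off_left[OF u _ B, of "- int (Suc k)"] \<open>1 \<le> k\<close> S_Suc[of k] S_Suc[of "Suc k"]
        by (simp add: S_def add.commute)
    next
      show "S (Suc k) \<le> S k" for k using S_Suc[of k] by simp
    qed (use bd B1 False n in \<open>auto simp: S_def\<close>)
    moreover have "(cmod (coord u n))\<^sup>2 \<le> S (nat (- n))"
      using S_Suc[of "nat (- n)"] False by (simp add: S_def)
    ultimately show ?thesis using False by simp
  qed
qed

end

section \<open>Growth of products of unimodular matrices\<close>

definition wronskian :: "complex^2 \<Rightarrow> complex^2 \<Rightarrow> complex" where
  "wronskian x y = x$1 * y$2 - x$2 * y$1"

lemma norm_complex2_sq: "(norm (v::complex^2))\<^sup>2 = (cmod (v$1))\<^sup>2 + (cmod (v$2))\<^sup>2"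
  by (simp add: norm_vec_def L2_set_def sum_2)

lemma two_Cauchy_Schwarz:
  "cmod (a * c + b * d) \<le> sqrt ((cmod a)\<^sup>2 + (cmod b)\<^sup>2) * sqrt ((cmod c)\<^sup>2 + (cmod d)\<^sup>2)"
proof -
  have "cmod (a * c + b * d) \<le> cmod a * cmod c + cmod b * cmod d"
    by (metis norm_mult norm_triangle_ineq)
  also have "\<dots> \<le> sqrt ((cmod a)\<^sup>2 + (cmod b)\<^sup>2) * sqrt ((cmod c)\<^sup>2 + (cmod d)\<^sup>2)"
    using L2_set_mult_ineq[where A = UNIV and f = "\<lambda>i. if i then cmod a else cmod b" and g = "\<lambda>i. if i then cmod c else cmod d"]
    by (simp add: L2_set_def UNIV_bool add.commute)
  finally show ?thesis .
qed

lemma norm_complex2: "norm (v::complex^2) = sqrt ((cmod (v$1))\<^sup>2 + (cmod (v$2))\<^sup>2)"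
  by (simp add: norm_vec_def L2_set_def sum_2)

lemma wronskian_le: "cmod (wronskian x y) \<le> norm x * norm y"
  using two_Cauchy_Schwarz[of "x$1" "y$2" "- (x$2)" "y$1"]
  by (simp add: wronskian_def norm_complex2 add.commute)

text \<open>\<open>d\<close> is the coefficient of the orthogonal projection onto \<open>U\<close>.
  The remainder is a multiple of the orthogonal vector (- cnj U2, cnj U1), and the Wronskian with
  \<open>U\<close> measures exactly that multiple.\<close>

lemma split_along_vector:
  fixes U x :: "complex^2"
  assumes "U \<noteq> 0"
  shows "\<exists>d. cmod d \<le> norm x / norm U \<and> norm (x - d *s U) \<le> cmod (wronskian U x) / norm U"
proof -
  define h where "h = (norm U)\<^sup>2"
  have h: "0 < h" "h = norm U * norm U"
    using assms by (auto simp: h_def power2_eq_square)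
  have hc: "complex_of_real h = U$1 * cnj (U$1) + U$2 * cnj (U$2)"
    unfolding h_def norm_complex2_sq of_real_add complex_norm_square ..
  define d where "d = (x$1 * cnj (U$1) + x$2 * cnj (U$2)) / of_real h"
  have "cmod (x$1 * cnj (U$1) + x$2 * cnj (U$2)) \<le> norm x * norm U"
    using two_Cauchy_Schwarz[of "x$1" "cnj (U$1)" "x$2" "cnj (U$2)"] by (simp add: norm_complex2)
  then have "cmod d \<le> norm x * norm U / h"
    unfolding d_def norm_divide norm_of_real using h(1) by (simp add: divide_right_mono)
  then have 1: "cmod d \<le> norm x / norm U"
    using assms by (simp add: h(2))
  have "(x - d *s U)$1 * h = - cnj (U$2) * wronskian U x"
    using h(1) by (simp add: d_def wronskian_def field_simps) (simp add: hc algebra_simps)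
  then have c1: "cmod ((x - d *s U)$1) * h = cmod (U$2) * cmod (wronskian U x)"
    by (metis norm_mult norm_of_real abs_of_pos h(1) norm_minus_cancel complex_mod_cnj mult_minus_left)
  have "(x - d *s U)$2 * h = cnj (U$1) * wronskian U x"
    using h(1) by (simp add: d_def wronskian_def field_simps) (simp add: hc algebra_simps)
  then have c2: "cmod ((x - d *s U)$2) * h = cmod (U$1) * cmod (wronskian U x)"
    by (metis norm_mult norm_of_real abs_of_pos h(1) complex_mod_cnj)
  have "(norm (x - d *s U) * h)\<^sup>2 = (cmod ((x - d *s U)$1) * h)\<^sup>2 + (cmod ((x - d *s U)$2) * h)\<^sup>2"
    by (simp only: power_mult_distrib norm_complex2_sq distrib_right)
  also have "\<dots> = (norm U * cmod (wronskian U x))\<^sup>2"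
    unfolding c1 c2 power_mult_distrib norm_complex2_sq by (simp add: algebra_simps)
  finally have "norm (x - d *s U) * h = norm U * cmod (wronskian U x)"
    using h(1) by (simp add: power2_eq_iff_nonneg)
  then have "norm (x - d *s U) = cmod (wronskian U x) / norm U"
    using assms by (simp add: h(2) field_simps)
  with 1 show ?thesis by auto
qed

lemma wronskian_matrix: "wronskian (A *v x) (A *v y) = det A * wronskian x y"
  by (simp add: wronskian_def det_2 matrix_vector_mult_def sum_2 algebra_simps)

text \<open>Reduction of order: modulo a multiple of the given orbit \<open>P j *v U\<close>, any other orbit has norm
  \<open>|\<omega>| / norm (P j *v U)\<close>, where \<open>\<omega>\<close> is the conserved Wronskian, and the coefficient of that multiple
  changes by at most \<open>\<tau> |\<omega>| / (m norm U)\<^sup>2\<close> per step.\<close>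

lemma matrix_opnorm_growth:
  fixes A P :: "nat \<Rightarrow> complex^2^2" and U :: "complex^2"
  assumes P0: "P 0 = mat 1" and PS: "\<And>j. j < k \<Longrightarrow> P (Suc j) = A j ** P j"
    and det: "\<And>j. j < k \<Longrightarrow> det (A j) = 1"
    and bd: "\<And>j x. j < k \<Longrightarrow> norm (A j *v x) \<le> \<tau> * norm x" and \<tau>: "0 \<le> \<tau>"
    and m: "0 < m" "m \<le> 1" and low: "\<And>j. j \<le> k \<Longrightarrow> m * norm U \<le> norm (P j *v U)"
  shows "matrix_opnorm (P k) * norm U \<le> (1 + (real k * \<tau> + 1) / m\<^sup>2) * norm (P k *v U)"
proof (cases "U = 0")
  case False
  define a where "a = norm U"
  have a: "a > 0" using False by (simp add: a_def)
  have "norm (P k *v w) \<le> ((1 + (real k * \<tau> + 1) / m\<^sup>2) * norm (P k *v U) / a) * norm w" for w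
  proof -
    define \<omega> where "\<omega> = wronskian U w"
    have om: "cmod \<omega> \<le> a * norm w"
      unfolding \<omega>_def a_def by (rule wronskian_le)
    have W: "j \<le> k \<Longrightarrow> wronskian (P j *v U) (P j *v w) = \<omega>" for j
      by (induction j) (simp_all add: P0 PS det \<omega>_def wronskian_matrix flip: matrix_vector_mul_assoc)
    have pos: "0 < norm (P j *v U)" "m * a \<le> norm (P j *v U)" if "j \<le> k" for j
      using low[OF that] mult_pos_pos[OF m(1) a] by (auto simp: a_def)
    have ind: "j \<le> k \<Longrightarrow> \<exists>c. cmod c \<le> norm w / a + real j * (\<tau> * cmod \<omega> / (m * a)\<^sup>2) \<and>
        norm (P j *v w - c *s (P j *v U)) \<le> cmod \<omega> / norm (P j *v U)" for j
    proof (induction j)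
      case 0
      show ?case
        using split_along_vector[OF False, of w] by (simp add: P0 \<omega>_def a_def)
    next
      case (Suc j)
      then obtain c where c: "cmod c \<le> norm w / a + real j * (\<tau> * cmod \<omega> / (m * a)\<^sup>2)"
          "norm (P j *v w - c *s (P j *v U)) \<le> cmod \<omega> / norm (P j *v U)"
        by auto
      \<comment> \<open>The remainder is carried one step further and split again along the new
        vector of the orbit; this corrects the coefficient by \<open>d\<close>. Subtracting
        multiples of the orbit leaves the Wronskian equal to \<open>\<omega>\<close>, so the
        remainder does not accumulate.\<close>
      define x where "x = A j *v (P j *v w - c *s (P j *v U))"
      have x: "x = P (Suc j) *v w - c *s (P (Suc j) *v U)"
        using Suc.prems
        by (simp add: x_def PS matrix_vector_mult_diff_distrib vector_scalar_commute flip: matrix_vector_mul_assoc)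
      have "norm x \<le> \<tau> * (cmod \<omega> / norm (P j *v U))"
        unfolding x_def using c(2) \<tau> Suc.prems by (intro order_trans[OF bd] mult_left_mono) auto
      also have "\<dots> \<le> \<tau> * (cmod \<omega> / (m * a))"
        using pos[of j] Suc.prems m a \<tau> by (intro mult_left_mono divide_left_mono) auto
      finally have nx: "norm x \<le> \<tau> * cmod \<omega> / (m * a)" by simp
      have "P (Suc j) *v U \<noteq> 0" using pos(1)[of "Suc j"] Suc.prems by auto
      from split_along_vector[OF this, of x] obtain d where
        d: "cmod d \<le> norm x / norm (P (Suc j) *v U)"
          "norm (x - d *s (P (Suc j) *v U)) \<le> cmod (wronskian (P (Suc j) *v U) x) / norm (P (Suc j) *v U)"
        by auto
      have "wronskian (P (Suc j) *v U) x = \<omega>"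
        unfolding x using W[OF Suc.prems] by (simp add: wronskian_def algebra_simps)
      moreover have "x - d *s (P (Suc j) *v U) = P (Suc j) *v w - (c + d) *s (P (Suc j) *v U)"
        by (simp add: x vec_eq_iff algebra_simps)
      moreover have "cmod d \<le> \<tau> * cmod \<omega> / (m * a)\<^sup>2"
      proof -
        have "cmod d \<le> norm x / norm (P (Suc j) *v U)" by (rule d)
        also have "\<dots> \<le> (\<tau> * cmod \<omega> / (m * a)) / (m * a)"
          using nx pos[OF Suc.prems] m a \<tau> by (intro frac_le) auto
        finally show ?thesis by (simp add: power2_eq_square)
      qed
      moreover have "norm w / a + real j * (\<tau> * cmod \<omega> / (m * a)\<^sup>2) + \<tau> * cmod \<omega> / (m * a)\<^sup>2 =
          norm w / a + real (Suc j) * (\<tau> * cmod \<omega> / (m * a)\<^sup>2)"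
        by (simp only: of_nat_Suc distrib_right mult_1 ac_simps)
      ultimately have "cmod (c + d) \<le> norm w / a + real (Suc j) * (\<tau> * cmod \<omega> / (m * a)\<^sup>2)"
        and "norm (P (Suc j) *v w - (c + d) *s (P (Suc j) *v U)) \<le> cmod \<omega> / norm (P (Suc j) *v U)"
        using d c(1) norm_triangle_ineq[of c d] by (linarith, metis)
      then show ?case by blast
    qed
    define b where "b = norm (P k *v U)"
    obtain c where c: "cmod c \<le> norm w / a + real k * (\<tau> * cmod \<omega> / (m * a)\<^sup>2)"
        "norm (P k *v w - c *s (P k *v U)) \<le> cmod \<omega> / b"
      using ind[of k] by (auto simp: b_def)
    have b: "0 < b" "m * a \<le> b" using pos[of k] by (auto simp: b_def)
    have "cmod c \<le> norm w / a + real k * (\<tau> * (a * norm w) / (m * a)\<^sup>2)"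
      using om \<tau> by (intro order_trans[OF c(1)] add_left_mono mult_left_mono divide_right_mono) auto
    also have "\<dots> = norm w / a * (1 + real k * \<tau> / m\<^sup>2)"
      using a m by (simp add: power2_eq_square field_simps)
    finally have c1: "cmod c \<le> norm w / a * (1 + real k * \<tau> / m\<^sup>2)" .
    \<comment> \<open>The factor \<open>b\<close> is kept in the numerator and only
      \<open>b * b\<close> below is estimated: the final bound has to be proportional to
      \<open>norm (P k *v U)\<close>.\<close>
    have "cmod \<omega> / b \<le> (a * norm w) * b / (b * b)"
      using om b by (simp add: divide_right_mono)
    also have "\<dots> \<le> (a * norm w) * b / ((m * a) * (m * a))"
      using b m a by (intro divide_left_mono mult_mono) auto
    also have "\<dots> = norm w / a * b / m\<^sup>2"
      using a m by (simp add: power2_eq_square field_simps)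
    finally have c2: "cmod \<omega> / b \<le> norm w / a * b / m\<^sup>2" .
    have sn: "norm (c *s (P k *v U)) = cmod c * b"
    proof -
      have "(norm (c *s (P k *v U)))\<^sup>2 = (cmod c * b)\<^sup>2"
        unfolding b_def power_mult_distrib norm_complex2_sq by (simp add: norm_mult power_mult_distrib algebra_simps)
      then show ?thesis using b by (simp add: power2_eq_iff_nonneg)
    qed
    have "norm (P k *v w) \<le> norm (P k *v w - c *s (P k *v U)) + norm (c *s (P k *v U))"
      by (metis diff_add_cancel norm_triangle_ineq)
    also have "\<dots> \<le> norm w / a * b / m\<^sup>2 + norm w / a * (1 + real k * \<tau> / m\<^sup>2) * b"
      unfolding sn using c(2) c2 c1 b by (intro add_mono mult_right_mono) auto
    also have "\<dots> = ((1 + (real k * \<tau> + 1) / m\<^sup>2) * b / a) * norm w"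
      using m a by (simp add: field_simps)
    finally show ?thesis by (simp add: b_def)
  qed
  then have "matrix_opnorm (P k) \<le> (1 + (real k * \<tau> + 1) / m\<^sup>2) * norm (P k *v U) / a"
    unfolding matrix_opnorm_def by (rule onorm_le)
  then show ?thesis using a by (simp add: a_def[symmetric] field_simps)
qed simp

section \<open>Transfer matrices and the Green function\<close>

lemma transfer_step_mult: "transfer_step V m z *v x = vector [(z - complex_of_real (V m)) * x$1 - x$2, x$1]"
  by (simp add: transfer_step_def matrix_vector_mult_def vec_eq_iff sum_2 forall_2)

lemma matrix_inv_transfer_step:
  "matrix_inv (transfer_step V m z) = vector [vector [0, 1], vector [-1, z - complex_of_real (V m)]]"
  (is "_ = ?B")
proof -
  have "transfer_step V m z ** ?B = mat 1" "?B ** transfer_step V m z = mat 1"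
    by (simp_all add: transfer_step_def matrix_matrix_mult_def mat_def vec_eq_iff sum_2 forall_2)
  then have *: "transfer_step V m z ** ?B = mat 1 \<and> ?B ** transfer_step V m z = mat 1" by simp
  \<comment> \<open>\<open>matrix_inv\<close> is a choice of some two-sided inverse; it is
    identified with \<open>?B\<close> by uniqueness.\<close>
  then have "matrix_inv (transfer_step V m z) ** transfer_step V m z = mat 1"
    unfolding matrix_inv_def by (rule someI2) simp
  then show ?thesis
    using matrix_mul_assoc[of "matrix_inv (transfer_step V m z)" "transfer_step V m z" ?B] *
    by (simp only: matrix_mul_lid matrix_mul_rid)
qed

lemma matrix_inv_transfer_step_mult:
  "matrix_inv (transfer_step V m z) *v x = vector [x$2, (z - complex_of_real (V m)) * x$2 - x$1]"
  by (simp add: matrix_inv_transfer_step matrix_vector_mult_def vec_eq_iff sum_2 forall_2)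

lemma det_transfer_step: "det (transfer_step V m z) = 1" "det (matrix_inv (transfer_step V m z)) = 1"
  by (simp_all add: matrix_inv_transfer_step det_2, simp_all add: transfer_step_def)

lemma norm_complex2_le: "norm (v::complex^2) \<le> cmod (v$1) + cmod (v$2)"
  unfolding norm_complex2 by (rule sqrt_sum_squares_le_sum) auto

lemma norm_transfer_step_le:
  assumes "cmod (z - complex_of_real (V m)) \<le> b"
  shows "norm (transfer_step V m z *v x) \<le> (b + 2) * norm x"
    and "norm (matrix_inv (transfer_step V m z) *v x) \<le> (b + 2) * norm x"
proof -
  let ?a = "z - complex_of_real (V m)"
  have x: "cmod (x$1) \<le> norm x" "cmod (x$2) \<le> norm x" by (rule Finite_Cartesian_Product.norm_nth_le)+
  have *: "cmod (?a * y - y') + cmod y \<le> (b + 2) * norm x"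
    if "cmod y \<le> norm x" "cmod y' \<le> norm x" for y y'
  proof -
    have "cmod (?a * y - y') + cmod y \<le> cmod ?a * cmod y + cmod y' + cmod y"
      using norm_triangle_ineq4[of "?a * y" y'] by (simp add: norm_mult)
    also have "\<dots> \<le> b * norm x + norm x + norm x"
      using that assms order_trans[OF norm_ge_zero assms] by (intro add_mono mult_mono) auto
    finally show ?thesis by (simp add: algebra_simps)
  qed
  show "norm (transfer_step V m z *v x) \<le> (b + 2) * norm x"
    using norm_complex2_le[of "transfer_step V m z *v x"] *[of "x$1" "x$2"] x by (simp add: transfer_step_mult)
  show "norm (matrix_inv (transfer_step V m z) *v x) \<le> (b + 2) * norm x"
    using norm_complex2_le[of "matrix_inv (transfer_step V m z) *v x"] *[of "x$2" "x$1"] x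
    by (simp add: matrix_inv_transfer_step_mult)
qed

lemma transfer_pos_solution:
  assumes "\<And>m. 1 \<le> m \<Longrightarrow> m \<le> int k \<Longrightarrow> v (m + 1) + v (m - 1) + complex_of_real (V m) * v m = z * v m"
  shows "j \<le> k \<Longrightarrow> transfer_pos V z j *v vector [v 1, v 0] = vector [v (int j + 1), v (int j)]"
proof (induction j)
  case (Suc j)
  have "v (int (Suc j) + 1) = (z - complex_of_real (V (int (Suc j)))) * v (int (Suc j)) - v (int j)"
    using assms[of "int (Suc j)"] Suc.prems by (simp add: algebra_simps)
  then show ?case
    using Suc by (simp add: transfer_step_mult add.commute flip: matrix_vector_mul_assoc)
qed simp

lemma transfer_neg_solution:
  assumes "\<And>m. - int k < m \<Longrightarrow> m \<le> 0 \<Longrightarrow> v (m + 1) + v (m - 1) + complex_of_real (V m) * v m = z * v m"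
  shows "j \<le> k \<Longrightarrow> transfer_neg V z j *v vector [v 1, v 0] = vector [v (1 - int j), v (- int j)]"
proof (induction j)
  case (Suc j)
  have "v (- int j - 1) = (z - complex_of_real (V (- int j))) * v (- int j) - v (1 - int j)"
    using assms[of "- int j"] Suc.prems by (simp add: algebra_simps)
  moreover have "- int (Suc j) = - int j - 1" "1 - int (Suc j) = - int j" by simp_all
  ultimately show ?case
    using Suc by (simp only: transfer_neg.simps matrix_inv_transfer_step_mult vector_2 flip: matrix_vector_mul_assoc)
qed simp

lemma norm_vector2_sq: "(norm (vector [a, b] :: complex^2))\<^sup>2 = (cmod a)\<^sup>2 + (cmod b)\<^sup>2"
  by (simp add: norm_complex2_sq)

lemma matrix_opnorm_nonneg: "0 \<le> matrix_opnorm A"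
  unfolding matrix_opnorm_def by (rule onorm_pos_le) (auto simp: linear_conv_bounded_linear)

context bounded_potential
begin

text \<open>This is \<open>matrix_opnorm_growth\<close> for the orbit of (v(1), v(0)) with lower
  constant \<open>1 / B\<close>. That constant comes from the cut-off lemmas: truncating on the side
  of the source keeps the sites 0 and 1, whose values are then bounded by the two values at the cut,
  which are the components of the orbit vector.\<close>

lemma transfer_matrix_green_bound:
  fixes n k :: int
  assumes v: "H v - z *\<^sub>C v = delta n" and low: "\<And>x. norm x \<le> B * norm (H x - z *\<^sub>C x)" and B: "1 \<le> B"
    and Vb: "\<And>m. cmod (z - complex_of_real (V m)) \<le> b"
    and k: "k \<noteq> 0" and n: "0 < k \<and> k < n \<or> k < 0 \<and> n < k"
  shows "(matrix_opnorm (transfer_matrix V k z))\<^sup>2 * (cmod (coord v 1))\<^sup>2 \<le>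
    (1 + (\<bar>real_of_int k\<bar> * (b + 2) + 1) * B\<^sup>2)\<^sup>2 * ((cmod (coord v (k + 1)))\<^sup>2 + (cmod (coord v k))\<^sup>2)"
proof -
  let ?v = "coord v"
  let ?U = "vector [?v 1, ?v 0] :: complex^2"
  have "coord (H v - z *\<^sub>C v) m = 0" if "m \<noteq> n" for m
    using v that by simp
  then have eq: "?v (m + 1) + ?v (m - 1) + complex_of_real (V m) * ?v m = z * ?v m" if "m \<noteq> n" for m
    using that by simp
  have b0: "0 \<le> b" by (rule order_trans[OF norm_ge_zero Vb])
  have cut: "1 / B * norm ?U \<le> norm (vector [x, y] :: complex^2)"
    if "(norm (restrict_ell2 A v))\<^sup>2 \<le> B\<^sup>2 * ((cmod x)\<^sup>2 + (cmod y)\<^sup>2)" "0 \<in> A" "1 \<in> A" for A x y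
  proof -
    have "(norm ?U)\<^sup>2 \<le> (norm (restrict_ell2 A v))\<^sup>2"
      using sum_coord_le_norm[of "{0,1}" "restrict_ell2 A v"] that by (simp add: norm_vector2_sq)
    also have "\<dots> \<le> (B * norm (vector [x, y] :: complex^2))\<^sup>2"
      using that by (simp add: power_mult_distrib norm_vector2_sq)
    finally have "norm ?U \<le> B * norm (vector [x, y] :: complex^2)"
      by (rule power2_le_imp_le) (use B in auto)
    then show ?thesis using B by (simp add: field_simps)
  qed
  define K where "K = nat \<bar>k\<bar>"
  have K: "real K = \<bar>real_of_int k\<bar>" "K \<ge> 1" using k by (auto simp: K_def)
  have U0: "1 / B * norm ?U \<le> norm ?U" using mult_right_mono[OF B norm_ge_zero[of ?U]] B by (simp add: field_simps)
  have "matrix_opnorm (transfer_matrix V k z) * norm ?U \<le>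
      (1 + (real K * (b + 2) + 1) / (1 / B)\<^sup>2) * norm (vector [?v (k + 1), ?v k] :: complex^2)"
  proof (cases "0 < k")
    case True
    then have n': "k < n" using n by auto
    have kK: "k = int K" using True by (simp add: K_def)
    have P: "j \<le> K \<Longrightarrow> transfer_pos V z j *v ?U = vector [?v (int j + 1), ?v (int j)]" for j
      by (rule transfer_pos_solution[of K]) (use eq n' kK in auto)
    have "matrix_opnorm (transfer_pos V z K) * norm ?U \<le>
        (1 + (real K * (b + 2) + 1) / (1 / B)\<^sup>2) * norm (transfer_pos V z K *v ?U)"
    proof (rule matrix_opnorm_growth[where A = "\<lambda>j. transfer_step V (int (Suc j)) z"])
      show "norm (transfer_step V (int (Suc j)) z *v x) \<le> (b + 2) * norm x" for j x
        by (rule norm_transfer_step_le[OF Vb])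
      fix j assume j: "j \<le> K"
      show "1 / B * norm ?U \<le> norm (transfer_pos V z j *v ?U)"
      \<comment> \<open>A cut at \<open>j = 0\<close> would not keep both sites 0 and 1; there
        \<open>1 \<le> B\<close> suffices.\<close>
      proof (cases "j = 0")
        case False
        show ?thesis
          using cut_off_left[OF v _ low, of "int j"] j n' kK False
          unfolding P[OF j] by (intro cut[where A = "{..int j}"]) (auto simp: add.commute)
      qed (use U0 in simp)
    qed (use B b0 in \<open>auto simp: det_transfer_step\<close>)
    then show ?thesis
      using P[of K] True kK by (simp add: transfer_matrix_def)
  next
    case False
    then have n': "n < k" "k < 0" using n by auto
    have kK: "k = - int K" using False by (simp add: K_def)
    have P: "j \<le> K \<Longrightarrow> transfer_neg V z j *v ?U = vector [?v (1 - int j), ?v (- int j)]" for j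
      by (rule transfer_neg_solution[of K]) (use eq n' kK in auto)
    have "matrix_opnorm (transfer_neg V z K) * norm ?U \<le>
        (1 + (real K * (b + 2) + 1) / (1 / B)\<^sup>2) * norm (transfer_neg V z K *v ?U)"
    proof (rule matrix_opnorm_growth[where A = "\<lambda>j. matrix_inv (transfer_step V (- int j) z)"])
      show "norm (matrix_inv (transfer_step V (- int j) z) *v x) \<le> (b + 2) * norm x" for j x
        by (rule norm_transfer_step_le[OF Vb])
      fix j assume j: "j \<le> K"
      show "1 / B * norm ?U \<le> norm (transfer_neg V z j *v ?U)"
      proof (cases "j = 0")
        case False
        show ?thesis
          using cut_off_right[OF v _ low, of "1 - int j"] j n' kK False
          unfolding P[OF j] by (intro cut[where A = "{1 - int j..}"]) auto
      qed (use U0 in simp)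
    qed (use B b0 in \<open>auto simp: det_transfer_step\<close>)
    then show ?thesis
      using P[of K] False n' kK by (simp add: transfer_matrix_def)
  qed
  then have "(matrix_opnorm (transfer_matrix V k z) * norm ?U)\<^sup>2 \<le>
      ((1 + (real K * (b + 2) + 1) / (1 / B)\<^sup>2) * norm (vector [?v (k + 1), ?v k] :: complex^2))\<^sup>2"
    by (rule power_mono) (simp add: matrix_opnorm_nonneg)
  then have "(matrix_opnorm (transfer_matrix V k z))\<^sup>2 * (norm ?U)\<^sup>2 \<le>
    (1 + (\<bar>real_of_int k\<bar> * (b + 2) + 1) * B\<^sup>2)\<^sup>2 * ((cmod (coord v (k + 1)))\<^sup>2 + (cmod (coord v k))\<^sup>2)"
    unfolding power_mult_distrib norm_vector2_sq K(1) by (simp add: power_divide)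
  moreover have "(cmod (?v 1))\<^sup>2 \<le> (norm ?U)\<^sup>2" by (simp add: norm_vector2_sq)
  ultimately show ?thesis
    by (meson mult_left_mono order_trans zero_le_power2)
qed

end

section \<open>The resolvent\<close>

text \<open>Meaningful only for \<open>z\<close> outside the spectrum.\<close>

definition resolvent_at :: "(ell2 \<Rightarrow> ell2) \<Rightarrow> complex \<Rightarrow> ell2 \<Rightarrow> ell2" where
  "resolvent_at A z = (SOME R. bounded_linear R \<and>
     (\<forall>\<psi>. R (A \<psi> - z *\<^sub>C \<psi>) = \<psi>) \<and> (\<forall>\<psi>. A (R \<psi>) - z *\<^sub>C R \<psi> = \<psi>))"

lemma resolvent_at:
  assumes "z \<notin> spectrum A"
  shows "bounded_linear (resolvent_at A z)" "resolvent_at A z (A \<psi> - z *\<^sub>C \<psi>) = \<psi>"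
    "A (resolvent_at A z \<psi>) - z *\<^sub>C resolvent_at A z \<psi> = \<psi>"
proof -
  have "\<exists>R. bounded_linear R \<and>
     (\<forall>\<psi>. R (A \<psi> - z *\<^sub>C \<psi>) = \<psi>) \<and> (\<forall>\<psi>. A (R \<psi>) - z *\<^sub>C R \<psi> = \<psi>)"
    using assms by (simp add: spectrum_def)
  from someI_ex[OF this] show "bounded_linear (resolvent_at A z)" "resolvent_at A z (A \<psi> - z *\<^sub>C \<psi>) = \<psi>"
    "A (resolvent_at A z \<psi>) - z *\<^sub>C resolvent_at A z \<psi> = \<psi>"
    by (simp_all add: resolvent_at_def)
qed

section \<open>Resolvent and Green function off the interval that encloses the spectrum\<close>

locale spectral_bound = bounded_potential +
  fixes K :: real
  assumes K: "4 \<le> K" and spectrum_H: "spectrum (schroedinger V) \<subseteq> complex_of_real ` {- K + 1..K - 1}"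
begin

text \<open>The complement of the enclosing interval rather than the resolvent set: openness is
  immediate and membership is read off from real and imaginary parts.\<close>

definition \<Omega> :: "complex set" where "\<Omega> = - (complex_of_real ` {- K + 1..K - 1})"

abbreviation R :: "complex \<Rightarrow> ell2 \<Rightarrow> ell2" where "R \<equiv> resolvent_at H"

lemma \<Omega>_iff: "z \<in> \<Omega> \<longleftrightarrow> Im z \<noteq> 0 \<or> Re z < - K + 1 \<or> Re z > K - 1"
  by (auto simp: \<Omega>_def image_iff complex_eq_iff not_le) 

lemma open_\<Omega>: "open \<Omega>"
  unfolding \<Omega>_def by (intro open_Compl compact_imp_closed compact_continuous_image continuous_intros) auto

lemma
  assumes "z \<in> \<Omega>"
  shows bounded_linear_R: "bounded_linear (R z)" and R_H: "R z (H \<psi> - z *\<^sub>C \<psi>) = \<psi>"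
    and H_R: "H (R z \<psi>) - z *\<^sub>C R z \<psi> = \<psi>"
  using resolvent_at[of z H] spectrum_H assms by (auto simp: \<Omega>_def)

lemma R_unique: "z \<in> \<Omega> \<Longrightarrow> H x - z *\<^sub>C x = \<psi> \<Longrightarrow> x = R z \<psi>"
  using R_H by auto

text \<open>The inverse supplied by \<open>spectrum\<close> is only assumed real-linear; complex
  linearity follows from uniqueness of solutions.\<close>

lemma R_linear:
  assumes "z \<in> \<Omega>"
  shows "R z (x + y) = R z x + R z y" "R z (x - y) = R z x - R z y" "R z (c *\<^sub>C x) = c *\<^sub>C R z x"
proof -
  have "H (R z x + R z y) - z *\<^sub>C (R z x + R z y) = (H (R z x) - z *\<^sub>C R z x) + (H (R z y) - z *\<^sub>C R z y)"
    by (simp add: H_linear cscale_simps)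
  then show "R z (x + y) = R z x + R z y"
    unfolding H_R[OF assms] by (rule sym[OF R_unique[OF assms]])
  have "H (R z x - R z y) - z *\<^sub>C (R z x - R z y) = (H (R z x) - z *\<^sub>C R z x) - (H (R z y) - z *\<^sub>C R z y)"
    by (simp add: H_linear cscale_simps)
  then show "R z (x - y) = R z x - R z y"
    unfolding H_R[OF assms] by (rule sym[OF R_unique[OF assms]])
  have "H (c *\<^sub>C R z x) - z *\<^sub>C c *\<^sub>C R z x = c *\<^sub>C (H (R z x) - z *\<^sub>C R z x)"
    by (simp add: H_linear cscale_simps mult.commute)
  then show "R z (c *\<^sub>C x) = c *\<^sub>C R z x"
    unfolding H_R[OF assms] by (rule sym[OF R_unique[OF assms]])
qed

lemma R_cnj: "z \<in> \<Omega> \<Longrightarrow> R (cnj z) (econj x) = econj (R z x)"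
proof -
  assume z: "z \<in> \<Omega>"
  have "econj (H (R z x) - z *\<^sub>C R z x) = econj x" using H_R[OF z] by simp
  moreover have "econj (H (R z x) - z *\<^sub>C R z x) = H (econj (R z x)) - cnj z *\<^sub>C econj (R z x)"
    by (rule ell2_eqI) (simp)
  ultimately show ?thesis
    using z by (intro sym[OF R_unique]) (auto simp: \<Omega>_iff)
qed

definition green :: "complex \<Rightarrow> int \<Rightarrow> int \<Rightarrow> complex" where
  "green z m n = coord (R z (delta n)) m"

lemma green_commute: "z \<in> \<Omega> \<Longrightarrow> green z m n = green z n m"
proof -
  assume z: "z \<in> \<Omega>"
  let ?x = "R z (delta n)" and ?y = "R z (delta m)"
  have "green z m n = bil (H ?y - z *\<^sub>C ?y) ?x"
    by (simp add: H_R[OF z] bil_delta green_def)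
  also have "\<dots> = bil (H ?x - z *\<^sub>C ?x) ?y"
    by (simp add: bil_linear bil_H bil_commute[of ?y])
  also have "\<dots> = green z n m"
    by (simp add: H_R[OF z] bil_delta green_def)
  finally show ?thesis .
qed

lemma green_cnj: "z \<in> \<Omega> \<Longrightarrow> green (cnj z) m n = cnj (green z m n)"
proof -
  assume z: "z \<in> \<Omega>"
  have "econj (delta n) = delta n" by (rule ell2_eqI) simp
  then show ?thesis using R_cnj[OF z, of "delta n"] by (simp add: green_def)
qed

lemma R_norm_bound: "z \<in> \<Omega> \<Longrightarrow> \<exists>b>0. \<forall>x. norm (R z x) \<le> b * norm x"
  using bounded_linear.pos_bounded[OF bounded_linear_R] by (auto simp: mult.commute)

text \<open>The first resolvent identity, the source of local boundedness and of holomorphy.\<close>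

lemma R_diff: "z \<in> \<Omega> \<Longrightarrow> w \<in> \<Omega> \<Longrightarrow> R w x - R z x = (w - z) *\<^sub>C R w (R z x)"
proof -
  assume z: "z \<in> \<Omega>" and w: "w \<in> \<Omega>"
  have "H (R z x) - w *\<^sub>C R z x = x - (w - z) *\<^sub>C R z x"
    using H_R[OF z, of x] by (simp add: cscale_simps algebra_simps)
  then have "R z x = R w (x - (w - z) *\<^sub>C R z x)"
    using R_H[OF w, of "R z x"] by simp
  then have "R z x = R w x - (w - z) *\<^sub>C R w (R z x)"
    by (simp only: R_linear[OF w])
  from eq_diff_eq[THEN iffD1, OF this] show ?thesis
    by (metis add_diff_cancel_left')
qed

text \<open>Within radius \<open>1 / (2 * b)\<close> the correction term of the resolvent identity
  is at most half of \<open>norm (R w x)\<close> and is absorbed on the left.\<close>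

lemma R_locally_bounded:
  assumes z: "z \<in> \<Omega>"
  shows "\<exists>r>0. \<exists>b>0. \<forall>w\<in>\<Omega> \<inter> ball z r. \<forall>x. norm (R w x) \<le> b * norm x"
proof -
  obtain b where b: "0 < b" "\<And>x. norm (R z x) \<le> b * norm x" using R_norm_bound[OF z] by auto
  have "norm (R w x) \<le> 2 * b * norm x" if w: "w \<in> \<Omega> \<inter> ball z (1 / (2 * b))" for w x
  proof -
    have "R w x = R z x + (w - z) *\<^sub>C R z (R w x)"
      using R_diff[of w z x] z w by (simp add: cscale_simps algebra_simps)
    then have "norm (R w x) \<le> norm (R z x) + cmod (w - z) * norm (R z (R w x))"
      by (metis norm_cscale norm_triangle_ineq)
    also have "\<dots> \<le> b * norm x + 1 / (2 * b) * (b * norm (R w x))"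
      using w b by (intro add_mono mult_mono) (auto simp: dist_norm norm_minus_commute)
    finally show ?thesis using b by simp
  qed
  then show ?thesis using b by (intro exI[of _ "1 / (2 * b)"] conjI exI[of _ "2 * b"]) auto
qed

text \<open>Meant for the vertical sides of the rectangle, which cross the real axis, where
  \<open>H_lower_bound\<close> degenerates.\<close>

lemma R_bounded_on_compact:
  assumes "compact C" "C \<subseteq> \<Omega>"
  shows "\<exists>b\<ge>1. \<forall>w\<in>C. \<forall>x. norm (R w x) \<le> b * norm x"
proof -
  have "\<forall>z. \<exists>p. z \<in> \<Omega> \<longrightarrow> 0 < fst p \<and> (\<forall>w\<in>\<Omega> \<inter> ball z (fst p). \<forall>x. norm (R w x) \<le> snd p * norm x)"
    using R_locally_bounded by (simp add: split_paired_Ex) blast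
  from choice[OF this] obtain p where p:
    "\<And>z. z \<in> \<Omega> \<Longrightarrow> 0 < fst (p z) \<and> (\<forall>w\<in>\<Omega> \<inter> ball z (fst (p z)). \<forall>x. norm (R w x) \<le> snd (p z) * norm x)"
    by blast
  define r where "r z = fst (p z)" for z
  define b where "b z = snd (p z)" for z
  have rb: "0 < r z" "w \<in> \<Omega> \<inter> ball z (r z) \<Longrightarrow> norm (R w x) \<le> b z * norm x" if "z \<in> \<Omega>" for z w x
    using p[OF that] by (auto simp: r_def b_def)
  have "C \<subseteq> (\<Union>z\<in>C. ball z (r z))"
    using rb(1) assms(2) by force
  then obtain D where D: "D \<subseteq> C" "finite D" "C \<subseteq> (\<Union>z\<in>D. ball z (r z))"
    using compactE_image[OF assms(1), of C "\<lambda>z. ball z (r z)"] by (metis open_ball)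
  define b' where "b' = (\<Sum>z\<in>D. \<bar>b z\<bar>) + 1"
  have "norm (R w x) \<le> b' * norm x" if "w \<in> C" for w x
  proof -
    obtain z where z: "z \<in> D" "w \<in> ball z (r z)" using D \<open>w \<in> C\<close> by blast
    then have "norm (R w x) \<le> b z * norm x"
      using rb(2)[of z w x] that D assms by auto
    also have "\<dots> \<le> b' * norm x"
    proof (rule mult_right_mono)
      have "\<bar>b z\<bar> \<le> (\<Sum>z\<in>D. \<bar>b z\<bar>)" using z D by (intro member_le_sum) auto
      then show "b z \<le> b'" by (simp add: b'_def)
    qed simp
    finally show ?thesis .
  qed
  moreover have "1 \<le> b'" by (simp add: b'_def sum_nonneg)
  ultimately show ?thesis by auto
qed

text \<open>By the resolvent identity the difference quotient is a matrix element of
  \<open>R w\<close> applied to \<open>R z (delta n)\<close>, and this is continuous in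
  \<open>w\<close>.\<close>

lemma green_holomorphic: "(\<lambda>z. green z m n) holomorphic_on \<Omega>"
proof (rule holomorphic_onI)
  fix z assume z: "z \<in> \<Omega>"
  let ?x = "delta n"
  obtain r b where r: "0 < r" "0 < b" "\<And>w x. w \<in> \<Omega> \<inter> ball z r \<Longrightarrow> norm (R w x) \<le> b * norm x"
    using R_locally_bounded[OF z] by blast
  have cont: "((\<lambda>w. coord (R w (R z ?x)) m) \<longlongrightarrow> coord (R z (R z ?x)) m) (at z within \<Omega>)"
  proof (rule Lim_null[THEN iffD2], rule Lim_null_comparison)
    have "\<forall>\<^sub>F w in at z within \<Omega>. w \<in> \<Omega> \<inter> ball z r"
      using r(1) unfolding eventually_at_topological by (intro exI[of _ "ball z r"]) auto
    then show "\<forall>\<^sub>F w in at z within \<Omega>. norm (coord (R w (R z ?x)) m - coord (R z (R z ?x)) m)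
        \<le> cmod (w - z) * (b * norm (R z (R z ?x)))"
    proof eventually_elim
      case (elim w)
      have "norm (coord (R w (R z ?x)) m - coord (R z (R z ?x)) m) \<le> norm (R w (R z ?x) - R z (R z ?x))"
        using coord_le_norm[of "R w (R z ?x) - R z (R z ?x)" m] by simp
      also have "\<dots> \<le> cmod (w - z) * (b * norm (R z (R z ?x)))"
        using elim z r by (subst R_diff) (auto simp: norm_cscale intro!: mult_left_mono)
      finally show ?case .
    qed
    show "((\<lambda>w. cmod (w - z) * (b * norm (R z (R z ?x)))) \<longlongrightarrow> 0) (at z within \<Omega>)"
      by (rule tendsto_eq_intros refl | simp)+
  qed
  have "((\<lambda>w. green w m n) has_field_derivative coord (R z (R z ?x)) m) (at z within \<Omega>)"
    unfolding has_field_derivative_iff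
  proof (rule Lim_transform_within[OF cont zero_less_one])
    fix w assume w: "w \<in> \<Omega>" "0 < dist w z"
    have "green w m n - green z m n = (w - z) * coord (R w (R z ?x)) m"
      using R_diff[OF z w(1), of ?x] unfolding green_def
      by (metis coord_simps(4,6))
    then show "coord (R w (R z ?x)) m = (green w m n - green z m n) / (w - z)"
      using w by simp
  qed
  then show "(\<lambda>z. green z m n) field_differentiable at z within \<Omega>"
    by (auto simp: field_differentiable_def)
qed

end

section \<open>The evolution as a contour integral\<close>

lemma contour_integral_horizontal:
  assumes "a < b" "continuous_on (closed_segment (Complex a c) (Complex b c)) f"
  shows "contour_integral (linepath (Complex a c) (Complex b c)) f = integral {a..b} (\<lambda>x. f (Complex x c))"
proof -
  let ?g = "\<lambda>z. f (z + Complex 0 c)"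
  have l: "linepath (Complex a c) (Complex b c) x = linepath (complex_of_real a) (complex_of_real b) x + Complex 0 c" for x
    by (simp add: linepath_def complex_eq_iff algebra_simps)
  have d: "Complex b c - Complex a c = complex_of_real b - complex_of_real a"
    by (simp add: complex_eq_iff)
  have "(f has_contour_integral contour_integral (linepath (Complex a c) (Complex b c)) f) (linepath (Complex a c) (Complex b c))"
    by (intro has_contour_integral_integral contour_integrable_continuous_linepath assms)
  then have "(?g has_contour_integral contour_integral (linepath (Complex a c) (Complex b c)) f) (linepath (complex_of_real a) (complex_of_real b))"
    unfolding has_contour_integral_linepath l d .
  then have "((\<lambda>x. ?g (of_real x)) has_integral contour_integral (linepath (Complex a c) (Complex b c)) f) {a..b}"
    using has_contour_integral_linepath_Reals_iff[of "complex_of_real a" "complex_of_real b" ?g] assms(1) by simp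
  moreover have "?g (of_real x) = f (Complex x c)" for x
    by (rule arg_cong[where f = f]) (simp add: complex_eq_iff)
  ultimately show ?thesis by (simp add: integral_unique)
qed

lemma contour_integral_rectpath_split:
  fixes a b :: complex
  assumes "Re a \<le> Re b" "Im a \<le> Im b" "continuous_on (path_image (rectpath a b)) f"
  defines "a2 \<equiv> Complex (Re b) (Im a)" and "a4 \<equiv> Complex (Re a) (Im b)"
  shows "contour_integral (rectpath a b) f = contour_integral (linepath a a2) f +
    contour_integral (linepath a2 b) f - contour_integral (linepath a4 b) f - contour_integral (linepath a a4) f"
    and "closed_segment a a2 \<subseteq> path_image (rectpath a b)" "closed_segment a2 b \<subseteq> path_image (rectpath a b)"
    "closed_segment a4 b \<subseteq> path_image (rectpath a b)" "closed_segment a a4 \<subseteq> path_image (rectpath a b)"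
proof -
  have "path_image (rectpath a b) = closed_segment a a2 \<union> closed_segment a2 b \<union> closed_segment a4 b \<union> closed_segment a a4"
    by (simp add: rectpath_def Let_def path_image_join closed_segment_commute a2_def a4_def Un_assoc)
  then show *: "closed_segment a a2 \<subseteq> path_image (rectpath a b)" "closed_segment a2 b \<subseteq> path_image (rectpath a b)"
    "closed_segment a4 b \<subseteq> path_image (rectpath a b)" "closed_segment a a4 \<subseteq> path_image (rectpath a b)"
    by auto
  have ci: "f contour_integrable_on linepath a a2" "f contour_integrable_on linepath a2 b"
    "f contour_integrable_on linepath b a4" "f contour_integrable_on linepath a4 a"
    using * by (auto intro!: contour_integrable_continuous_linepath continuous_on_subset[OF assms(3)]
        simp: closed_segment_commute)
  have "contour_integral (rectpath a b) f = contour_integral (linepath a a2) f +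
    (contour_integral (linepath a2 b) f + (contour_integral (linepath b a4) f + contour_integral (linepath a4 a) f))"
    unfolding rectpath_def Let_def a2_def[symmetric] a4_def[symmetric] using ci by simp
  then show "contour_integral (rectpath a b) f = contour_integral (linepath a a2) f +
    contour_integral (linepath a2 b) f - contour_integral (linepath a4 b) f - contour_integral (linepath a a4) f"
    using contour_integral_reverse_linepath[of a4 b f] contour_integral_reverse_linepath[of a a4 f]
      *[THEN continuous_on_subset[OF assms(3)]] by simp
qed

lemma contour_integral_rectpath_bound:
  assumes "Re a \<le> Re b" "Im a \<le> Im b" "continuous_on (path_image (rectpath a b)) f"
    and "\<And>z. z \<in> path_image (rectpath a b) \<Longrightarrow> cmod (f z) \<le> c"
  shows "cmod (contour_integral (rectpath a b) f) \<le> 2 * c * (Re b - Re a + (Im b - Im a))"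
proof -
  note s = contour_integral_rectpath_split[OF assms(1-3)]
  have c: "0 \<le> c"
    using assms(4)[of a] pathstart_in_path_image[of "rectpath a b"] by (auto intro: order_trans[OF norm_ge_zero])
  have *: "cmod (contour_integral (linepath x y) f) \<le> c * cmod (y - x)"
    if "closed_segment x y \<subseteq> path_image (rectpath a b)" for x y
    using that c assms(4)
    by (intro contour_integral_bound_linepath contour_integrable_continuous_linepath continuous_on_subset[OF assms(3)]) auto
  have l: "cmod (Complex (Re b) (Im a) - a) = Re b - Re a" "cmod (b - Complex (Re b) (Im a)) = Im b - Im a"
    "cmod (b - Complex (Re a) (Im b)) = Re b - Re a" "cmod (Complex (Re a) (Im b) - a) = Im b - Im a"
    using assms(1,2) by (simp_all add: cmod_def)
  have t: "cmod (p + q - r - w) \<le> cmod p + cmod q + cmod r + cmod w" for p q r w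
    using norm_triangle_ineq4[of "p + q - r" w] norm_triangle_ineq4[of "p + q" r] norm_triangle_ineq[of p q]
    by linarith
  have "cmod (contour_integral (rectpath a b) f) \<le> c * (Re b - Re a) + c * (Im b - Im a) + c * (Re b - Re a) + c * (Im b - Im a)"
    unfolding s(1)
    using *[OF s(2)] *[OF s(3)] *[OF s(4)] *[OF s(5)] unfolding l
    by (intro order_trans[OF t] add_mono)
  then show ?thesis by (simp add: algebra_simps)
qed

text \<open>It gives concentric rectangles the same parametrisation, so that the straight homotopy
  between them can be written down pointwise.\<close>

lemma rectpath_linear_image:
  assumes "\<And>z. A z = Complex (p * Re z) (q * Im z)"
  shows "rectpath (A a) (A b) = A \<circ> rectpath a b"
proof -
  have l: "linepath (A x) (A y) = A \<circ> linepath x y" for x y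
    by (rule ext) (simp add: assms linepath_def complex_eq_iff algebra_simps)
  have "Complex (Re (A b)) (Im (A a)) = A (Complex (Re b) (Im a))"
    "Complex (Re (A a)) (Im (A b)) = A (Complex (Re a) (Im b))"
    by (simp_all add: assms)
  then show ?thesis by (simp only: rectpath_def Let_def l path_compose_join)
qed

text \<open>The residue at 0 is the Taylor coefficient of order \<open>k\<close> of exp(c
  z).\<close>

lemma contour_integral_exp_over_power:
  assumes "0 < L"
  shows "contour_integral (rectpath (Complex (- L) (- L)) (Complex L L)) (\<lambda>z. exp (c * z) / z ^ Suc k) =
    2 * pi * \<i> * (c ^ k / fact k)"
proof -
  let ?g = "rectpath (Complex (- L) (- L)) (Complex L L)"
  have "(deriv ^^ k) (\<lambda>z. exp (c * z)) 0 = c ^ k * (deriv ^^ k) exp (c * 0)"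
    by (rule higher_deriv_compose_linear[where S = UNIV and T = UNIV]) (auto intro: holomorphic_intros)
  moreover have "deriv exp = (exp :: complex \<Rightarrow> complex)"
    by (rule ext) (rule DERIV_imp_deriv[OF DERIV_exp])
  then have "(deriv ^^ k) exp = (exp :: complex \<Rightarrow> complex)"
    by (induction k) simp_all
  ultimately have d: "(deriv ^^ k) (\<lambda>z. exp (c * z)) 0 = c ^ k"
    by simp
  have "contour_integral ?g (\<lambda>z. exp (c * z) / z ^ Suc k) =
      2 * pi * \<i> * (\<Sum>p\<in>{0}. winding_number ?g p * residue (\<lambda>z. exp (c * z) / z ^ Suc k) p)"
    by (rule Residue_theorem[where S = UNIV])
      (use assms in \<open>auto intro!: holomorphic_intros simp: path_image_rectpath\<close>)
  also have "\<dots> = 2 * pi * \<i> * (c ^ k / fact k)"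
    using assms residue_holomorphic_over_power'[of UNIV "\<lambda>z. exp (c * z)" k]
    by (simp add: winding_number_rectpath in_box_complex_iff d holomorphic_intros)
  finally show ?thesis .
qed

context bounded_potential
begin

lemma H_pow_bound:
  assumes "\<And>x. norm (H x) \<le> M * norm x" "0 \<le> M"
  shows "norm ((H ^^ k) x) \<le> M ^ k * norm x"
proof (induction k)
  case (Suc k)
  have "norm ((H ^^ Suc k) x) \<le> M * norm ((H ^^ k) x)" using assms(1) by simp
  also have "\<dots> \<le> M * (M ^ k * norm x)" using Suc assms(2) by (rule mult_left_mono)
  finally show ?case by simp
qed simp

lemma evolution_sums:
  "(\<lambda>k. ((- \<i> * complex_of_real t) ^ k / fact k) *\<^sub>C (H ^^ k) \<psi>) sums evolution H t \<psi>"
proof -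
  obtain M where M: "1 \<le> M" "\<And>x. norm (H x) \<le> M * norm x" using H_bounded by blast
  have "summable (\<lambda>k. ((- \<i> * complex_of_real t) ^ k / fact k) *\<^sub>C (H ^^ k) \<psi>)"
  proof (rule summable_comparison_test')
    show "summable (\<lambda>k. inverse (fact k) * (\<bar>t\<bar> * M) ^ k * norm \<psi>)"
      by (intro summable_mult2 summable_exp)
    fix k
    have "norm (((- \<i> * complex_of_real t) ^ k / fact k) *\<^sub>C (H ^^ k) \<psi>) =
        inverse (fact k) * \<bar>t\<bar> ^ k * norm ((H ^^ k) \<psi>)"
      by (simp add: norm_cscale norm_divide norm_power norm_mult field_simps)
    also have "\<dots> \<le> inverse (fact k) * \<bar>t\<bar> ^ k * (M ^ k * norm \<psi>)"
      using M by (intro mult_left_mono H_pow_bound) auto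
    finally show "norm (((- \<i> * complex_of_real t) ^ k / fact k) *\<^sub>C (H ^^ k) \<psi>) \<le>
        inverse (fact k) * (\<bar>t\<bar> * M) ^ k * norm \<psi>"
      by (simp add: power_mult_distrib mult_ac)
  qed
  then show ?thesis unfolding evolution_def by (rule summable_sums)
qed

end

context spectral_bound
begin

text \<open>The Neumann expansion with its exact remainder, by iterating R(z) = (R(z) H - 1) /
  z.\<close>

lemma R_Neumann:
  assumes "z \<in> \<Omega>" "z \<noteq> 0"
  shows "coord (R z x) n = coord (R z ((H ^^ m) x)) n / z ^ m - (\<Sum>k<m. coord ((H ^^ k) x) n / z ^ Suc k)"
proof (induction m)
  case (Suc m)
  let ?y = "(H ^^ m) x"
  have "R z (H ?y - z *\<^sub>C ?y) = ?y" by (rule R_H[OF assms(1)])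
  then have "R z (H ?y) - z *\<^sub>C R z ?y = ?y" by (simp add: R_linear[OF assms(1)])
  then have "coord (R z (H ?y)) n - z * coord (R z ?y) n = coord ?y n"
    by (metis coord_simps(4,6))
  then have "coord (R z ?y) n / z ^ m = coord (R z (H ?y)) n / z ^ Suc m - coord ?y n / z ^ Suc m"
    using assms(2) by (simp add: field_simps)
  with Suc show ?case by simp
qed simp

text \<open>Far out the Neumann expansion can be integrated term by term and reproduces the
  exponential series. The minus sign is that of (H - z)^(-1), which behaves like - 1 / z.\<close>

lemma coord_evolution_big_rectangle:
  shows "\<exists>L>K. contour_integral (rectpath (Complex (- L) (- L)) (Complex L L)) (\<lambda>z. exp (- \<i> * complex_of_real t * z) * green z n 1)
    = - (2 * pi * \<i>) * coord (evolution H t (delta 1)) n"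
proof -
  obtain M where M: "1 \<le> M" "\<And>x. norm (H x) \<le> M * norm x" using H_bounded by blast
  \<comment> \<open>\<open>K + 1\<close> keeps the contour away from the spectrum, and
    \<open>2 * M\<close> makes the remainder after \<open>m\<close> terms of order 2^(-m). The
    factor \<open>8 * L\<close> further down is the perimeter.\<close>
  define L where "L = max (K + 1) (2 * M)"
  have L: "K < L" "2 * M \<le> L" "0 < L" using K by (auto simp: L_def)
  define c where "c = - \<i> * complex_of_real t"
  define h where "h k = coord ((H ^^ k) (delta 1)) n" for k
  let ?g = "rectpath (Complex (- L) (- L)) (Complex L L)"
  let ?I = "contour_integral ?g (\<lambda>z. exp (c * z) * green z n 1)"
  have img: "z \<in> path_image ?g \<Longrightarrow> (\<bar>Re z\<bar> = L \<or> \<bar>Im z\<bar> = L) \<and> \<bar>Re z\<bar> \<le> L \<and> \<bar>Im z\<bar> \<le> L" for z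
    using L by (auto simp: path_image_rectpath)
  have img': "z \<in> \<Omega>" "z \<noteq> 0" "2 * M \<le> cmod z" if "z \<in> path_image ?g" for z
    using img[OF that] L K abs_Re_le_cmod[of z] abs_Im_le_cmod[of z] by (auto simp: \<Omega>_iff)
  have exp_le: "cmod (exp (c * z)) \<le> exp (\<bar>t\<bar> * L)" if "z \<in> path_image ?g" for z
  proof -
    have "Re (c * z) \<le> \<bar>t\<bar> * \<bar>Im z\<bar>" by (simp add: c_def flip: abs_mult)
    also have "\<dots> \<le> \<bar>t\<bar> * L" using img[OF that] by (intro mult_left_mono) auto
    finally show ?thesis by simp
  qed
  have hol: "(\<lambda>z. exp (c * z) * green z n 1) holomorphic_on \<Omega>"
    by (intro holomorphic_intros green_holomorphic)
  have ci1: "(\<lambda>z. exp (c * z) * green z n 1) contour_integrable_on ?g"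
    using img' by (intro contour_integrable_holomorphic_simple[OF hol open_\<Omega>]) auto
  have ci2: "(\<lambda>z. exp (c * z) / z ^ Suc k) contour_integrable_on ?g" for k
    using img' by (intro contour_integrable_holomorphic_simple[of _ "- {0}"] holomorphic_intros) auto
  have rem: "cmod (?I + 2 * pi * \<i> * (\<Sum>k<m. c ^ k / fact k * h k)) \<le> (8 * L * exp (\<bar>t\<bar> * L) / M) * (1 / 2) ^ m" for m
  proof -
    define r where "r z = exp (c * z) * green z n 1 + (\<Sum>k<m. h k * (exp (c * z) / z ^ Suc k))" for z
    have "((\<lambda>z. exp (c * z) * green z n 1 + (\<Sum>k<m. h k * (exp (c * z) / z ^ Suc k))) has_contour_integral
        (?I + (\<Sum>k<m. h k * contour_integral ?g (\<lambda>z. exp (c * z) / z ^ Suc k)))) ?g"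
      by (intro has_contour_integral_add has_contour_integral_sum has_contour_integral_lmul has_contour_integral_integral ci1 ci2 finite_lessThan)
    then have "contour_integral ?g r = ?I + (\<Sum>k<m. h k * contour_integral ?g (\<lambda>z. exp (c * z) / z ^ Suc k))"
      unfolding r_def by (rule contour_integral_unique)
    also have "\<dots> = ?I + 2 * pi * \<i> * (\<Sum>k<m. c ^ k / fact k * h k)"
      unfolding contour_integral_exp_over_power[OF L(3)] sum_distrib_left by (simp add: mult_ac)
    finally have eq: "contour_integral ?g r = ?I + 2 * pi * \<i> * (\<Sum>k<m. c ^ k / fact k * h k)" .
    have r_eq: "r z = exp (c * z) * (coord (R z ((H ^^ m) (delta 1))) n / z ^ m)" if "z \<in> path_image ?g" for z
    proof -
      have "r z = exp (c * z) * (green z n 1 + (\<Sum>k<m. h k / z ^ Suc k))"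
        by (simp add: r_def sum_distrib_left distrib_left mult_ac)
      then show ?thesis
        using R_Neumann[OF img'(1,2)[OF that], of "delta 1" n m] by (simp add: green_def h_def)
    qed
    have "cmod (contour_integral ?g r) \<le> 2 * (exp (\<bar>t\<bar> * L) / M * (1 / 2) ^ m) *
        (Re (Complex L L) - Re (Complex (- L) (- L)) + (Im (Complex L L) - Im (Complex (- L) (- L))))"
    proof (rule contour_integral_rectpath_bound)
      show "continuous_on (path_image ?g) r"
        unfolding r_def using img'
        by (intro continuous_intros continuous_on_subset[OF holomorphic_on_imp_continuous_on[OF green_holomorphic]]) auto
      fix z assume z: "z \<in> path_image ?g"
      let ?y = "R z ((H ^^ m) (delta 1))"
      have "M * norm ?y \<le> (cmod z - M) * norm ?y" using img'(3)[OF z] by (intro mult_right_mono) auto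
      also have "\<dots> \<le> norm (z *\<^sub>C ?y) - norm (H ?y)"
        using M(2)[of ?y] by (simp add: norm_cscale algebra_simps)
      also have "\<dots> \<le> norm (H ?y - z *\<^sub>C ?y)"
        by (metis norm_minus_commute norm_triangle_ineq2)
      also have "\<dots> \<le> M ^ m"
        using H_pow_bound[OF M(2), of m "delta 1"] M(1) H_R[OF img'(1)[OF z]] by simp
      finally have y: "norm ?y \<le> M ^ m / M" using M(1) by (simp add: field_simps)
      have zp: "(2 * M) ^ m \<le> cmod z ^ m" using img'(3)[OF z] M(1) by (intro power_mono) auto
      have "cmod (r z) = cmod (exp (c * z)) * (cmod (coord ?y n) / cmod z ^ m)"
        by (simp add: r_eq[OF z] norm_mult norm_divide norm_power)
      also have "\<dots> \<le> exp (\<bar>t\<bar> * L) * ((M ^ m / M) / (2 * M) ^ m)"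
        using y zp M(1) order_trans[OF coord_le_norm y]
        by (intro mult_mono exp_le[OF z] frac_le) auto
      also have "\<dots> = exp (\<bar>t\<bar> * L) / M * (1 / 2) ^ m"
        using M(1) by (simp add: power_mult_distrib field_simps)
      finally show "cmod (r z) \<le> exp (\<bar>t\<bar> * L) / M * (1 / 2) ^ m" .
    qed (use L in auto)
    then show ?thesis unfolding eq by (simp add: mult_ac)
  qed
  have "(\<lambda>k. c ^ k / fact k * h k) sums coord (evolution H t (delta 1)) n"
    using bounded_linear.sums[OF bounded_linear_coord evolution_sums[of t "delta 1"], of n]
    by (simp add: h_def c_def)
  then have "(\<lambda>m. ?I + 2 * pi * \<i> * (\<Sum>k<m. c ^ k / fact k * h k)) \<longlonglongrightarrow> ?I + 2 * pi * \<i> * coord (evolution H t (delta 1)) n"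
    unfolding sums_def by (intro tendsto_intros)
  moreover have "(\<lambda>m. ?I + 2 * pi * \<i> * (\<Sum>k<m. c ^ k / fact k * h k)) \<longlonglongrightarrow> 0"
  proof (rule Lim_null_comparison[OF always_eventually])
    show "\<forall>m. norm (?I + 2 * pi * \<i> * (\<Sum>k<m. c ^ k / fact k * h k)) \<le> (8 * L * exp (\<bar>t\<bar> * L) / M) * (1 / 2) ^ m"
      using rem by blast
    show "(\<lambda>m. (8 * L * exp (\<bar>t\<bar> * L) / M) * (1 / 2) ^ m) \<longlonglongrightarrow> 0"
      by (intro tendsto_mult_right_zero LIMSEQ_power_zero) simp
  qed
  ultimately have "?I + 2 * pi * \<i> * coord (evolution H t (delta 1)) n = 0"
    by (rule LIMSEQ_unique)
  then have "?I = - (2 * pi * \<i>) * coord (evolution H t (delta 1)) n"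
    by (simp add: add_eq_0_iff2)
  then show ?thesis using L(1) by (intro exI[of _ L]) (simp add: c_def)
qed

text \<open>The linear map \<open>A\<close> below carries the thin rectangle to the large one, and the straight homotopy
  between them moves every point away from both axes, hence never meets the spectrum.\<close>

lemma coord_evolution_contour:
  assumes \<epsilon>: "0 < \<epsilon>" "\<epsilon> \<le> 1"
  shows "contour_integral (rectpath (Complex (- K) (- \<epsilon>)) (Complex K \<epsilon>)) (\<lambda>z. exp (- \<i> * complex_of_real t * z) * green z n 1)
    = - (2 * pi * \<i>) * coord (evolution H t (delta 1)) n"
proof -
  obtain L where L: "L > K" "contour_integral (rectpath (Complex (- L) (- L)) (Complex L L)) (\<lambda>z. exp (- \<i> * complex_of_real t * z) * green z n 1)
    = - (2 * pi * \<i>) * coord (evolution H t (delta 1)) n"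
    using coord_evolution_big_rectangle by blast
  define A where "A z = Complex (L / K * Re z) (L / \<epsilon> * Im z)" for z
  have A: "rectpath (Complex (- L) (- L)) (Complex L L) = A \<circ> rectpath (Complex (- K) (- \<epsilon>)) (Complex K \<epsilon>)"
    using rectpath_linear_image[of A "L / K" "L / \<epsilon>" "Complex (- K) (- \<epsilon>)" "Complex K \<epsilon>"] K \<epsilon>
    by (simp add: A_def)
  have "homotopic_loops \<Omega> (rectpath (Complex (- K) (- \<epsilon>)) (Complex K \<epsilon>)) (rectpath (Complex (- L) (- L)) (Complex L L))"
  proof (rule homotopic_loops_linear)
    fix s :: real assume s: "s \<in> {0..1}"
    define z where "z = rectpath (Complex (- K) (- \<epsilon>)) (Complex K \<epsilon>) s"
    have "z \<in> path_image (rectpath (Complex (- K) (- \<epsilon>)) (Complex K \<epsilon>))"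
      using s by (auto simp: z_def path_image_def)
    then have z: "Re z = K \<or> Re z = - K \<or> Im z = \<epsilon> \<or> Im z = - \<epsilon>"
      using K \<epsilon> by (auto simp: path_image_rectpath)
    show "closed_segment (rectpath (Complex (- K) (- \<epsilon>)) (Complex K \<epsilon>) s) (rectpath (Complex (- L) (- L)) (Complex L L) s) \<subseteq> \<Omega>"
    proof
      fix w assume "w \<in> closed_segment (rectpath (Complex (- K) (- \<epsilon>)) (Complex K \<epsilon>) s) (rectpath (Complex (- L) (- L)) (Complex L L) s)"
      then obtain u where u: "0 \<le> u" "u \<le> 1" "w = (1 - u) *\<^sub>R z + u *\<^sub>R A z"
        unfolding A by (auto simp: closed_segment_def z_def)
      define p where "p = 1 + u * (L / K - 1)"
      define q where "q = 1 + u * (L / \<epsilon> - 1)"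
      have p: "1 \<le> p" "1 \<le> q"
        unfolding p_def q_def using u(1) L(1) K \<epsilon> by (simp_all add: field_simps mult_right_mono)
      have w: "Re w = p * Re z" "Im w = q * Im z"
        by (simp_all add: u(3) A_def p_def q_def algebra_simps)
      have "K \<le> p * K" "0 < q * \<epsilon>" using p K \<epsilon> by auto
      moreover have "Re w = p * K \<or> Re w = - (p * K) \<or> Im w = q * \<epsilon> \<or> Im w = - (q * \<epsilon>)"
        using z by (auto simp: w)
      ultimately have "Re w > K - 1 \<or> Re w < - K + 1 \<or> Im w > 0 \<or> Im w < 0"
        by linarith
      then show "w \<in> \<Omega>"
        unfolding \<Omega>_iff by auto
    qed
  qed auto
  from Cauchy_theorem_homotopic_loops[OF this open_\<Omega>, of "\<lambda>z. exp (- \<i> * complex_of_real t * z) * green z n 1"] L(2)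
  show ?thesis by (simp add: holomorphic_intros green_holomorphic)
qed

end

section \<open>Time averages\<close>

text \<open>Cauchy-Schwarz against the constant 1, obtained from nonnegativity of the variance about
  the mean \<open>m\<close>.\<close>

lemma integral_square_le:
  fixes g :: "real \<Rightarrow> real"
  assumes "a < b" "continuous_on {a..b} g"
  shows "(integral {a..b} g)\<^sup>2 \<le> (b - a) * integral {a..b} (\<lambda>x. (g x)\<^sup>2)"
proof -
  define m where "m = integral {a..b} g / (b - a)"
  have int: "g integrable_on {a..b}" "(\<lambda>x. (g x)\<^sup>2) integrable_on {a..b}"
    using assms by (auto intro!: integrable_continuous_real continuous_intros)
  have "0 \<le> integral {a..b} (\<lambda>x. (g x - m)\<^sup>2)"
    by (rule integral_nonneg) (auto intro!: integrable_continuous_real continuous_intros assms)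
  also have "(\<lambda>x. (g x - m)\<^sup>2) = (\<lambda>x. (g x)\<^sup>2 - 2 * m * g x + m\<^sup>2)"
    by (simp add: power2_eq_square algebra_simps)
  also have "integral {a..b} (\<lambda>x. (g x)\<^sup>2 - 2 * m * g x + m\<^sup>2) =
      integral {a..b} (\<lambda>x. (g x)\<^sup>2) - 2 * m * integral {a..b} g + m\<^sup>2 * (b - a)"
    using has_integral_add[OF has_integral_diff[OF integrable_integral[OF int(2)]
        has_integral_mult_right[OF integrable_integral[OF int(1)], of "2 * m"]] has_integral_const_real[of "m\<^sup>2" a b]] assms(1)
    by (simp add: integral_unique mult_ac)
  finally have "0 \<le> integral {a..b} (\<lambda>x. (g x)\<^sup>2) - 2 * m * integral {a..b} g + m\<^sup>2 * (b - a)" .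
  moreover have m: "m * (b - a) = integral {a..b} g"
    using assms(1) by (simp add: m_def)
  then have "m\<^sup>2 * (b - a) = m * integral {a..b} g"
    by (simp add: power2_eq_square mult.assoc)
  ultimately have "m * integral {a..b} g \<le> integral {a..b} (\<lambda>x. (g x)\<^sup>2)"
    by simp
  then have "(b - a) * (m * integral {a..b} g) \<le> (b - a) * integral {a..b} (\<lambda>x. (g x)\<^sup>2)"
    using assms(1) by (intro mult_left_mono) auto
  then show ?thesis
    using m by (metis mult.assoc mult.commute power2_eq_square)
qed

lemma has_bochner_integral_exp_minus:
  fixes a :: real
  assumes "0 < a"
  shows "has_bochner_integral lborel (\<lambda>t. indicator {0..} t *\<^sub>R exp (- (a * t))) (1 / a)"
proof (rule has_bochner_integral_nn_integral)
  have "(\<integral>\<^sup>+t. ennreal (exp (- (a * t))) * indicator {0..} t \<partial>lborel) = ennreal (0 - (- exp (- (a * 0)) / a))"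
  proof (rule nn_integral_FTC_atLeast)
    show "((\<lambda>t. - exp (- (a * t)) / a) has_real_derivative exp (- (a * t))) (at t)" for t
      by (auto intro!: derivative_eq_intros simp: assms[THEN less_imp_neq, symmetric])
    have "((\<lambda>t. exp (- (a * t))) \<longlongrightarrow> 0) at_top"
      by (rule filterlim_compose[OF exp_at_bot], simp add: filterlim_uminus_at_top[symmetric],
          rule filterlim_tendsto_pos_mult_at_top[OF tendsto_const assms filterlim_ident])
    then have "((\<lambda>t. - exp (- (a * t)) / a) \<longlongrightarrow> - 0 / a) at_top"
      by (intro tendsto_intros) (use assms in auto)
    then show "((\<lambda>t. - exp (- (a * t)) / a) \<longlongrightarrow> 0) at_top" by simp
  qed auto
  moreover have "(\<lambda>t. ennreal (indicator {0..} t *\<^sub>R exp (- (a * t)))) = (\<lambda>t. ennreal (exp (- (a * t))) * indicator {0..} t)"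
    by (auto simp: indicator_def)
  ultimately show "(\<integral>\<^sup>+t. ennreal (indicator {0..} t *\<^sub>R exp (- (a * t))) \<partial>lborel) = ennreal (1 / a)"
    by simp
qed (use assms in auto)

text \<open>No measurability of the \<open>f i\<close> is required: a non-integrable summand has integral \<open>0\<close>.\<close>

lemma sum_integral_le:
  fixes f :: "'i \<Rightarrow> 'a \<Rightarrow> real"
  assumes "finite F" "integrable M g" "\<And>i x. i \<in> F \<Longrightarrow> 0 \<le> f i x"
    and "\<And>x. (\<Sum>i\<in>F. f i x) \<le> g x"
  shows "(\<Sum>i\<in>F. integral\<^sup>L M (f i)) \<le> integral\<^sup>L M g"
proof -
  let ?F = "{i \<in> F. integrable M (f i)}"
  have "(\<Sum>i\<in>F. integral\<^sup>L M (f i)) = (\<Sum>i\<in>?F. integral\<^sup>L M (f i))"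
    using assms(1) by (intro sum.mono_neutral_right) (auto simp: not_integrable_integral_eq)
  also have "\<dots> = integral\<^sup>L M (\<lambda>x. \<Sum>i\<in>?F. f i x)"
    by (rule Bochner_Integration.integral_sum[symmetric]) simp
  also have "\<dots> \<le> integral\<^sup>L M g"
  proof (rule integral_mono')
    fix x
    have "(\<Sum>i\<in>?F. f i x) \<le> (\<Sum>i\<in>F. f i x)"
      using assms(1,3) by (intro sum_mono2) auto
    then show le: "(\<Sum>i\<in>?F. f i x) \<le> g x" using assms(4)[of x] by linarith
    show "0 \<le> g x" using le assms(3) by (intro order_trans[OF sum_nonneg le]) auto
  qed fact
  finally show ?thesis .
qed

context bounded_potential
begin

text \<open>The partial sums \<open>p\<close> of the exponential series satisfy \<open>p'\<^sub>m\<^sub>+\<^sub>1 = - i H p\<^sub>m\<close>, so their norms are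
  conserved up to an error \<open>E m\<close> that tends to \<open>0\<close>.\<close>

lemma norm_evolution_le:
  assumes t: "0 \<le> t"
  shows "norm (evolution H t \<psi>) \<le> norm \<psi>"
proof -
  obtain M where M: "1 \<le> M" "\<And>x. norm (H x) \<le> M * norm x" using H_bounded by blast
  define c where "c k = ((- \<i>) ^ k / fact k) *\<^sub>C (H ^^ k) \<psi>" for k
  define p where "p m s = (\<Sum>k<m. s ^ k *\<^sub>R c k)" for m and s :: real
  have norm_c: "norm (c k) \<le> M ^ k / fact k * norm \<psi>" for k
  proof -
    have "norm (c k) = norm ((H ^^ k) \<psi>) / fact k"
      by (simp add: c_def norm_cscale norm_divide norm_power)
    also have "\<dots> \<le> (M ^ k * norm \<psi>) / fact k"
      using M by (intro divide_right_mono H_pow_bound) auto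
    finally show ?thesis by simp
  qed
  have norm_p: "norm (p m s) \<le> exp (M * t) * norm \<psi>" if "0 \<le> s" "s \<le> t" for m s
  proof -
    have "norm (s ^ k *\<^sub>R c k) \<le> s ^ k * (M ^ k / fact k * norm \<psi>)" for k
      unfolding norm_scaleR using that by (intro mult_mono norm_c) auto
    then have "norm (p m s) \<le> (\<Sum>k<m. s ^ k * (M ^ k / fact k * norm \<psi>))"
      unfolding p_def by (intro order_trans[OF norm_sum] sum_mono)
    also have "\<dots> = (\<Sum>k<m. (M * s) ^ k /\<^sub>R fact k) * norm \<psi>"
      by (simp add: sum_distrib_left sum_distrib_right power_mult_distrib divide_inverse mult_ac)
    also have "\<dots> \<le> exp (M * s) * norm \<psi>"
      unfolding exp_def using that M(1)
      by (intro mult_right_mono sum_le_suminf summable_exp_generic) auto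
    also have "\<dots> \<le> exp (M * t) * norm \<psi>"
      using that M(1) by (intro mult_right_mono) auto
    finally show ?thesis .
  qed
  have Hc: "(1 + real k) *\<^sub>R c (Suc k) = (- \<i>) *\<^sub>C H (c k)" for k
  proof -
    have "complex_of_real (1 + real k) = of_nat (Suc k)" by simp
    moreover have "of_nat (Suc k) * ((- \<i>) ^ Suc k / fact (Suc k)) = - \<i> * ((- \<i>) ^ k / fact k)"
      unfolding fact_Suc power_Suc of_nat_mult of_nat_fact
      by (simp only: times_divide_eq_right mult_divide_mult_cancel_left_if) (simp del: of_nat_Suc)
    ultimately show ?thesis
      unfolding c_def H_linear(3) cscale_simps(5,10) funpow.simps o_apply by metis
  qed
  have deriv_p: "(p (Suc m) has_vector_derivative (- \<i>) *\<^sub>C H (p m s)) (at s)" for m s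
  proof -
    have "(p (Suc m) has_vector_derivative (\<Sum>k<Suc m. (real k * s ^ (k - Suc 0)) *\<^sub>R c k)) (at s)"
      unfolding p_def
      by (auto intro!: derivative_eq_intros has_vector_derivative_sum simp: has_real_derivative_iff_has_vector_derivative[symmetric])
    also have "(\<Sum>k<Suc m. (real k * s ^ (k - Suc 0)) *\<^sub>R c k) = (\<Sum>k<m. s ^ k *\<^sub>R ((1 + real k) *\<^sub>R c (Suc k)))"
      by (subst sum.lessThan_Suc_shift) (simp add: mult.commute)
    also have "\<dots> = (- \<i>) *\<^sub>C H (p m s)"
      unfolding Hc p_def H_sum cscale_sum H_linear(4) by (simp only: cscale_simps(5,10) mult.commute)
    finally show ?thesis .
  qed
  have inner_H: "x \<bullet> ((- \<i>) *\<^sub>C H x) = 0" for x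
  proof -
    have "cinner x ((- \<i>) *\<^sub>C H x) = cnj (- \<i> * cinner (H x) x)"
      by (subst cinner_commute) (simp add: cinner_linear)
    then show ?thesis using Im_cinner_H[of x] by (simp add: inner_ell2_def)
  qed
  \<comment> \<open>The 2 counts the two equal terms of the product rule; the other factors bound
    the partial sum, the operator, and the top term of the series up to time
    \<open>t\<close>.\<close>
  define E where "E m = 2 * (exp (M * t) * norm \<psi>) * (M * ((M * t) ^ m /\<^sub>R fact m * norm \<psi>))" for m
  have poly: "p (Suc m) t \<bullet> p (Suc m) t \<le> (norm \<psi>)\<^sup>2 + t * E m" for m
  proof -
    let ?N = "\<lambda>s. p (Suc m) s \<bullet> p (Suc m) s - s * E m"
    have "?N t \<le> ?N 0"
    proof (rule DERIV_nonpos_imp_nonincreasing[OF t])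
      fix s assume s: "0 \<le> s" "s \<le> t"
      let ?q = "p (Suc m) s" and ?d = "(- \<i>) *\<^sub>C H (p m s)"
      have "((\<lambda>s. p (Suc m) s \<bullet> p (Suc m) s) has_real_derivative (?q \<bullet> ?d + ?d \<bullet> ?q)) (at s)"
        unfolding has_field_derivative_def
        by (rule has_derivative_eq_rhs[OF has_derivative_inner[OF deriv_p[of m s, unfolded has_vector_derivative_def]
            deriv_p[of m s, unfolded has_vector_derivative_def]]]) (simp add: fun_eq_iff algebra_simps)
      from DERIV_diff[OF this DERIV_cmult_right[OF DERIV_ident, of "E m"]]
      have "(?N has_real_derivative (?q \<bullet> ?d + ?d \<bullet> ?q - E m)) (at s)"
        by simp
      moreover have "?q \<bullet> ?d + ?d \<bullet> ?q - E m \<le> 0"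
      proof -
        \<comment> \<open>The derivative involves \<open>p m\<close> instead of
          \<open>p (Suc m)\<close>. They differ by the top term, and \<open>- \<i> H\<close> applied
          to \<open>?q\<close> is orthogonal to \<open>?q\<close> for the real inner product, so
          only the top term contributes.\<close>
        have "p m s = ?q - s ^ m *\<^sub>R c m" by (simp add: p_def)
        then have "?d = (- \<i>) *\<^sub>C H ?q - s ^ m *\<^sub>R ((- \<i>) *\<^sub>C H (c m))"
          by (simp only: H_linear(2,3) cscale_simps(2,5,10) mult.commute)
        then have "?q \<bullet> ?d = - (s ^ m * (?q \<bullet> ((- \<i>) *\<^sub>C H (c m))))"
          using inner_H[of ?q] by (simp only: inner_diff_right inner_scaleR_right)
        also have "\<dots> \<le> s ^ m * (norm ?q * norm ((- \<i>) *\<^sub>C H (c m)))"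
        proof -
          have "- (?q \<bullet> ((- \<i>) *\<^sub>C H (c m))) \<le> norm ?q * norm ((- \<i>) *\<^sub>C H (c m))"
            using Cauchy_Schwarz_ineq2[of ?q "(- \<i>) *\<^sub>C H (c m)"] by linarith
          from mult_left_mono[OF this zero_le_power[OF s(1)]] show ?thesis
            by (simp only: mult_minus_right)
        qed
        also have "\<dots> \<le> t ^ m * ((exp (M * t) * norm \<psi>) * (M * (M ^ m / fact m * norm \<psi>)))"
        proof (intro mult_mono power_mono norm_p s)
          have "norm ((- \<i>) *\<^sub>C H (c m)) \<le> M * norm (c m)"
            using M(2)[of "c m"] by (simp add: norm_cscale)
          also have "\<dots> \<le> M * (M ^ m / fact m * norm \<psi>)"
            using norm_c M(1) by (intro mult_left_mono) auto
          finally show "norm ((- \<i>) *\<^sub>C H (c m)) \<le> M * (M ^ m / fact m * norm \<psi>)" .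
        qed (use s t M in auto)
        also have "\<dots> = E m / 2"
          by (simp add: E_def power_mult_distrib field_simps)
        finally show ?thesis by (simp add: inner_commute[of ?d])
      qed
      ultimately show "\<exists>y. (?N has_real_derivative y) (at s) \<and> y \<le> 0" by blast
    qed
    moreover have "p (Suc m) 0 = \<psi>"
      unfolding p_def by (subst sum.lessThan_Suc_shift) (simp add: c_def cscale_simps)
    ultimately show ?thesis by (simp add: power2_norm_eq_inner)
  qed
  have "(\<lambda>k. t ^ k *\<^sub>R c k) sums evolution H t \<psi>"
    using evolution_sums[of t \<psi>] unfolding power_mult_distrib
    by (simp add: c_def cscale_simps mult_ac)
  then have "(\<lambda>m. p m t) \<longlonglongrightarrow> evolution H t \<psi>"
    by (simp add: sums_def p_def)
  then have "(\<lambda>m. p (Suc m) t \<bullet> p (Suc m) t) \<longlonglongrightarrow> evolution H t \<psi> \<bullet> evolution H t \<psi>"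
    by (intro tendsto_inner LIMSEQ_Suc)
  moreover have "(\<lambda>m. (norm \<psi>)\<^sup>2 + t * E m) \<longlonglongrightarrow> (norm \<psi>)\<^sup>2 + t * (2 * (exp (M * t) * norm \<psi>) * (M * (0 * norm \<psi>)))"
    unfolding E_def by (intro tendsto_intros summable_LIMSEQ_zero summable_exp_generic)
  ultimately have "evolution H t \<psi> \<bullet> evolution H t \<psi> \<le> (norm \<psi>)\<^sup>2 + t * (2 * (exp (M * t) * norm \<psi>) * (M * (0 * norm \<psi>)))"
    by (rule LIMSEQ_le) (use poly in blast)
  then have "(norm (evolution H t \<psi>))\<^sup>2 \<le> (norm \<psi>)\<^sup>2"
    by (simp add: power2_norm_eq_inner)
  then show ?thesis by (rule power2_le_imp_le) simp
qed

lemma avg_prob_nonneg: "0 < T \<Longrightarrow> 0 \<le> avg_prob V n T"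
  unfolding avg_prob_def set_lebesgue_integral_def
  by (intro mult_nonneg_nonneg integral_nonneg_AE) auto

text \<open>The factor 2 / T normalises the exponential weight to total mass 1, and the evolution
  does not increase the norm.\<close>

lemma sum_avg_prob_le_1:
  assumes F: "finite F" and T: "0 < T"
  shows "(\<Sum>n\<in>F. avg_prob V n T) \<le> 1"
proof -
  let ?f = "\<lambda>n t. indicator {0..} t *\<^sub>R (exp (- 2 * t / T) * (cmod (cinner (evolution H t (delta 1)) (delta n)))\<^sup>2)"
  have int: "has_bochner_integral lborel (\<lambda>t. indicator {0..} t *\<^sub>R exp (- (2 / T * t))) (1 / (2 / T))"
    using T by (intro has_bochner_integral_exp_minus) auto
  have "(\<Sum>n\<in>F. integral\<^sup>L lborel (?f n)) \<le> integral\<^sup>L lborel (\<lambda>t. indicator {0..} t *\<^sub>R exp (- (2 / T * t)))"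
  proof (rule sum_integral_le[OF F])
    show "integrable lborel (\<lambda>t. indicator {0..} t *\<^sub>R exp (- (2 / T * t)))"
      using int by (simp add: has_bochner_integral_iff)
    fix t :: real
    show "(\<Sum>n\<in>F. ?f n t) \<le> indicator {0..} t *\<^sub>R exp (- (2 / T * t))"
    proof (cases "0 \<le> t")
      case True
      have "(\<Sum>n\<in>F. ?f n t) = exp (- 2 * t / T) * (\<Sum>n\<in>F. (cmod (coord (evolution H t (delta 1)) n))\<^sup>2)"
        using True by (simp add: cinner_delta sum_distrib_left)
      also have "\<dots> \<le> exp (- 2 * t / T) * 1"
      proof (intro mult_left_mono)
        have "(norm (evolution H t (delta 1)))\<^sup>2 \<le> 1"
          using norm_evolution_le[OF True, of "delta 1"] by (simp add: power_le_one)
        then show "(\<Sum>n\<in>F. (cmod (coord (evolution H t (delta 1)) n))\<^sup>2) \<le> 1"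
          using sum_coord_le_norm[OF F, of "evolution H t (delta 1)"] by linarith
      qed simp
      finally show ?thesis using True by simp
    qed simp
  qed auto
  also have "\<dots> = T / 2"
    using int by (simp add: has_bochner_integral_iff)
  finally show ?thesis
    using T by (simp add: avg_prob_def set_lebesgue_integral_def field_simps flip: sum_divide_distrib sum_distrib_left)
qed

end

context spectral_bound
begin

lemma green_continuous: "0 < \<epsilon> \<Longrightarrow> continuous_on A (\<lambda>x. green (Complex x \<epsilon>) m n)"
  by (rule continuous_on_compose2[OF holomorphic_on_imp_continuous_on[OF green_holomorphic]])
    (auto simp: \<Omega>_iff Complex_eq intro!: continuous_intros)

text \<open>On the contour the exponential has modulus at most exp(\<epsilon> t). Both horizontal
  sides contribute the same integral, since the Green function at conjugate points is conjugate; the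
  vertical sides contribute \<open>D\<close> times a length of at most 2. Cauchy-Schwarz then passes
  to the integral of the square.\<close>

lemma coord_evolution_bound:
  assumes \<epsilon>: "0 < \<epsilon>" "\<epsilon> \<le> 1" and t: "0 \<le> t"
    and D: "\<And>x y. \<bar>x\<bar> = K \<Longrightarrow> \<bar>y\<bar> \<le> 1 \<Longrightarrow> cmod (green (Complex x y) n 1) \<le> D"
  shows "(cmod (coord (evolution H t (delta 1)) n))\<^sup>2 \<le>
    exp (2 * \<epsilon> * t) * (2 * K * integral {- K..K} (\<lambda>x. (cmod (green (Complex x \<epsilon>) n 1))\<^sup>2) + D\<^sup>2)"
proof -
  define f where "f z = exp (- \<i> * complex_of_real t * z) * green z n 1" for z
  have f_eq: "f = (\<lambda>z. exp (- \<i> * complex_of_real t * z) * green z n 1)"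
    by (simp add: f_def fun_eq_iff)
  define g where "g x = cmod (green (Complex x \<epsilon>) n 1)" for x
  define I where "I = integral {- K..K} g"
  have g: "continuous_on {- K..K} g"
    unfolding g_def by (intro continuous_intros green_continuous \<epsilon>)
  have I0: "0 \<le> I" unfolding I_def
    by (rule integral_nonneg) (auto simp: g_def intro!: integrable_continuous_real g[unfolded g_def])
  have D0: "0 \<le> D" using D[of K 0] K by (auto intro: order_trans[OF norm_ge_zero])
  let ?g = "rectpath (Complex (- K) (- \<epsilon>)) (Complex K \<epsilon>)"
  have "path_image ?g \<subseteq> \<Omega>"
  proof
    fix z assume "z \<in> path_image ?g"
    then have "Re z = K \<or> Re z = - K \<or> Im z = \<epsilon> \<or> Im z = - \<epsilon>"
      using K \<epsilon> by (auto simp: path_image_rectpath)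
    then have "Re z > K - 1 \<or> Re z < - K + 1 \<or> Im z > 0 \<or> Im z < 0"
      using \<epsilon> by linarith
    then show "z \<in> \<Omega>" unfolding \<Omega>_iff by auto
  qed
  then have cont: "continuous_on (path_image ?g) f"
    unfolding f_def by (intro continuous_intros continuous_on_subset[OF holomorphic_on_imp_continuous_on[OF green_holomorphic]])
  note s = contour_integral_rectpath_split[of "Complex (- K) (- \<epsilon>)" "Complex K \<epsilon>", OF _ _ cont, simplified]
  have Ke: "0 \<le> K" "0 \<le> \<epsilon>" using K \<epsilon> by auto
  have f_le: "cmod (f z) \<le> exp (\<epsilon> * t) * cmod (green z n 1)" if "Im z \<le> \<epsilon>" for z
    using mult_left_mono[OF that t] by (simp add: f_def norm_mult mult.commute[of \<epsilon>] mult_right_mono)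
  have hor: "cmod (contour_integral (linepath (Complex (- K) y) (Complex K y)) f) \<le> exp (\<epsilon> * t) * I"
    if y: "\<bar>y\<bar> = \<epsilon>" and c: "continuous_on (closed_segment (Complex (- K) y) (Complex K y)) f" for y
  proof -
    have gy: "cmod (green (Complex x y) n 1) = g x" for x
    proof (cases "y = \<epsilon>")
      case False
      then have "Complex x y = cnj (Complex x \<epsilon>)" using y by (simp add: complex_eq_iff)
      then show ?thesis using \<epsilon> by (simp only: green_cnj g_def) (simp add: green_cnj \<Omega>_iff)
    qed (simp add: g_def)
    have ct: "continuous_on {- K..K} (\<lambda>x. f (Complex x y))"
      using K by (intro continuous_on_compose2[OF c]) 
        (auto simp: Complex_eq closed_segment_same_Im closed_segment_eq_real_ivl intro!: continuous_intros)
    have "cmod (integral {- K..K} (\<lambda>x. f (Complex x y))) \<le> integral {- K..K} (\<lambda>x. exp (\<epsilon> * t) * g x)"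
      using f_le[of "Complex _ y"] y
      by (intro integral_norm_bound_integral integrable_continuous_real ct continuous_intros g) (auto simp: gy)
    then show ?thesis
      using K c by (subst contour_integral_horizontal) (auto simp: I_def)
  qed
  have ver: "cmod (contour_integral (linepath (Complex x (- \<epsilon>)) (Complex x \<epsilon>)) f) \<le> exp (\<epsilon> * t) * (2 * D)"
    if x: "\<bar>x\<bar> = K" and c: "continuous_on (closed_segment (Complex x (- \<epsilon>)) (Complex x \<epsilon>)) f" for x
  proof -
    have "cmod (contour_integral (linepath (Complex x (- \<epsilon>)) (Complex x \<epsilon>)) f) \<le>
        (exp (\<epsilon> * t) * D) * cmod (Complex x \<epsilon> - Complex x (- \<epsilon>))"
    proof (intro contour_integral_bound_linepath contour_integrable_continuous_linepath c)
      fix z assume "z \<in> closed_segment (Complex x (- \<epsilon>)) (Complex x \<epsilon>)"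
      then have z: "z = Complex x (Im z)" "\<bar>Im z\<bar> \<le> \<epsilon>"
        using \<epsilon> by (auto simp: closed_segment_same_Re closed_segment_eq_real_ivl complex_eq_iff)
      then have "cmod (green z n 1) \<le> D" using D[OF x, of "Im z"] \<epsilon> by simp
      then show "cmod (f z) \<le> exp (\<epsilon> * t) * D"
        using f_le[of z] z(2) by (intro order_trans[OF f_le] mult_left_mono) auto
    qed (use D0 in simp)
    also have "cmod (Complex x \<epsilon> - Complex x (- \<epsilon>)) = 2 * \<epsilon>"
      using \<epsilon> by (simp add: cmod_def real_sqrt_mult)
    also have "exp (\<epsilon> * t) * D * (2 * \<epsilon>) \<le> exp (\<epsilon> * t) * D * 2"
      using \<epsilon> D0 by (intro mult_left_mono) auto
    finally show ?thesis by simp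
  qed
  have tri: "cmod (p + q - r - w) \<le> cmod p + cmod q + cmod r + cmod w" for p q r w
    using norm_triangle_ineq4[of "p + q - r" w] norm_triangle_ineq4[of "p + q" r] norm_triangle_ineq[of p q]
    by linarith
  have "2 * pi * cmod (coord (evolution H t (delta 1)) n) = cmod (contour_integral ?g f)"
    unfolding f_eq coord_evolution_contour[OF \<epsilon>] by (simp add: norm_mult)
  also have "\<dots> \<le> exp (\<epsilon> * t) * I + exp (\<epsilon> * t) * (2 * D) + exp (\<epsilon> * t) * I + exp (\<epsilon> * t) * (2 * D)"
    unfolding s(1)[OF Ke]
    using K \<epsilon> s(2-)[OF Ke, THEN continuous_on_subset[OF cont]]
    by (intro order_trans[OF tri] add_mono hor ver) auto
  finally have b: "pi * cmod (coord (evolution H t (delta 1)) n) \<le> exp (\<epsilon> * t) * (I + 2 * D)"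
    by (simp add: algebra_simps)
  have "3 * cmod (coord (evolution H t (delta 1)) n) \<le> pi * cmod (coord (evolution H t (delta 1)) n)"
    using pi_gt3 by (intro mult_right_mono) auto
  with b have "(3 * cmod (coord (evolution H t (delta 1)) n))\<^sup>2 \<le> (exp (\<epsilon> * t) * (I + 2 * D))\<^sup>2"
    by (intro power_mono) auto
  also have "\<dots> = exp (2 * \<epsilon> * t) * (I + 2 * D)\<^sup>2"
    by (simp add: power_mult_distrib mult_ac flip: exp_of_nat_mult)
  \<comment> \<open>The 9 is chosen to cancel against the square of the 3 that replaced
    \<open>pi\<close>.\<close>
  also have "(I + 2 * D)\<^sup>2 \<le> 9 * (I\<^sup>2 + D\<^sup>2)"
  proof -
    have "0 \<le> (2 * I - D)\<^sup>2 + 4 * I\<^sup>2 + 4 * D\<^sup>2" by simp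
    then show ?thesis by (simp add: power2_eq_square algebra_simps)
  qed
  also have "I\<^sup>2 \<le> 2 * K * integral {- K..K} (\<lambda>x. (g x)\<^sup>2)"
    using integral_square_le[of "- K" K g] g K by (simp add: I_def)
  finally have "9 * (cmod (coord (evolution H t (delta 1)) n))\<^sup>2 \<le>
      exp (2 * \<epsilon> * t) * (9 * (2 * K * integral {- K..K} (\<lambda>x. (g x)\<^sup>2) + D\<^sup>2))"
    by (simp add: power_mult_distrib)
  then have "9 * (cmod (coord (evolution H t (delta 1)) n))\<^sup>2 \<le>
      9 * (exp (2 * \<epsilon> * t) * (2 * K * integral {- K..K} (\<lambda>x. (g x)\<^sup>2) + D\<^sup>2))"
    by (simp only: mult.left_commute)
  then show ?thesis by (simp add: g_def)
qed

text \<open>At height \<open>1 / (2 T)\<close> the contour formula costs only a factor \<open>exp (t / T)\<close>, so that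
  \<open>exp (- t / T)\<close> of the weight \<open>exp (- 2 t / T)\<close> remains and no Plancherel identity is needed.\<close>

lemma avg_prob_bound:
  assumes T: "1 \<le> T" and D: "\<And>x y. \<bar>x\<bar> = K \<Longrightarrow> \<bar>y\<bar> \<le> 1 \<Longrightarrow> cmod (green (Complex x y) n 1) \<le> D"
  shows "avg_prob V n T \<le> 4 * K * (LINT x:{- K..K}|lborel. (cmod (green (Complex x (1 / (2 * T))) n 1))\<^sup>2) + 2 * D\<^sup>2"
proof -
  let ?J = "integral {- K..K} (\<lambda>x. (cmod (green (Complex x (1 / (2 * T))) n 1))\<^sup>2)"
  have J: "?J = (LINT x:{- K..K}|lborel. (cmod (green (Complex x (1 / (2 * T))) n 1))\<^sup>2)"
    using T by (intro set_borel_integral_eq_integral(2)[symmetric] borel_integrable_atLeastAtMost')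
      (auto intro!: continuous_intros green_continuous)
  let ?c = "2 * K * ?J + D\<^sup>2"
  have c: "0 \<le> ?c"
    using K T by (intro add_nonneg_nonneg mult_nonneg_nonneg integral_nonneg integrable_continuous_real)
      (auto intro!: continuous_intros green_continuous)
  have int: "has_bochner_integral lborel (\<lambda>t. ?c * (indicator {0..} t *\<^sub>R exp (- (1 / T * t)))) (?c * (1 / (1 / T)))"
    using T by (intro has_bochner_integral_mult_right has_bochner_integral_exp_minus) auto
  have "(LINT t:{0..}|lborel. exp (- 2 * t / T) * (cmod (cinner (evolution H t (delta 1)) (delta n)))\<^sup>2) \<le>
      integral\<^sup>L lborel (\<lambda>t. ?c * (indicator {0..} t *\<^sub>R exp (- (1 / T * t))))"
    unfolding set_lebesgue_integral_def
  proof (rule integral_mono')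
    show "integrable lborel (\<lambda>t. ?c * (indicator {0..} t *\<^sub>R exp (- (1 / T * t))))"
      using int by (simp add: has_bochner_integral_iff)
    fix t :: real
    show "0 \<le> ?c * (indicator {0..} t *\<^sub>R exp (- (1 / T * t)))"
      using c by (intro mult_nonneg_nonneg) auto
    show "indicator {0..} t *\<^sub>R (exp (- 2 * t / T) * (cmod (cinner (evolution H t (delta 1)) (delta n)))\<^sup>2) \<le>
        ?c * (indicator {0..} t *\<^sub>R exp (- (1 / T * t)))"
    proof (cases "0 \<le> t")
      case True
      have "(cmod (coord (evolution H t (delta 1)) n))\<^sup>2 \<le> exp (2 * (1 / (2 * T)) * t) * ?c"
        using T by (intro coord_evolution_bound True D) auto
      then have "exp (- 2 * t / T) * (cmod (coord (evolution H t (delta 1)) n))\<^sup>2 \<le>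
          exp (- 2 * t / T) * (exp (2 * (1 / (2 * T)) * t) * ?c)"
        by (rule mult_left_mono) simp
      also have "\<dots> = ?c * exp (- 2 * t / T + 2 * (1 / (2 * T)) * t)"
        by (simp only: exp_add mult_ac)
      also have "- 2 * t / T + 2 * (1 / (2 * T)) * t = - (1 / T * t)"
        using T by (simp add: field_simps)
      finally show ?thesis using True by (simp add: cinner_delta)
    qed simp
  qed
  also have "\<dots> = ?c * T" using int by (simp add: has_bochner_integral_iff)
  finally have "2 / T * (LINT t:{0..}|lborel. exp (- 2 * t / T) * (cmod (cinner (evolution H t (delta 1)) (delta n)))\<^sup>2) \<le> 2 / T * (?c * T)"
    using T by (intro mult_left_mono) auto
  then show ?thesis
    unfolding avg_prob_def J[symmetric] using T by simp
qed

end

section \<open>Integrated bounds by transfer matrices\<close>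

lemma matrix_opnorm_mult: "norm (A *v x) \<le> matrix_opnorm A * norm x"
  unfolding matrix_opnorm_def by (rule onorm) (simp add: linear_conv_bounded_linear[symmetric])

text \<open>The images of the two basis vectors have Wronskian equal to the determinant.
  Consequently the inverse of the maximum in the hypotheses is at most 1.\<close>

lemma one_le_matrix_opnorm:
  assumes "det A = 1"
  shows "1 \<le> (matrix_opnorm A)\<^sup>2"
proof -
  let ?x = "vector [1, 0] :: complex^2" and ?y = "vector [0, 1] :: complex^2"
  have "1 = cmod (wronskian (A *v ?x) (A *v ?y))"
    unfolding wronskian_matrix assms by (simp add: wronskian_def)
  also have "\<dots> \<le> norm (A *v ?x) * norm (A *v ?y)" by (rule wronskian_le)
  also have "\<dots> \<le> (matrix_opnorm A * norm ?x) * (matrix_opnorm A * norm ?y)"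
    by (intro mult_mono matrix_opnorm_mult mult_nonneg_nonneg matrix_opnorm_nonneg) auto
  also have "\<dots> = (matrix_opnorm A)\<^sup>2"
    by (simp add: norm_complex2 power2_eq_square)
  finally show ?thesis .
qed

text \<open>A crude comparison with the Frobenius norm, from which the continuity of
  \<open>matrix_opnorm\<close> follows.\<close>

lemma matrix_opnorm_le_norm: "matrix_opnorm A \<le> 4 * norm A"
  unfolding matrix_opnorm_def
proof (rule onorm_le)
  fix x :: "complex^2"
  have *: "cmod (A$i$j * x$j) \<le> norm A * norm x" for i j
    unfolding norm_mult
    by (intro mult_mono order_trans[OF Finite_Cartesian_Product.norm_nth_le Finite_Cartesian_Product.norm_nth_le]
        Finite_Cartesian_Product.norm_nth_le) auto
  have "cmod ((A *v x)$i) \<le> norm A * norm x + norm A * norm x" for i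
    unfolding matrix_vector_mult_def sum_2 vec_lambda_beta
    by (intro order_trans[OF norm_triangle_ineq] add_mono *)
  then have "norm (A *v x) \<le> (norm A * norm x + norm A * norm x) + (norm A * norm x + norm A * norm x)"
    by (intro order_trans[OF norm_complex2_le] add_mono)
  then show "norm (A *v x) \<le> 4 * norm A * norm x"
    by (simp only: mult.assoc)
qed

lemma continuous_on_matrix_opnorm: "continuous_on UNIV matrix_opnorm"
proof (rule continuous_onI)
  have le: "matrix_opnorm A \<le> matrix_opnorm B + 4 * norm (A - B)" for A B
  proof -
    have "matrix_opnorm A \<le> matrix_opnorm B + matrix_opnorm (A - B)"
      unfolding matrix_opnorm_def
    proof (rule onorm_le)
      fix x
      have "norm (A *v x) \<le> norm (B *v x) + norm ((A - B) *v x)"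
        by (metis add_diff_cancel_left' matrix_vector_mult_diff_rdistrib norm_triangle_ineq diff_add_cancel add.commute)
      also have "\<dots> \<le> matrix_opnorm B * norm x + matrix_opnorm (A - B) * norm x"
        by (intro add_mono matrix_opnorm_mult)
      finally show "norm (A *v x) \<le> (onorm ((*v) B) + onorm ((*v) (A - B))) * norm x"
        by (simp add: matrix_opnorm_def distrib_right)
    qed
    then show ?thesis using matrix_opnorm_le_norm[of "A - B"] by linarith
  qed
  fix B :: "complex^2^2" and e :: real assume e: "0 < e"
  show "\<exists>d>0. \<forall>A\<in>UNIV. dist A B < d \<longrightarrow> dist (matrix_opnorm A) (matrix_opnorm B) \<le> e"
  proof (intro exI[of _ "e / 4"] conjI ballI impI)
    fix A assume "dist A B < e / 4"
    then show "dist (matrix_opnorm A) (matrix_opnorm B) \<le> e"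
      using le[of A B] le[of B A] by (simp add: dist_norm norm_minus_commute abs_le_iff)
  qed (use e in simp)
qed

lemma continuous_on_matrix_mult:
  fixes A B :: "'a::topological_space \<Rightarrow> complex^2^2"
  assumes "continuous_on S A" "continuous_on S B"
  shows "continuous_on S (\<lambda>x. A x ** B x)"
  unfolding matrix_matrix_mult_def by (intro continuous_intros assms)

lemma continuous_on_transfer_matrix:
  "continuous_on UNIV (\<lambda>z. transfer_matrix V k z)"
proof -
  \<comment> \<open>The step matrices and their inverses are affine in \<open>z\<close>: a constant
    matrix plus \<open>z\<close> times a matrix unit.\<close>
  have "transfer_step V m = (\<lambda>z. transfer_step V m 0 + (\<chi> i j. (if i = 1 \<and> j = 1 then 1 else 0) * z))" for m
    by (rule ext) (simp add: transfer_step_def vec_eq_iff forall_2)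
  moreover have "continuous_on UNIV (\<lambda>z::complex. transfer_step V m 0 + (\<chi> i j. (if i = 1 \<and> j = 1 then 1 else 0) * z))" for m
    by (intro continuous_intros)
  ultimately have 1: "continuous_on UNIV (transfer_step V m)" for m by metis
  have "(\<lambda>z. matrix_inv (transfer_step V m z)) =
      (\<lambda>z. matrix_inv (transfer_step V m 0) + (\<chi> i j. (if i = 2 \<and> j = 2 then 1 else 0) * z))" for m
    by (rule ext) (simp add: matrix_inv_transfer_step vec_eq_iff forall_2)
  moreover have "continuous_on UNIV (\<lambda>z::complex. matrix_inv (transfer_step V m 0) + (\<chi> i j. (if i = 2 \<and> j = 2 then 1 else 0) * z))" for m
    by (intro continuous_intros)
  ultimately have 2: "continuous_on UNIV (\<lambda>z. matrix_inv (transfer_step V m z))" for m by metis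
  have "continuous_on UNIV (\<lambda>z. transfer_pos V z j)" for j
    by (induction j) (simp_all add: continuous_on_matrix_mult 1)
  moreover have "continuous_on UNIV (\<lambda>z. transfer_neg V z j)" for j
    by (induction j) (simp_all add: continuous_on_matrix_mult 2)
  ultimately show ?thesis by (cases "0 \<le> k") (simp_all add: transfer_matrix_def)
qed

lemma det_transfer_matrix: "det (transfer_matrix V k z) = 1"
proof -
  have "det (transfer_pos V z j) = 1" "det (transfer_neg V z j) = 1" for j
    by (induction j) (simp_all add: det_mul det_transfer_step)
  then show ?thesis by (simp add: transfer_matrix_def)
qed

text \<open>Needed for the dominating function in \<open>sum_integral_le\<close>: a non-integrable
  one would have integral 0 by convention and bound nothing.\<close>

lemma integrable_inverse_Max_transfer:
  assumes I: "finite I" "I \<noteq> {}"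
  shows "integrable lborel (\<lambda>x. indicator {a..b} x *\<^sub>R
    inverse (MAX k\<in>I. (matrix_opnorm (transfer_matrix V k (Complex x \<epsilon>)))\<^sup>2))"
proof (rule Bochner_Integration.integrable_bound[where f = "indicator {a..b} :: real \<Rightarrow> real"])
  have "continuous_on UNIV (\<lambda>x. transfer_matrix V k (Complex x \<epsilon>))" for k
    by (rule continuous_on_compose2[OF continuous_on_transfer_matrix])
      (auto simp: Complex_eq intro!: continuous_intros)
  then have "continuous_on UNIV (\<lambda>x. (matrix_opnorm (transfer_matrix V k (Complex x \<epsilon>)))\<^sup>2)" for k
    by (intro continuous_on_power continuous_on_compose2[OF continuous_on_matrix_opnorm]) auto
  then have [measurable]: "(\<lambda>x. (matrix_opnorm (transfer_matrix V k (Complex x \<epsilon>)))\<^sup>2) \<in> borel_measurable borel" for k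
    by (rule borel_measurable_continuous_onI)
  have [measurable]: "(\<lambda>x. MAX k\<in>I. (matrix_opnorm (transfer_matrix V k (Complex x \<epsilon>)))\<^sup>2) \<in> borel_measurable borel"
    using I(1) by (intro borel_measurable_Max) auto
  show "(\<lambda>x. indicator {a..b} x *\<^sub>R
    inverse (MAX k\<in>I. (matrix_opnorm (transfer_matrix V k (Complex x \<epsilon>)))\<^sup>2)) \<in> borel_measurable lborel"
    by measurable
  have "1 \<le> (MAX k\<in>I. (matrix_opnorm (transfer_matrix V k (Complex x \<epsilon>)))\<^sup>2)" for x
    using I by (auto simp: Max_ge_iff intro!: one_le_matrix_opnorm det_transfer_matrix)
  then have "\<bar>inverse (MAX k\<in>I. (matrix_opnorm (transfer_matrix V k (Complex x \<epsilon>)))\<^sup>2)\<bar> \<le> 1" for x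
    by (metis abs_inverse abs_of_nonneg inverse_le_1_iff order_trans zero_le_one)
  then show "AE x in lborel. norm (indicator {a..b} x *\<^sub>R
    inverse (MAX k\<in>I. (matrix_opnorm (transfer_matrix V k (Complex x \<epsilon>)))\<^sup>2)) \<le> norm (indicator {a..b} x :: real)"
    by (intro AE_I2) (auto simp: indicator_def)
qed (simp add: integrable_indicator_iff emeasure_lborel_Icc_eq)

context spectral_bound
begin

lemma R_lower_bound:
  assumes "z \<in> \<Omega>" "\<And>x. norm (R z x) \<le> b * norm x"
  shows "norm x \<le> b * norm (H x - z *\<^sub>C x)"
  using assms(2)[of "H x - z *\<^sub>C x"] by (simp add: R_H[OF assms(1)])

text \<open>The two sides form a compact set, written as degenerate boxes. Heights up to 1 cover
  every rectangle used, so \<open>B\<close> does not depend on \<open>T\<close>.\<close>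

lemma green_decay_side:
  "\<exists>B\<ge>1. \<forall>x y n s. \<bar>x\<bar> = K \<longrightarrow> \<bar>y\<bar> \<le> 1 \<longrightarrow> n \<noteq> 0 \<longrightarrow>
     (cmod (green (Complex x y) n 1))\<^sup>2 \<le> B\<^sup>2 * (fact s * (8 * B\<^sup>2 / \<bar>real_of_int n\<bar>) ^ s)"
proof -
  let ?C = "cbox (Complex K (- 1)) (Complex K 1) \<union> cbox (Complex (- K) (- 1)) (Complex (- K) 1)"
  have "?C \<subseteq> \<Omega>" using K by (auto simp: in_cbox_complex_iff \<Omega>_iff)
  then obtain b where b: "1 \<le> b" "\<And>w x. w \<in> ?C \<Longrightarrow> norm (R w x) \<le> b * norm x"
    using R_bounded_on_compact[of ?C] by (meson compact_Un compact_cbox)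
  have "(cmod (green (Complex x y) n 1))\<^sup>2 \<le> b\<^sup>2 * (fact s * (8 * b\<^sup>2 / \<bar>real_of_int n\<bar>) ^ s)"
    if "\<bar>x\<bar> = K" "\<bar>y\<bar> \<le> 1" "n \<noteq> 0" for x y n s
  proof -
    have w: "Complex x y \<in> ?C" using that by (auto simp: in_cbox_complex_iff)
    then have w': "Complex x y \<in> \<Omega>" using \<open>?C \<subseteq> \<Omega>\<close> by blast
    show ?thesis
      unfolding green_def
      by (rule green_decay[OF H_R[OF w'] R_lower_bound[OF w' b(2)[OF w]] b(1) that(3)])
  qed
  then show ?thesis using b(1) by blast
qed

lemma H_lower_bound_strip:
  assumes "1 \<le> T"
  shows "norm x \<le> T * norm (H x - Complex E (1 / T) *\<^sub>C x)"
  using H_lower_bound[of "Complex E (1 / T)" x] assms by (simp add: field_simps)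

lemma strip_in_\<Omega>: "1 \<le> T \<Longrightarrow> Complex E (1 / T) \<in> \<Omega>"
  by (simp add: \<Omega>_iff)

lemma sum_green_le:
  assumes T: "1 \<le> T" and F: "finite F"
  shows "(\<Sum>n\<in>F. (cmod (green (Complex E (1 / T)) n k))\<^sup>2) \<le> T\<^sup>2"
proof -
  let ?x = "R (Complex E (1 / T)) (delta k)"
  have "norm ?x \<le> T"
    using H_lower_bound_strip[OF T, of ?x E] by (simp add: H_R[OF strip_in_\<Omega>[OF T]])
  then have "(norm ?x)\<^sup>2 \<le> T\<^sup>2" by (rule power_mono) simp
  then show ?thesis
    using sum_coord_le_norm[OF F, of ?x] by (simp add: green_def)
qed

text \<open>At a fixed energy \<open>k\<close> is taken where the maximum is attained. This is
  allowed because the pointwise bound holds for every \<open>k\<close> in \<open>I\<close>, and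
  because the sums over \<open>n\<close> of the columns \<open>k\<close> and \<open>k + 1\<close>
  are at most T^2 for each \<open>k\<close>.\<close>

lemma sum_green_le_transfer:
  assumes T: "1 \<le> T" and F: "finite F" and I: "finite I" "I \<noteq> {}"
    and IF: "\<And>k n. k \<in> I \<Longrightarrow> n \<in> F \<Longrightarrow> 0 < k \<and> k < n \<or> k < 0 \<and> n < k"
    and N: "\<And>k. k \<in> I \<Longrightarrow> \<bar>real_of_int k\<bar> \<le> N"
    and b: "\<And>m. cmod (Complex E (1 / T) - complex_of_real (V m)) \<le> b"
  shows "(\<Sum>n\<in>F. (cmod (green (Complex E (1 / T)) n 1))\<^sup>2) \<le>
    2 * T\<^sup>2 * (1 + (N * (b + 2) + 1) * T\<^sup>2)\<^sup>2 *
    inverse (MAX k\<in>I. (matrix_opnorm (transfer_matrix V k (Complex E (1 / T))))\<^sup>2)"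
\<comment> \<open>For empty \<open>F\<close> the condition \<open>IF\<close> is vacuous, and the
  maximising \<open>k\<close> could be 0.\<close>
proof (cases "F = {}")
  case True
  have "0 \<le> (MAX k\<in>I. (matrix_opnorm (transfer_matrix V k (Complex E (1 / T))))\<^sup>2)"
    using I by (auto simp: Max_ge_iff)
  then show ?thesis using True by simp
next
  case False
  define z where "z = Complex E (1 / T)"
  have z: "z \<in> \<Omega>" unfolding z_def by (rule strip_in_\<Omega>[OF T])
  define \<Phi> where "\<Phi> k = (matrix_opnorm (transfer_matrix V k z))\<^sup>2" for k
  have "Max (\<Phi> ` I) \<in> \<Phi> ` I" using I by (intro Max_in) auto
  then obtain k where k: "k \<in> I" "Max (\<Phi> ` I) = \<Phi> k" by auto
  have k0: "k \<noteq> 0" using IF[OF k(1)] False by force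
  have \<Phi>: "1 \<le> \<Phi> k" unfolding \<Phi>_def by (rule one_le_matrix_opnorm[OF det_transfer_matrix])
  have b0: "0 \<le> b" by (rule order_trans[OF norm_ge_zero b])
  let ?Q = "\<lambda>N. (1 + (N * (b + 2) + 1) * T\<^sup>2)\<^sup>2"
  have "\<Phi> k * (cmod (green z n 1))\<^sup>2 \<le> ?Q \<bar>real_of_int k\<bar> * ((cmod (green z n (k + 1)))\<^sup>2 + (cmod (green z n k))\<^sup>2)"
    if n: "n \<in> F" for n
  proof -
    \<comment> \<open>Symmetry exchanges source and observation point: what was a value of the
      column \<open>n\<close> becomes an entry of the column \<open>m\<close>, to be summed over
      \<open>n\<close>.\<close>
    have "coord (R z (delta n)) m = green z n m" for m
      using green_commute[OF z, of n m] by (simp add: green_def)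
    then show ?thesis
      using transfer_matrix_green_bound[OF H_R[OF z, of "delta n"] _ T b[folded z_def] k0 IF[OF k(1) n]]
        H_lower_bound_strip[OF T, of _ E]
      by (simp add: \<Phi>_def z_def[symmetric])
  qed
  then have "(\<Sum>n\<in>F. \<Phi> k * (cmod (green z n 1))\<^sup>2) \<le>
      (\<Sum>n\<in>F. ?Q \<bar>real_of_int k\<bar> * ((cmod (green z n (k + 1)))\<^sup>2 + (cmod (green z n k))\<^sup>2))"
    by (rule sum_mono)
  also have "\<dots> = ?Q \<bar>real_of_int k\<bar> * ((\<Sum>n\<in>F. (cmod (green z n (k + 1)))\<^sup>2) + (\<Sum>n\<in>F. (cmod (green z n k))\<^sup>2))"
    by (simp add: sum_distrib_left sum.distrib distrib_left)
  also have "\<dots> \<le> ?Q N * (T\<^sup>2 + T\<^sup>2)"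
  proof (intro mult_mono add_mono power_mono)
    show "(\<Sum>n\<in>F. (cmod (green z n (k + 1)))\<^sup>2) \<le> T\<^sup>2" "(\<Sum>n\<in>F. (cmod (green z n k))\<^sup>2) \<le> T\<^sup>2"
      unfolding z_def by (rule sum_green_le[OF T F])+
    show "\<bar>real_of_int k\<bar> \<le> N" by (rule N[OF k(1)])
  qed (use b0 T order_trans[OF abs_ge_zero N[OF k(1)]] in \<open>auto intro!: add_nonneg_nonneg sum_nonneg mult_nonneg_nonneg\<close>)
  finally have "\<Phi> k * (\<Sum>n\<in>F. (cmod (green z n 1))\<^sup>2) \<le> ?Q N * (T\<^sup>2 + T\<^sup>2)"
    by (simp add: sum_distrib_left)
  then have "(\<Sum>n\<in>F. (cmod (green z n 1))\<^sup>2) \<le> 2 * T\<^sup>2 * ?Q N * inverse (\<Phi> k)"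
    using \<Phi> by (simp add: field_simps)
  then show ?thesis using k(2) by (simp add: \<Phi>_def z_def)
qed

lemma sum_integral_green_le:
  assumes T: "1 \<le> T" and F: "finite F" and I: "finite I" "I \<noteq> {}"
    and IF: "\<And>k n. k \<in> I \<Longrightarrow> n \<in> F \<Longrightarrow> 0 < k \<and> k < n \<or> k < 0 \<and> n < k"
    and N: "\<And>k. k \<in> I \<Longrightarrow> \<bar>real_of_int k\<bar> \<le> N"
    and b: "\<And>m. \<bar>V m\<bar> \<le> b"
  shows "(\<Sum>n\<in>F. LINT x:{- K..K}|lborel. (cmod (green (Complex x (1 / T)) n 1))\<^sup>2) \<le>
    2 * T\<^sup>2 * (1 + (N * (K + b + 3) + 1) * T\<^sup>2)\<^sup>2 *
    (LINT x:{- K..K}|lborel. inverse (MAX k\<in>I. (matrix_opnorm (transfer_matrix V k (Complex x (1 / T))))\<^sup>2))"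
proof -
  let ?q = "2 * T\<^sup>2 * (1 + (N * (K + b + 3) + 1) * T\<^sup>2)\<^sup>2"
  let ?g = "\<lambda>x. indicator {- K..K} x *\<^sub>R
    inverse (MAX k\<in>I. (matrix_opnorm (transfer_matrix V k (Complex x (1 / T))))\<^sup>2)"
  have "(\<Sum>n\<in>F. LINT x|lborel. indicator {- K..K} x *\<^sub>R (cmod (green (Complex x (1 / T)) n 1))\<^sup>2) \<le>
      (LINT x|lborel. ?q * ?g x)"
  proof (rule sum_integral_le[OF F])
    show "integrable lborel (\<lambda>x. ?q * ?g x)"
      by (intro integrable_mult_right integrable_inverse_Max_transfer I)
    fix x
    show "(\<Sum>n\<in>F. indicator {- K..K} x *\<^sub>R (cmod (green (Complex x (1 / T)) n 1))\<^sup>2) \<le> ?q * ?g x"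
    proof (cases "x \<in> {- K..K}")
      case True
      have "cmod (Complex x (1 / T) - complex_of_real (V m)) \<le> K + b + 1" for m
      proof -
        have "cmod (Complex x (1 / T) - complex_of_real (V m)) \<le> \<bar>x\<bar> + \<bar>1 / T\<bar> + \<bar>V m\<bar>"
          using norm_triangle_ineq4[of "Complex x (1 / T)" "complex_of_real (V m)"]
            cmod_le[of "Complex x (1 / T)"] by simp
        also have "\<dots> \<le> K + 1 + b"
          using True T b[of m] by (intro add_mono) auto
        finally show ?thesis by simp
      qed
      from sum_green_le_transfer[OF T F I IF N this] True
      show ?thesis by (simp add: add.assoc)
    qed simp
  qed auto
  also have "\<dots> = ?q * (LINT x|lborel. ?g x)"
    by (rule Bochner_Integration.integral_mult_right_zero)
  finally show ?thesis by (simp add: set_lebesgue_integral_def)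
qed

end

section \<open>Asymptotics\<close>

text \<open>Telescoping with 1 / (k + 1)^2 <= 1 / k - 1 / (k + 1).\<close>

lemma sum_inverse_squares_le_2: "(\<Sum>k=1..m. 1 / (real k)\<^sup>2) \<le> 2"
proof -
  have *: "(\<Sum>k=1..Suc m. 1 / (real k)\<^sup>2) \<le> 2 - 1 / real (Suc m)" for m
  proof (induction m)
    case (Suc m)
    have eq: "1 / real (Suc m) - 1 / real (Suc (Suc m)) = 1 / (real (Suc m) * real (Suc (Suc m)))"
      by (simp add: field_simps)
    have "1 / (real (Suc (Suc m)))\<^sup>2 \<le> 1 / real (Suc m) - 1 / real (Suc (Suc m))"
      unfolding eq power2_eq_square by (intro divide_left_mono mult_right_mono) auto
    with Suc show ?case by simp
  qed simp
  show ?thesis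
  proof (cases m)
    case (Suc k)
    have "2 - 1 / real (Suc k) \<le> 2" by simp
    with *[of k] show ?thesis unfolding Suc by (rule order_trans)
  qed simp
qed

lemma sum_int_inverse_squares_le_4:
  fixes F :: "int set"
  assumes "finite F" "0 \<notin> F"
  shows "(\<Sum>n\<in>F. 1 / \<bar>real_of_int n\<bar>\<^sup>2) \<le> 4"
proof -
  obtain m where m: "nat ` abs ` F \<subseteq> {..m}"
    using finite_nat_iff_bounded_le assms(1) by blast
  let ?A = "int ` {1..m}" and ?B = "(\<lambda>k. - int k) ` {1..m}"
  have "n \<in> ?A \<union> ?B" if "n \<in> F" for n
  proof -
    have "nat \<bar>n\<bar> \<in> {1..m}" using m that assms(2) by (auto simp: Suc_le_eq)
    moreover have "n = int (nat \<bar>n\<bar>) \<or> n = - int (nat \<bar>n\<bar>)" by auto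
    ultimately show ?thesis by blast
  qed
  then have "(\<Sum>n\<in>F. 1 / \<bar>real_of_int n\<bar>\<^sup>2) \<le> (\<Sum>n\<in>?A \<union> ?B. 1 / \<bar>real_of_int n\<bar>\<^sup>2)"
    by (intro sum_mono2) auto
  also have "\<dots> \<le> (\<Sum>n\<in>?A. 1 / \<bar>real_of_int n\<bar>\<^sup>2) + (\<Sum>n\<in>?B. 1 / \<bar>real_of_int n\<bar>\<^sup>2)"
    by (subst sum.union_disjoint) auto
  also have "\<dots> = (\<Sum>k=1..m. 1 / (real k)\<^sup>2) + (\<Sum>k=1..m. 1 / (real k)\<^sup>2)"
    by (subst (1 2) sum.reindex) (auto simp: inj_on_def)
  finally show ?thesis using sum_inverse_squares_le_2[of m] by linarith
qed

lemma eventually_ge_powr: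
  assumes "0 < \<gamma>"
  shows "\<forall>\<^sub>F T in at_top. (c::real) \<le> T powr \<gamma>"
proof (rule eventually_at_top_linorderI)
  fix T assume "max 1 (\<bar>c\<bar> powr (1 / \<gamma>)) \<le> T"
  then have "(\<bar>c\<bar> powr (1 / \<gamma>)) powr \<gamma> \<le> T powr \<gamma>"
    using assms by (intro powr_mono2) auto
  then show "c \<le> T powr \<gamma>" using assms by (simp add: powr_powr)
qed

context spectral_bound
begin

text \<open>An a priori bound from \<open>green_decay\<close> alone, with lower-bound constant
  \<open>2 * T\<close> on the whole horizontal segment. It is weak near the origin but controls the
  moments at sites far beyond T^2.\<close>

lemma avg_prob_decay:
  "\<exists>c\<ge>0. \<forall>T\<ge>1. \<forall>n. n \<noteq> 0 \<longrightarrow> avg_prob V n T \<le> c * T ^ (2 * s + 2) / \<bar>real_of_int n\<bar> ^ s"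
proof -
  obtain B where B: "1 \<le> B" "\<And>x y n s. \<bar>x\<bar> = K \<Longrightarrow> \<bar>y\<bar> \<le> 1 \<Longrightarrow> n \<noteq> 0 \<Longrightarrow>
     (cmod (green (Complex x y) n 1))\<^sup>2 \<le> B\<^sup>2 * (fact s * (8 * B\<^sup>2 / \<bar>real_of_int n\<bar>) ^ s)"
    using green_decay_side by blast
  \<comment> \<open>From 4 K (contour bound) times 2 K (length of the segment) times
    \<open>E\<close> below, whose constants are (2 T)^2 = 4 T^2 and 8 (2 T)^2 = 32 T^2.\<close>
  define c1 where "c1 = 8 * K\<^sup>2 * (4 * (fact s * 32 ^ s))"
  define c2 where "c2 = 2 * (B\<^sup>2 * (fact s * (8 * B\<^sup>2) ^ s))"
  have c: "0 \<le> c1" "0 \<le> c2" using K B(1) by (auto simp: c1_def c2_def)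
  have "avg_prob V n T \<le> (c1 + c2) * T ^ (2 * s + 2) / \<bar>real_of_int n\<bar> ^ s"
    if T: "1 \<le> T" and n: "n \<noteq> 0" for T n
  proof -
    define D where "D = sqrt (B\<^sup>2 * (fact s * (8 * B\<^sup>2 / \<bar>real_of_int n\<bar>) ^ s))"
    have D2: "D\<^sup>2 = B\<^sup>2 * (fact s * (8 * B\<^sup>2 / \<bar>real_of_int n\<bar>) ^ s)"
      by (simp add: D_def)
    have D: "cmod (green (Complex x y) n 1) \<le> D" if "\<bar>x\<bar> = K" "\<bar>y\<bar> \<le> 1" for x y
      unfolding D_def by (rule real_le_rsqrt) (rule B(2)[OF that n])
    define E where "E = (2 * T)\<^sup>2 * (fact s * (8 * (2 * T)\<^sup>2 / \<bar>real_of_int n\<bar>) ^ s)"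
    have E0: "0 \<le> E" by (simp add: E_def)
    have "(LINT x:{- K..K}|lborel. (cmod (green (Complex x (1 / (2 * T))) n 1))\<^sup>2) \<le>
        (LINT x|lborel. indicator {- K..K} x *\<^sub>R E)"
      unfolding set_lebesgue_integral_def
    proof (rule integral_mono')
      fix x
      have "(cmod (green (Complex x (1 / (2 * T))) n 1))\<^sup>2 \<le> E"
        unfolding E_def green_def
        by (rule green_decay[OF H_R[OF strip_in_\<Omega>] H_lower_bound_strip]) (use T n in auto)
      then show "indicator {- K..K} x *\<^sub>R (cmod (green (Complex x (1 / (2 * T))) n 1))\<^sup>2 \<le> indicator {- K..K} x *\<^sub>R E"
        by (auto simp: indicator_def)
    qed (use E0 in \<open>auto intro!: integrable_mult_left simp: integrable_indicator_iff emeasure_lborel_Icc_eq\<close>)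
    also have "\<dots> = 2 * K * E"
      using K by simp
    finally have "avg_prob V n T \<le> 4 * K * (2 * K * E) + 2 * D\<^sup>2"
      using K by (intro order_trans[OF avg_prob_bound[OF T D]] add_right_mono mult_left_mono) auto
    also have "4 * K * (2 * K * E) = c1 * T ^ (2 * s + 2) / \<bar>real_of_int n\<bar> ^ s"
      by (simp add: E_def c1_def power_mult_distrib power_divide power_add power_mult power2_eq_square)
    also have "2 * D\<^sup>2 = c2 * 1 / \<bar>real_of_int n\<bar> ^ s"
      by (simp add: D2 c2_def power_divide)
    also have "\<dots> \<le> c2 * T ^ (2 * s + 2) / \<bar>real_of_int n\<bar> ^ s"
      using T c by (intro divide_right_mono mult_left_mono one_le_power) auto
    finally show ?thesis by (simp add: distrib_right add_divide_distrib)
  qed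
  then show ?thesis using c by (intro exI[of _ "c1 + c2"]) auto
qed

end

section \<open>Rapid decay of the outside probabilities from the hypotheses\<close>

locale transfer_decay = spectral_bound +
  fixes C \<alpha> :: real
  assumes C: "0 < C" and \<alpha>: "0 < \<alpha>" "\<alpha> < 1"
    and right: "\<And>m :: nat. m \<ge> 1 \<Longrightarrow>
      (\<lambda>T :: real. LINT E:{- K..K}|lborel.
         inverse (MAX n\<in>{n :: int. 1 \<le> n \<and> real_of_int n \<le> C * T powr \<alpha>}.
           (matrix_opnorm (transfer_matrix V n (Complex E (1 / T))))\<^sup>2))
        \<in> O[at_top](\<lambda>T. T powr (- real m))"
    and left: "\<And>m :: nat. m \<ge> 1 \<Longrightarrow>
      (\<lambda>T :: real. LINT E:{- K..K}|lborel.
         inverse (MAX n\<in>{n :: int. 1 \<le> - n \<and> real_of_int (- n) \<le> C * T powr \<alpha>}.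
           (matrix_opnorm (transfer_matrix V n (Complex E (1 / T))))\<^sup>2))
        \<in> O[at_top](\<lambda>T. T powr (- real m))"
begin

lemma sum_integral_green_rapid:
  "\<exists>c\<ge>0. \<forall>\<^sub>F T in at_top. \<forall>F. finite F \<longrightarrow> (\<forall>n\<in>F. C * T powr \<alpha> < \<bar>real_of_int n\<bar>) \<longrightarrow>
     (\<Sum>n\<in>F. LINT x:{- K..K}|lborel. (cmod (green (Complex x (1 / T)) n 1))\<^sup>2) \<le> c * T powr (- real m)"
proof -
  obtain b where b: "\<And>m. \<bar>V m\<bar> \<le> b"
    using bounded_V by (auto simp: bounded_iff)
  have b0: "0 \<le> b" by (rule order_trans[OF abs_ge_zero b])
  define Ir where "Ir T = {n :: int. 1 \<le> n \<and> real_of_int n \<le> C * T powr \<alpha>}" for T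
  define Il where "Il T = {n :: int. 1 \<le> - n \<and> real_of_int (- n) \<le> C * T powr \<alpha>}" for T
  define J where "J I T = (LINT E:{- K..K}|lborel. inverse (MAX n\<in>I T.
      (matrix_opnorm (transfer_matrix V n (Complex E (1 / T))))\<^sup>2))" for I :: "real \<Rightarrow> int set" and T
  \<comment> \<open>The extra 8 pays for the prefactor of \<open>sum_integral_green_le\<close>: with
    \<open>N \<le> C * T\<close> it is at most a constant times T^2 (T * T^2)^2 = T^8.\<close>
  have "(\<lambda>T. J Ir T) \<in> O[at_top](\<lambda>T. T powr (- real (m + 8)))"
    unfolding J_def Ir_def by (rule right) simp
  moreover have "(\<lambda>T. J Il T) \<in> O[at_top](\<lambda>T. T powr (- real (m + 8)))"
    unfolding J_def Il_def by (rule left) simp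
  ultimately obtain cr cl where cr: "0 < cr" "\<forall>\<^sub>F T in at_top. norm (J Ir T) \<le> cr * norm (T powr (- real (m + 8)))"
    and cl: "0 < cl" "\<forall>\<^sub>F T in at_top. norm (J Il T) \<le> cl * norm (T powr (- real (m + 8)))"
    by (elim landau_o.bigE) blast
  define q where "q = 2 * (2 + C * (K + b + 3))\<^sup>2"
  have q0: "0 \<le> q" by (simp add: q_def)
  \<comment> \<open>This makes \<open>N \<ge> 1\<close>, so that both index sets of the maxima are
    nonempty.\<close>
  have ev: "\<forall>\<^sub>F T in at_top. 1 / C \<le> T powr \<alpha>"
    by (rule eventually_ge_powr) (rule \<alpha>)
  have "\<forall>\<^sub>F T in at_top. \<forall>F. finite F \<longrightarrow> (\<forall>n\<in>F. C * T powr \<alpha> < \<bar>real_of_int n\<bar>) \<longrightarrow>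
     (\<Sum>n\<in>F. LINT x:{- K..K}|lborel. (cmod (green (Complex x (1 / T)) n 1))\<^sup>2) \<le> q * (cr + cl) * T powr (- real m)"
    using cr(2) cl(2) ev eventually_ge_at_top[of "1::real"]
  proof eventually_elim
    case (elim T)
    let ?g = "\<lambda>n. LINT x:{- K..K}|lborel. (cmod (green (Complex x (1 / T)) n 1))\<^sup>2"
    define N where "N = C * T powr \<alpha>"
    have N1: "1 \<le> N" using elim(3) C by (simp add: N_def field_simps)
    have T: "1 \<le> T" by fact
    have "T powr \<alpha> \<le> T powr 1" using \<alpha> T by (intro powr_mono) auto
    then have NT: "N \<le> C * T" using C T by (simp add: N_def)
    have finr: "finite (Ir T)"
      by (rule finite_subset[of _ "{1..\<lfloor>N\<rfloor>}"]) (auto simp: Ir_def N_def le_floor_iff)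
    have finl: "finite (Il T)"
      by (rule finite_subset[of _ "{- \<lfloor>N\<rfloor>..-1}"]) (auto simp: Il_def N_def le_floor_iff minus_le_iff)
    have ne: "1 \<in> Ir T" "-1 \<in> Il T"
      using N1 by (auto simp: Ir_def Il_def N_def)
    have pre: "2 * T\<^sup>2 * (1 + (N * (K + b + 3) + 1) * T\<^sup>2)\<^sup>2 \<le> q * T ^ 8"
    proof -
      have "N * (K + b + 3) \<le> C * T * (K + b + 3)"
        using NT K b0 by (intro mult_right_mono) auto
      then have "(N * (K + b + 3) + 1) * T\<^sup>2 \<le> (C * T * (K + b + 3) + T) * T\<^sup>2"
        using T by (intro mult_right_mono) auto
      moreover have "1 \<le> T ^ 3" using T by simp
      ultimately have "1 + (N * (K + b + 3) + 1) * T\<^sup>2 \<le> (2 + C * (K + b + 3)) * T ^ 3"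
        by (simp add: power3_eq_cube power2_eq_square algebra_simps)
      then have "(1 + (N * (K + b + 3) + 1) * T\<^sup>2)\<^sup>2 \<le> ((2 + C * (K + b + 3)) * T ^ 3)\<^sup>2"
        using N1 K b0 by (intro power_mono) (auto intro!: add_nonneg_nonneg mult_nonneg_nonneg)
      then have "2 * T\<^sup>2 * (1 + (N * (K + b + 3) + 1) * T\<^sup>2)\<^sup>2 \<le> 2 * T\<^sup>2 * ((2 + C * (K + b + 3)) * T ^ 3)\<^sup>2"
        by (intro mult_left_mono) auto
      also have "\<dots> = q * T ^ 8"
        by (simp add: q_def power_mult_distrib flip: power_mult power_add)
      finally show ?thesis .
    qed
    have pw: "T ^ 8 * T powr (- real (m + 8)) = T powr (- real m)"
    proof -
      have "T ^ 8 = T powr 8" using T powr_realpow[of T 8] by simp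
      moreover have "T powr 8 * T powr (- real (m + 8)) = T powr (8 + - real (m + 8))"
        by (rule powr_add[symmetric])
      ultimately show ?thesis by simp
    qed
    have part: "(\<Sum>n\<in>F. ?g n) \<le> q * c * T powr (- real m)"
      if "finite F" "finite I" "I \<noteq> {}"
        and IF: "\<And>k n. k \<in> I \<Longrightarrow> n \<in> F \<Longrightarrow> 0 < k \<and> k < n \<or> k < 0 \<and> n < k"
        and IN: "\<And>k. k \<in> I \<Longrightarrow> \<bar>real_of_int k\<bar> \<le> N"
        and J: "norm (J (\<lambda>_. I) T) \<le> c * norm (T powr (- real (m + 8)))" and "0 < c" for F I c
    proof -
      have "(\<Sum>n\<in>F. ?g n) \<le> 2 * T\<^sup>2 * (1 + (N * (K + b + 3) + 1) * T\<^sup>2)\<^sup>2 * J (\<lambda>_. I) T"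
        unfolding J_def by (rule sum_integral_green_le[OF T that(1-3) IF IN b])
      also have "\<dots> \<le> 2 * T\<^sup>2 * (1 + (N * (K + b + 3) + 1) * T\<^sup>2)\<^sup>2 * (c * T powr (- real (m + 8)))"
        using J by (intro mult_left_mono) auto
      also have "\<dots> \<le> q * T ^ 8 * (c * T powr (- real (m + 8)))"
        using \<open>0 < c\<close> by (intro mult_right_mono pre) auto
      also have "\<dots> = q * c * (T ^ 8 * T powr (- real (m + 8)))"
        by (simp only: mult_ac)
      finally show ?thesis unfolding pw .
    qed
    show ?case
    proof (intro allI impI)
      fix F :: "int set" assume F: "finite F" "\<forall>n\<in>F. C * T powr \<alpha> < \<bar>real_of_int n\<bar>"
      have *: "F = {n\<in>F. 0 < n} \<union> {n\<in>F. n < 0}"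
        using F(2) N1 by (force simp: N_def)
      have "(\<Sum>n\<in>F. ?g n) = (\<Sum>n\<in>{n\<in>F. 0 < n}. ?g n) + (\<Sum>n\<in>{n\<in>F. n < 0}. ?g n)"
        by (subst *, rule sum.union_disjoint) (use F in auto)
      also have "\<dots> \<le> q * cr * T powr (- real m) + q * cl * T powr (- real m)"
      proof (rule add_mono)
        show "(\<Sum>n\<in>{n\<in>F. 0 < n}. ?g n) \<le> q * cr * T powr (- real m)"
        proof (rule part[of _ "Ir T"])
          show "norm (J (\<lambda>_. Ir T) T) \<le> cr * norm (T powr - real (m + 8))"
            using elim(1) by (simp add: J_def)
          show "0 < k \<and> k < n \<or> k < 0 \<and> n < k" if "k \<in> Ir T" "n \<in> {n\<in>F. 0 < n}" for k n
          proof -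
            have "real_of_int k < real_of_int n" using that F(2) by (fastforce simp: Ir_def)
            then show ?thesis using that by (auto simp: Ir_def)
          qed
        qed (use F(1) finr ne cr(1) in \<open>auto simp: Ir_def N_def\<close>)
        show "(\<Sum>n\<in>{n\<in>F. n < 0}. ?g n) \<le> q * cl * T powr (- real m)"
        proof (rule part[of _ "Il T"])
          show "norm (J (\<lambda>_. Il T) T) \<le> cl * norm (T powr - real (m + 8))"
            using elim(2) by (simp add: J_def)
          show "0 < k \<and> k < n \<or> k < 0 \<and> n < k" if "k \<in> Il T" "n \<in> {n\<in>F. n < 0}" for k n
          proof -
            have "real_of_int n < real_of_int k" using that F(2) by (fastforce simp: Il_def)
            then show ?thesis using that by (auto simp: Il_def)
          qed
        qed (use F(1) finl ne cl(1) in \<open>auto simp: Il_def N_def\<close>)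
      qed
      finally show "(\<Sum>n\<in>F. ?g n) \<le> q * (cr + cl) * T powr (- real m)"
        by (simp add: algebra_simps)
    qed
  qed
  then show ?thesis using q0 cr(1) cl(1) by (intro exI[of _ "q * (cr + cl)"]) auto
qed

end

lemma ereal_le_if_le_all_greater:
  fixes x :: ereal and a :: real
  assumes "\<And>b. a < b \<Longrightarrow> x \<le> ereal b"
  shows "x \<le> ereal a"
proof (rule ereal_le_epsilon2)
  fix e :: real assume "0 < e"
  then show "x \<le> ereal a + ereal e" using assms[of "a + e"] by simp
qed

context transfer_decay
begin

text \<open>\<open>avg_prob_bound\<close> at time \<open>T\<close> uses the height
  \<open>1 / (2 * T)\<close>, hence the range \<open>C * (2 * T) powr \<alpha>\<close>. The exponent
  \<open>m + 1\<close> leaves one power of \<open>T\<close> to absorb the constant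
  \<open>c'\<close>.\<close>

lemma avg_prob_rapid:
  "\<forall>\<^sub>F T in at_top. \<forall>F. finite F \<longrightarrow> (\<forall>n\<in>F. C * (2 * T) powr \<alpha> < \<bar>real_of_int n\<bar>) \<longrightarrow>
     (\<Sum>n\<in>F. avg_prob V n T) \<le> T powr (- real m)"
proof -
  obtain c where c: "0 \<le> c" "\<forall>\<^sub>F T in at_top. \<forall>F. finite F \<longrightarrow> (\<forall>n\<in>F. C * T powr \<alpha> < \<bar>real_of_int n\<bar>) \<longrightarrow>
     (\<Sum>n\<in>F. LINT x:{- K..K}|lborel. (cmod (green (Complex x (1 / T)) n 1))\<^sup>2) \<le> c * T powr (- real (m + 1))"
    using sum_integral_green_rapid by blast
  have "filterlim (\<lambda>T::real. 2 * T) at_top at_top"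
    by (rule filterlim_tendsto_pos_mult_at_top[OF tendsto_const _ filterlim_ident]) simp
  from eventually_compose_filterlim[OF c(2) this]
  have ev: "\<forall>\<^sub>F T in at_top. \<forall>F. finite F \<longrightarrow> (\<forall>n\<in>F. C * (2 * T) powr \<alpha> < \<bar>real_of_int n\<bar>) \<longrightarrow>
     (\<Sum>n\<in>F. LINT x:{- K..K}|lborel. (cmod (green (Complex x (1 / (2 * T))) n 1))\<^sup>2) \<le> c * (2 * T) powr (- real (m + 1))" .
  obtain B where B: "1 \<le> B" "\<And>x y n s. \<bar>x\<bar> = K \<Longrightarrow> \<bar>y\<bar> \<le> 1 \<Longrightarrow> n \<noteq> 0 \<Longrightarrow>
     (cmod (green (Complex x y) n 1))\<^sup>2 \<le> B\<^sup>2 * (fact s * (8 * B\<^sup>2 / \<bar>real_of_int n\<bar>) ^ s)"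
    using green_decay_side by blast
  \<comment> \<open>On the vertical sides \<open>r\<close> powers of 1/|n| become T^(- (m + 1)), as
    |n| exceeds a multiple of \<open>T powr \<alpha>\<close>; the two powers added in
    \<open>s\<close> make the sum over \<open>n\<close> converge.\<close>
  obtain r :: nat where r: "real (m + 1) / \<alpha> \<le> real r" using real_arch_simple by blast
  define s where "s = r + 2"
  define d where "d = B\<^sup>2 * (fact s * (8 * B\<^sup>2) ^ s)"
  have d0: "0 \<le> d" by (simp add: d_def)
  define c' where "c' = 4 * K * c + 8 * d / C ^ r"
  show ?thesis
    using ev eventually_ge_at_top[of "max 1 c'"]
  proof eventually_elim
    case (elim T)
    then have T: "1 \<le> T" "c' \<le> T" by auto
    show ?case
    proof (intro allI impI)
      fix F :: "int set" assume F: "finite F" "\<forall>n\<in>F. C * (2 * T) powr \<alpha> < \<bar>real_of_int n\<bar>"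
      define N where "N = C * (2 * T) powr \<alpha>"
      have N: "0 < N" using C T by (simp add: N_def)
      have F0: "0 \<notin> F" using F(2) N by (force simp: N_def)
      have "avg_prob V n T \<le> 4 * K * (LINT x:{- K..K}|lborel. (cmod (green (Complex x (1 / (2 * T))) n 1))\<^sup>2)
          + 2 * d / N ^ r * (1 / \<bar>real_of_int n\<bar>\<^sup>2)" if n: "n \<in> F" for n
      proof -
        define D where "D = sqrt (B\<^sup>2 * (fact s * (8 * B\<^sup>2 / \<bar>real_of_int n\<bar>) ^ s))"
        have n0: "n \<noteq> 0" "N \<le> \<bar>real_of_int n\<bar>" using n F0 F(2) by (auto simp: N_def less_imp_le)
        have D: "cmod (green (Complex x y) n 1) \<le> D" if "\<bar>x\<bar> = K" "\<bar>y\<bar> \<le> 1" for x y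
          unfolding D_def by (rule real_le_rsqrt) (rule B(2)[OF that n0(1)])
        have "D\<^sup>2 = d / \<bar>real_of_int n\<bar> ^ s"
          by (simp add: D_def d_def power_divide)
        also have "\<bar>real_of_int n\<bar> ^ s = \<bar>real_of_int n\<bar> ^ r * \<bar>real_of_int n\<bar>\<^sup>2"
          by (simp only: s_def power_add)
        also have "d / (\<bar>real_of_int n\<bar> ^ r * \<bar>real_of_int n\<bar>\<^sup>2) \<le> d / (N ^ r * \<bar>real_of_int n\<bar>\<^sup>2)"
          using n0 N d0 by (intro divide_left_mono mult_right_mono power_mono) auto
        finally have "2 * D\<^sup>2 \<le> 2 * d / N ^ r * (1 / \<bar>real_of_int n\<bar>\<^sup>2)" by simp
        then show ?thesis using avg_prob_bound[OF T(1) D] by linarith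
      qed
      then have "(\<Sum>n\<in>F. avg_prob V n T) \<le>
          (\<Sum>n\<in>F. 4 * K * (LINT x:{- K..K}|lborel. (cmod (green (Complex x (1 / (2 * T))) n 1))\<^sup>2)
            + 2 * d / N ^ r * (1 / \<bar>real_of_int n\<bar>\<^sup>2))"
        by (rule sum_mono)
      also have "\<dots> = 4 * K * (\<Sum>n\<in>F. LINT x:{- K..K}|lborel. (cmod (green (Complex x (1 / (2 * T))) n 1))\<^sup>2)
            + 2 * d / N ^ r * (\<Sum>n\<in>F. 1 / \<bar>real_of_int n\<bar>\<^sup>2)"
        by (simp only: sum.distrib sum_distrib_left)
      also have "\<dots> \<le> 4 * K * (c * (2 * T) powr (- real (m + 1))) + 2 * d / N ^ r * 4"
        using elim(1)[rule_format, of F] F K d0 N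
        by (intro add_mono mult_left_mono sum_int_inverse_squares_le_4 F0) auto
      also have "\<dots> \<le> 4 * K * (c * T powr (- real (m + 1))) + (8 * d / C ^ r) * T powr (- real (m + 1))"
      proof (intro add_mono mult_left_mono)
        show "(2 * T) powr (- real (m + 1)) \<le> T powr (- real (m + 1))"
          using T by (intro powr_mono2') auto
        have "T powr real (m + 1) \<le> T powr (\<alpha> * real r)"
          using r \<alpha> T by (intro powr_mono) (auto simp: field_simps)
        also have "\<dots> \<le> (2 * T) powr (\<alpha> * real r)"
          using T \<alpha> by (intro powr_mono2) auto
        also have "\<dots> = ((2 * T) powr \<alpha>) ^ r"
          using T by (simp add: powr_powr[symmetric] powr_realpow)
        finally have "C ^ r * T powr real (m + 1) \<le> N ^ r"
          using C by (simp add: N_def power_mult_distrib)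
        then have "8 * d / N ^ r \<le> 8 * d / (C ^ r * T powr real (m + 1))"
          using C T d0 N by (intro divide_left_mono mult_pos_pos) auto
        also have "\<dots> = (8 * d / C ^ r) * T powr (- real (m + 1))"
          by (simp only: powr_minus divide_inverse inverse_mult_distrib mult.assoc)
        finally show "2 * d / N ^ r * 4 \<le> (8 * d / C ^ r) * T powr (- real (m + 1))"
          by simp
      qed (use K c in auto)
      also have "\<dots> = c' * T powr (- real (m + 1))"
        by (simp only: c'_def distrib_right mult.assoc)
      also have "\<dots> \<le> T * T powr (- real (m + 1))"
        using T by (intro mult_right_mono) auto
      also have "\<dots> = T powr (1 + - real (m + 1))"
        using T by (subst powr_add) simp
      finally show "(\<Sum>n\<in>F. avg_prob V n T) \<le> T powr (- real m)" by simp
    qed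
  qed
qed

text \<open>Any exponent above \<alpha> absorbs the constants and the shift by 2 in the definition
  of \<open>S_plus\<close>.\<close>

lemma eventually_scale_le:
  assumes "\<alpha> < \<beta>"
  shows "\<forall>\<^sub>F T in at_top. C * (2 * T) powr \<alpha> \<le> T powr \<beta> - 2"
proof -
  have "0 < \<beta> - \<alpha>" using assms by simp
  from eventually_ge_powr[OF this, of "C * 2 powr \<alpha> + 2"] show ?thesis
    using eventually_ge_at_top[of 1]
  proof eventually_elim
    case (elim T)
    have T: "1 \<le> T powr \<alpha>" using elim(2) \<alpha> by (simp add: ge_one_powr_ge_zero)
    have "(C * 2 powr \<alpha> + 2) * T powr \<alpha> \<le> T powr (\<beta> - \<alpha>) * T powr \<alpha>"
      using elim(1) assms by (intro mult_right_mono) auto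
    also have "\<dots> = T powr \<beta>" by (simp flip: powr_add)
    finally show ?case using elim(2) T by (simp add: powr_mult distrib_right)
  qed
qed

section \<open>From rapid decay to the transport exponents\<close>

lemma outside_prob_le:
  assumes "\<And>F. finite F \<Longrightarrow> (\<forall>n\<in>F. N < ereal \<bar>real_of_int n\<bar>) \<Longrightarrow> (\<Sum>n\<in>F. avg_prob V n T) \<le> b"
  shows "outside_prob V N T \<le> b"
proof (cases "(\<lambda>n. avg_prob V n T) summable_on {n. N < ereal \<bar>real_of_int n\<bar>}")
  case True
  then show ?thesis
    unfolding outside_prob_def by (rule infsum_le_finite_sums) (use assms in auto)
next
  case False
  \<comment> \<open>Here \<open>infsum\<close> takes its default value 0, and the empty
    \<open>F\<close> shows that \<open>b\<close> is nonnegative.\<close>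
  then show ?thesis
    using assms[of "{}"] by (simp add: outside_prob_def infsum_not_exists)
qed

lemma outside_prob_nonneg: "0 < T \<Longrightarrow> 0 \<le> outside_prob V N T"
  unfolding outside_prob_def by (intro infsum_nonneg avg_prob_nonneg)

lemma S_plus_eq_PInf:
  assumes "ereal \<alpha> < \<beta>"
  shows "S_plus V \<beta> = \<infinity>"
proof -
  have *: "Limsup at_top (\<lambda>T. ext_ln (outside_prob V (ext_powr T \<beta> - 2) T) / ereal (ln T)) \<le> ereal (- real m)" for m
  proof (rule Limsup_bounded)
    \<comment> \<open>A real intermediate exponent, since \<beta> may be infinite.\<close>
    obtain \<gamma> where \<gamma>: "\<alpha> < \<gamma>" "ereal \<gamma> \<le> \<beta>"
      using assms by (metis ereal_dense2 less_ereal.simps(1) less_imp_le)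
    show "\<forall>\<^sub>F T in at_top. ext_ln (outside_prob V (ext_powr T \<beta> - 2) T) / ereal (ln T) \<le> ereal (- real m)"
      using avg_prob_rapid[of m] eventually_scale_le[OF \<gamma>(1)] eventually_gt_at_top[of 1]
    proof eventually_elim
      case (elim T)
      have lnT: "0 < ln T" using elim(3) by simp
      have "ereal (T powr \<gamma> - 2) \<le> ext_powr T \<beta> - 2"
      proof (cases \<beta>)
        case (real b)
        then have "T powr \<gamma> \<le> T powr b" using \<gamma>(2) elim(3) by (intro powr_mono) auto
        then show ?thesis using real by (simp add: ext_powr_def)
      qed (use \<gamma> in \<open>auto simp: ext_powr_def\<close>)
      then have le: "ereal (C * (2 * T) powr \<alpha>) \<le> ext_powr T \<beta> - 2"
        using elim(2) by (meson ereal_less_eq(3) order_trans)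
      define P where "P = outside_prob V (ext_powr T \<beta> - 2) T"
      have P_le: "P \<le> T powr (- real m)"
        unfolding P_def
      proof (rule outside_prob_le)
        fix F :: "int set" assume F: "finite F" "\<forall>n\<in>F. ext_powr T \<beta> - 2 < ereal \<bar>real_of_int n\<bar>"
        have "C * (2 * T) powr \<alpha> < \<bar>real_of_int n\<bar>" if "n \<in> F" for n
          using le F(2) that by (metis le_less_trans less_ereal.simps(1))
        then show "(\<Sum>n\<in>F. avg_prob V n T) \<le> T powr (- real m)"
          using elim(1) F(1) by blast
      qed
      have "0 \<le> P" unfolding P_def using elim(3) by (intro outside_prob_nonneg) simp
      have "ext_ln P / ereal (ln T) \<le> ereal (- real m)"
      proof (cases "P = 0")
        case True
        then show ?thesis using lnT by (simp add: ext_ln_def)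
      next
        case False
        then have "ln P \<le> ln (T powr (- real m))"
          using P_le \<open>0 \<le> P\<close> elim(3) by (subst ln_le_cancel_iff) auto
        then have "ln P \<le> - real m * ln T" using elim(3) by (simp add: ln_powr)
        then have "ln P / ln T \<le> - real m" using lnT by (simp add: divide_le_eq)
        then show ?thesis using False lnT by (simp add: ext_ln_def)
      qed
      then show ?case by (simp only: P_def)
    qed
  qed
  have "Limsup at_top (\<lambda>T. ext_ln (outside_prob V (ext_powr T \<beta> - 2) T) / ereal (ln T)) \<le> ereal B" for B
  proof -
    obtain m :: nat where "- B \<le> real m" using real_arch_simple by blast
    then have "ereal (- real m) \<le> ereal B" by simp
    with * show ?thesis by (rule order_trans)
  qed
  then show ?thesis unfolding S_plus_def by (subst ereal_bot) auto
qed

lemma alpha_u_plus_le: "alpha_u_plus V \<le> ereal \<alpha>"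
  unfolding alpha_u_plus_def
proof (rule Sup_least)
  fix \<beta> assume "\<beta> \<in> {\<alpha>. 0 \<le> \<alpha> \<and> S_plus V \<alpha> < \<infinity>}"
  then show "\<beta> \<le> ereal \<alpha>" using S_plus_eq_PInf[of \<beta>] by (force simp: not_le)
qed

lemma sum_moment_far_le:
  assumes p: "0 < p"
  shows "\<exists>c\<ge>0. \<forall>T\<ge>1. \<forall>F. finite F \<longrightarrow> (\<forall>n\<in>F. T ^ 3 < \<bar>real_of_int n\<bar>) \<longrightarrow>
     (\<Sum>n\<in>F. \<bar>real_of_int n\<bar> powr p * avg_prob V n T) \<le> c"
proof -
  \<comment> \<open>Beyond T^3 the factor T^(2 s + 2) is at most |n|^((2 s + 2) / 3), so a summand
    is of order |n|^(p + (2 - s) / 3). The choice of \<open>s\<close> makes this exponent at most -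
    2. A cube is used because the threshold exponent must exceed 2.\<close>
  obtain s :: nat where s: "3 * p + 8 \<le> real s" using real_arch_simple by blast
  obtain c where c: "0 \<le> c" "\<And>T n. 1 \<le> T \<Longrightarrow> n \<noteq> 0 \<Longrightarrow> avg_prob V n T \<le> c * T ^ (2 * s + 2) / \<bar>real_of_int n\<bar> ^ s"
    using avg_prob_decay[of s] by blast
  have "(\<Sum>n\<in>F. \<bar>real_of_int n\<bar> powr p * avg_prob V n T) \<le> 4 * c"
    if T: "1 \<le> T" and F: "finite F" "\<forall>n\<in>F. T ^ 3 < \<bar>real_of_int n\<bar>" for T F
  proof -
    have F0: "0 \<notin> F" using F(2) T by (force dest: bspec[of _ _ 0])
    have "\<bar>real_of_int n\<bar> powr p * avg_prob V n T \<le> c * (1 / \<bar>real_of_int n\<bar>\<^sup>2)" if n: "n \<in> F" for n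
    proof -
      define x where "x = \<bar>real_of_int n\<bar>"
      have n0: "n \<noteq> 0" using n F0 by auto
      have "T ^ 3 < x" using F(2) n by (simp add: x_def)
      moreover have "1 \<le> T ^ 3" using T by simp
      moreover have "T powr 3 = T ^ 3" using T powr_realpow[of T 3] by simp
      ultimately have x: "1 \<le> x" "T powr 3 \<le> x"
        by linarith+
      have "T ^ (2 * s + 2) = T powr real (2 * s + 2)"
        using T by (intro powr_realpow[symmetric]) simp
      also have "\<dots> = (T powr 3) powr (real (2 * s + 2) / 3)"
      proof -
        have "3 * (x / 3) = x" for x :: real by simp
        then show ?thesis by (simp only: powr_powr)
      qed
      also have "\<dots> \<le> x powr (real (2 * s + 2) / 3)"
        using x by (intro powr_mono2) auto
      finally have T_le: "T ^ (2 * s + 2) \<le> x powr (real (2 * s + 2) / 3)" .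
      have "x powr p * avg_prob V n T \<le> x powr p * (c * T ^ (2 * s + 2) / x ^ s)"
        unfolding x_def by (intro mult_left_mono c(2) T n0) auto
      also have "\<dots> \<le> x powr p * (c * x powr (real (2 * s + 2) / 3) / x ^ s)"
        using c(1) x by (intro mult_left_mono divide_right_mono T_le) auto
      also have "\<dots> = c * x powr (p + real (2 * s + 2) / 3 - real s)"
        using x by (simp add: powr_add powr_diff powr_realpow)
      also have "\<dots> \<le> c * x powr (- 2)"
        using x s c(1) by (intro mult_left_mono powr_mono) (auto simp: field_simps)
      also have "x powr (- 2) = 1 / x\<^sup>2"
        using x powr_realpow[of x 2] by (simp add: powr_minus divide_inverse)
      finally show ?thesis by (simp add: x_def)
    qed
    then have "(\<Sum>n\<in>F. \<bar>real_of_int n\<bar> powr p * avg_prob V n T) \<le> (\<Sum>n\<in>F. c * (1 / \<bar>real_of_int n\<bar>\<^sup>2))"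
      by (rule sum_mono)
    also have "\<dots> = c * (\<Sum>n\<in>F. 1 / \<bar>real_of_int n\<bar>\<^sup>2)" by (simp only: sum_distrib_left)
    also have "\<dots> \<le> c * 4"
      using c(1) sum_int_inverse_squares_le_4[OF F(1) F0] by (rule mult_left_mono[rotated])
    finally show ?thesis by simp
  qed
  then show ?thesis using c(1) by (intro exI[of _ "4 * c"]) auto
qed

text \<open>Sites up to \<open>T powr \<gamma>\<close> are counted with total probability at most \<open>1\<close>, those up to \<open>T ^ 3\<close> by the
  rapid decay of the outside probabilities, and the remaining ones by the decay of the
  Green function in the upper half plane alone.\<close>

lemma sum_moment_le:
  assumes p: "0 < p" and \<beta>: "\<alpha> < \<beta>"
  shows "\<forall>\<^sub>F T in at_top. \<forall>F. finite F \<longrightarrow> (\<Sum>n\<in>F. \<bar>real_of_int n\<bar> powr p * avg_prob V n T) \<le> T powr (\<beta> * p)"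
proof -
  \<comment> \<open>The gap between \<alpha> and \<gamma> makes the far sites improbable; the gap
    between \<gamma> and \<beta> absorbs the constant \<open>2 + c\<close>.\<close>
  define \<gamma> where "\<gamma> = (\<alpha> + \<beta>) / 2"
  have \<gamma>: "\<alpha> < \<gamma>" "\<gamma> < \<beta>" using \<beta> by (auto simp: \<gamma>_def)
  obtain c where c: "0 \<le> c" "\<And>T F. 1 \<le> T \<Longrightarrow> finite F \<Longrightarrow> \<forall>n\<in>F. T ^ 3 < \<bar>real_of_int n\<bar> \<Longrightarrow>
     (\<Sum>n\<in>F. \<bar>real_of_int n\<bar> powr p * avg_prob V n T) \<le> c"
    using sum_moment_far_le[OF p] by blast
  \<comment> \<open>Chosen so that the largest weight (T^3)^p in the middle range is outweighed by
    the probability T^(- m).\<close>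
  obtain m :: nat where m: "3 * p \<le> real m" using real_arch_simple by blast
  have "0 < (\<beta> - \<gamma>) * p" using \<gamma> p by simp
  from eventually_ge_powr[OF this, of "2 + c"] show ?thesis
    using avg_prob_rapid[of m] eventually_scale_le[OF \<gamma>(1)] eventually_ge_at_top[of 1]
  proof eventually_elim
    case (elim T)
    have T: "1 \<le> T" by fact
    let ?f = "\<lambda>n. \<bar>real_of_int n\<bar> powr p * avg_prob V n T"
    show ?case
    proof (intro allI impI)
      fix F :: "int set" assume F: "finite F"
      define F1 where "F1 = {n\<in>F. \<bar>real_of_int n\<bar> \<le> T powr \<gamma>}"
      define F2 where "F2 = {n\<in>F. T powr \<gamma> < \<bar>real_of_int n\<bar> \<and> \<bar>real_of_int n\<bar> \<le> T ^ 3}"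
      define F3 where "F3 = {n\<in>F. T powr \<gamma> < \<bar>real_of_int n\<bar> \<and> T ^ 3 < \<bar>real_of_int n\<bar>}"
      have fin: "finite F1" "finite F2" "finite F3" using F by (auto simp: F1_def F2_def F3_def)
      have nn: "0 \<le> avg_prob V n T" for n using T by (intro avg_prob_nonneg) simp
      have "F = F1 \<union> (F2 \<union> F3)" by (auto simp: F1_def F2_def F3_def)
      moreover have "F1 \<inter> (F2 \<union> F3) = {}" "F2 \<inter> F3 = {}"
        by (auto simp: F1_def F2_def F3_def)
      ultimately have "(\<Sum>n\<in>F. ?f n) = (\<Sum>n\<in>F1. ?f n) + ((\<Sum>n\<in>F2. ?f n) + (\<Sum>n\<in>F3. ?f n))"
        using fin by (simp add: sum.union_disjoint)
      also have "\<dots> \<le> T powr (\<gamma> * p) + (1 + c)"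
      proof (intro add_mono)
        have "(\<Sum>n\<in>F1. ?f n) \<le> (\<Sum>n\<in>F1. (T powr \<gamma>) powr p * avg_prob V n T)"
          using p by (intro sum_mono mult_right_mono powr_mono2 nn) (auto simp: F1_def)
        also have "\<dots> = (T powr \<gamma>) powr p * (\<Sum>n\<in>F1. avg_prob V n T)"
          by (simp only: sum_distrib_left)
        also have "\<dots> \<le> (T powr \<gamma>) powr p * 1"
          using T by (intro mult_left_mono sum_avg_prob_le_1 fin) auto
        finally show "(\<Sum>n\<in>F1. ?f n) \<le> T powr (\<gamma> * p)" by (simp add: powr_powr)
        have "(\<Sum>n\<in>F2. ?f n) \<le> (\<Sum>n\<in>F2. (T ^ 3) powr p * avg_prob V n T)"
          using p by (intro sum_mono mult_right_mono powr_mono2 nn) (auto simp: F2_def)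
        also have "\<dots> = (T ^ 3) powr p * (\<Sum>n\<in>F2. avg_prob V n T)"
          by (simp only: sum_distrib_left)
        also have "\<dots> \<le> T powr real m * T powr (- real m)"
        proof (intro mult_mono)
          have "T ^ 3 = T powr 3" using T powr_realpow[of T 3] by simp
          then have "(T ^ 3) powr p = T powr (3 * p)" by (simp add: powr_powr)
          also have "\<dots> \<le> T powr real m" using m T by (intro powr_mono) auto
          finally show "(T ^ 3) powr p \<le> T powr real m" .
          have "C * (2 * T) powr \<alpha> < \<bar>real_of_int n\<bar>" if "n \<in> F2" for n
            using that elim(3) by (auto simp: F2_def)
          then show "(\<Sum>n\<in>F2. avg_prob V n T) \<le> T powr (- real m)"
            using elim(2) fin by blast
        qed (auto intro: sum_nonneg nn)
        also have "\<dots> = 1" using T by (simp flip: powr_add)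
        finally show "(\<Sum>n\<in>F2. ?f n) \<le> 1" .
        show "(\<Sum>n\<in>F3. ?f n) \<le> c"
          by (rule c(2)[OF T fin(3)]) (auto simp: F3_def)
      qed
      also have "\<dots> \<le> (2 + c) * T powr (\<gamma> * p)"
      proof -
        have "1 \<le> T powr (\<gamma> * p)" using T \<gamma> \<alpha> p by (intro ge_one_powr_ge_zero) auto
        then have "(1 + c) * 1 \<le> (1 + c) * T powr (\<gamma> * p)" using c(1) by (intro mult_left_mono) auto
        then show ?thesis by (simp add: algebra_simps)
      qed
      also have "\<dots> \<le> T powr ((\<beta> - \<gamma>) * p) * T powr (\<gamma> * p)"
        using elim(1) by (intro mult_right_mono) auto
      also have "\<dots> = T powr (\<beta> * p)"
        by (simp add: algebra_simps flip: powr_add)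
      finally show "(\<Sum>n\<in>F. ?f n) \<le> T powr (\<beta> * p)" .
    qed
  qed
qed

lemma beta_plus_le:
  assumes p: "0 < p"
  shows "beta_plus V p \<le> ereal \<alpha>"
proof (rule ereal_le_if_le_all_greater)
  fix \<beta> assume \<beta>: "\<alpha> < \<beta>"
  show "beta_plus V p \<le> ereal \<beta>"
    unfolding beta_plus_def
  proof (rule Limsup_bounded)
    show "\<forall>\<^sub>F T in at_top. ereal (ln (moment V p T) / (p * ln T)) \<le> ereal \<beta>"
      using sum_moment_le[OF p \<beta>] eventually_gt_at_top[of 1]
    proof eventually_elim
      case (elim T)
      let ?f = "\<lambda>n. \<bar>real_of_int n\<bar> powr p * avg_prob V n T"
      have pT: "0 < p * ln T" using p elim(2) by simp
      have "0 \<le> moment V p T"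
        unfolding moment_def using elim(2) by (intro infsum_nonneg mult_nonneg_nonneg avg_prob_nonneg) auto
      have le: "moment V p T \<le> T powr (\<beta> * p)"
      proof (cases "?f summable_on UNIV")
        case True
        then show ?thesis
          unfolding moment_def by (rule infsum_le_finite_sums) (use elim(1) in auto)
      qed (simp add: moment_def infsum_not_exists)
      show ?case
      \<comment> \<open>With the convention \<open>ln 0 = 0\<close> the quotient is 0 in the
        degenerate case, and 0 < \<alpha> < \<beta> settles it.\<close>
      proof (cases "moment V p T = 0")
        case True
        then show ?thesis using \<beta> \<alpha> by simp
      next
        case False
        then have "ln (moment V p T) \<le> ln (T powr (\<beta> * p))"
          using le \<open>0 \<le> moment V p T\<close> elim(2) by (subst ln_le_cancel_iff) auto
        then have "ln (moment V p T) \<le> \<beta> * (p * ln T)" using elim(2) by (simp add: ln_powr)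
        then show ?thesis using pT by (simp add: divide_le_eq)
      qed
    qed
  qed
qed

end

theorem theorem1:
  fixes V :: "int \<Rightarrow> real" and K C \<alpha> :: real
  assumes "bounded (range V)"
    and "K \<ge> 4"
    and "spectrum (schroedinger V) \<subseteq> complex_of_real ` {- K + 1..K - 1}"
    and "0 < C"
    and "0 < \<alpha>" and "\<alpha> < 1"
    and "\<And>m :: nat. m \<ge> 1 \<Longrightarrow>
      (\<lambda>T :: real. LINT E:{- K..K}|lborel.
         inverse (MAX n\<in>{n :: int. 1 \<le> n \<and> real_of_int n \<le> C * T powr \<alpha>}.
           (matrix_opnorm (transfer_matrix V n (Complex E (1 / T))))\<^sup>2))
        \<in> O[at_top](\<lambda>T. T powr (- real m))"
    and "\<And>m :: nat. m \<ge> 1 \<Longrightarrow>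
      (\<lambda>T :: real. LINT E:{- K..K}|lborel.
         inverse (MAX n\<in>{n :: int. 1 \<le> - n \<and> real_of_int (- n) \<le> C * T powr \<alpha>}.
           (matrix_opnorm (transfer_matrix V n (Complex E (1 / T))))\<^sup>2))
        \<in> O[at_top](\<lambda>T. T powr (- real m))"
  shows "alpha_u_plus V \<le> ereal \<alpha> \<and> (\<forall>p > 0. beta_plus V p \<le> ereal \<alpha>)"
proof -
  interpret transfer_decay V K C \<alpha>
    by unfold_locales (fact assms)+
  show ?thesis using alpha_u_plus_le beta_plus_le by blast
qed

end
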